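(* Let $D$ be a nuclear positive-definite self-adjoint operator on $E$ whose eigenvectors are the basis vectors of $\mathcal E$. If $D^{1/2}$ is nuclear, then the semigroup $\mathcal U_{tD}$, $t\ge0$, on $\mathcal H_{\mathcal E}$ is strongly continuous.
   Context: $E$ is an infinite-dimensional real separable Hilbert space with orthonormal basis $\mathcal E=\{e_k\}_{k\in\mathbb N}$; $x_k=(x,e_k)$. A block is a set $\Pi_{a,b}=\{x\in E: x_j\in[a_j,b_j)\ \forall j\}$ with $a,b\in\ell_\infty$, $a_j<b_j$; it is absolutely measurable if it is empty or $\sum_j\max\{0,\ln(b_j-a_j)\}<\infty$. Put $\lambda_{\mathcal E}(\Pi_{a,b})=\prod_j(b_j-a_j)$ if $\Pi_{a,b}\ne\emptyset$ (value $0$ if the product diverges to $0$), and $\lambda_{\mathcal E}(\emptyset)=0$. It is known that $\lambda_{\mathcal E}$ extends uniquely to a finitely additive shift-invariant measure on the ring generated by absolutely measurable blocks, and then to the completion $\mathcal R_{\mathcal E}$ of this ring. $\mathcal H_{\mathcal E}$ is the complex Hilbert space obtained by completing (modulo the null space) the space of finite sums $\sum c_k\chi_{B_k}$, $c_k\in\mathbb C$, $B_k\in\mathcal R_{\mathcal E}$ pairwise disjoint, in the norm $(\sum|c_k|^2\lambda_{\mathcal E}(B_k))^{1/2}$. For $h\in E$, $S_hf(x)=f(x-h)$ (unitary on $\mathcal H_{\mathcal E}$). $\mathcal U_{tD}f=\int_ES_hf\,d\nu_{tD}(h)$ (Pettis integral), where $\nu_{tD}$ is the centered Gaussian measure on $E$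 with covariance operator $tD$, i.e. with Fourier transform $\exp(-\frac t2(D\xi,\xi))$. *)

theory Defs
  imports "HOL-Probability.Probability"
begin

class complex_hilbert = banach +
  fixes scaleC :: "complex \<Rightarrow> 'a \<Rightarrow> 'a" (infixr \<open>*\<^sub>C\<close> 75)
    and cinner :: "'a \<Rightarrow> 'a \<Rightarrow> complex"
  assumes scaleC_add_right: "c *\<^sub>C (x + y) = c *\<^sub>C x + c *\<^sub>C y"
    and scaleC_add_left: "(c + d) *\<^sub>C x = c *\<^sub>C x + d *\<^sub>C x"
    and scaleC_scaleC: "c *\<^sub>C d *\<^sub>C x = (c * d) *\<^sub>C x"
    and scaleR_scaleC: "r *\<^sub>R x = complex_of_real r *\<^sub>C x"
    and cinner_commute: "cinner x y = cnj (cinner y x)"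
    and cinner_add_left: "cinner (x + y) z = cinner x z + cinner y z"
    and cinner_scaleC_left: "cinner (c *\<^sub>C x) y = c * cinner x y"
    and norm_eq_sqrt_cinner: "norm x = sqrt (Re (cinner x x))"

definition bounded_clinear :: "('h::complex_hilbert \<Rightarrow> 'h) \<Rightarrow> bool" where
  "bounded_clinear T \<longleftrightarrow> bounded_linear T \<and> (\<forall>c x. T (c *\<^sub>C x) = c *\<^sub>C T x)"

definition bounded_cfunctional :: "('h::complex_hilbert \<Rightarrow> complex) \<Rightarrow> bool" where
  "bounded_cfunctional \<phi> \<longleftrightarrow> bounded_linear \<phi> \<and> (\<forall>c x. \<phi> (c *\<^sub>C x) = c * \<phi> x)"

definition strongly_continuous_semigroup :: "(real \<Rightarrow> 'h::complex_hilbert \<Rightarrow> 'h) \<Rightarrow> bool" where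
  "strongly_continuous_semigroup U \<longleftrightarrow>
     (\<forall>t\<ge>0. bounded_clinear (U t)) \<and>
     (\<forall>f. U 0 f = f) \<and>
     (\<forall>s\<ge>0. \<forall>t\<ge>0. \<forall>f. U (s + t) f = U s (U t f)) \<and>
     (\<forall>f. continuous_on {0..} (\<lambda>t. U t f))"

definition has_pettis_integral :: "'w measure \<Rightarrow> ('w \<Rightarrow> 'h::complex_hilbert) \<Rightarrow> 'h \<Rightarrow> bool" where
  "has_pettis_integral M F y \<longleftrightarrow>
     (\<forall>\<phi>. bounded_cfunctional \<phi> \<longrightarrow>
        integrable M (\<lambda>w. \<phi> (F w)) \<and> (\<integral>w. \<phi> (F w) \<partial>M) = \<phi> y)"

definition orthonormal_basis :: "(nat \<Rightarrow> 'a::{real_inner,complete_space}) \<Rightarrow> bool" where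
  "orthonormal_basis e \<longleftrightarrow>
     (\<forall>i j. e i \<bullet> e j = (if i = j then 1 else 0)) \<and> closure (span (range e)) = UNIV"

definition selfadjoint :: "('a::real_inner \<Rightarrow> 'a) \<Rightarrow> bool" where
  "selfadjoint T \<longleftrightarrow> bounded_linear T \<and> (\<forall>x y. T x \<bullet> y = x \<bullet> T y)"

definition positive_definite :: "('a::real_inner \<Rightarrow> 'a) \<Rightarrow> bool" where
  "positive_definite T \<longleftrightarrow> (\<forall>x. x \<noteq> 0 \<longrightarrow> T x \<bullet> x > 0)"

definition nuclear :: "('a::real_inner \<Rightarrow> 'a) \<Rightarrow> bool" where
  "nuclear T \<longleftrightarrow>
     (\<exists>x y. summable (\<lambda>n. norm (x n) * norm (y n)) \<and> (\<forall>v. (\<lambda>n. (v \<bullet> x n) *\<^sub>R y n) sums T v))"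

definition sqrt_op :: "('a::real_inner \<Rightarrow> 'a) \<Rightarrow> 'a \<Rightarrow> 'a" where
  "sqrt_op T = (THE R. selfadjoint R \<and> (\<forall>x. R x \<bullet> x \<ge> 0) \<and> R \<circ> R = T)"

definition centered_gaussian :: "('a::{real_inner,complete_space} \<Rightarrow> 'a) \<Rightarrow> 'a measure \<Rightarrow> bool" where
  "centered_gaussian C M \<longleftrightarrow>
     prob_space M \<and> sets M = sets borel \<and>
     (\<forall>\<xi>. (\<integral>x. iexp (x \<bullet> \<xi>) \<partial>M) = complex_of_real (exp (- (C \<xi> \<bullet> \<xi>) / 2)))"

definition gaussian_measure :: "('a::{real_inner,complete_space} \<Rightarrow> 'a) \<Rightarrow> 'a measure" where
  "gaussian_measure C = (THE M. centered_gaussian C M)"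

definition block :: "(nat \<Rightarrow> 'a::real_inner) \<Rightarrow> (nat \<Rightarrow> real) \<Rightarrow> (nat \<Rightarrow> real) \<Rightarrow> 'a set" where
  "block e a b = {x. \<forall>j. a j \<le> x \<bullet> e j \<and> x \<bullet> e j < b j}"

definition block_bounds :: "(nat \<Rightarrow> real) \<Rightarrow> (nat \<Rightarrow> real) \<Rightarrow> bool" where
  "block_bounds a b \<longleftrightarrow> bounded (range a) \<and> bounded (range b) \<and> (\<forall>j. a j < b j)"

definition abs_measurable :: "(nat \<Rightarrow> 'a::real_inner) \<Rightarrow> (nat \<Rightarrow> real) \<Rightarrow> (nat \<Rightarrow> real) \<Rightarrow> bool" where
  "abs_measurable e a b \<longleftrightarrow>
     block_bounds a b \<and> (block e a b = {} \<or> summable (\<lambda>j. max 0 (ln (b j - a j))))"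

text \<open>
  The limit of partial products is used instead of \<^const>\<open>prodinf\<close>, because the latter does not
  assign the value 0 to a product diverging to 0.
\<close>

definition block_volume :: "(nat \<Rightarrow> 'a::real_inner) \<Rightarrow> (nat \<Rightarrow> real) \<Rightarrow> (nat \<Rightarrow> real) \<Rightarrow> real" where
  "block_volume e a b = (if block e a b = {} then 0 else lim (\<lambda>n. \<Prod>j<n. (b j - a j)))"

definition block_ring :: "(nat \<Rightarrow> 'a::real_inner) \<Rightarrow> 'a set set" where
  "block_ring e = \<Inter>{R. ring_of_sets UNIV R \<and> {block e a b |a b. abs_measurable e a b} \<subseteq> R}"

text \<open>
  The finitely additive, shift-invariant extension of \<^const>\<open>block_volume\<close> to the ring. The value 0
  outside the ring only serves to make it unique as a function on all sets.
\<close>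

definition ring_measure :: "(nat \<Rightarrow> 'a::real_inner) \<Rightarrow> 'a set \<Rightarrow> real" where
  "ring_measure e = (THE m.
     (\<forall>A\<in>block_ring e. 0 \<le> m A) \<and>
     additive (block_ring e) m \<and>
     (\<forall>A\<in>block_ring e. \<forall>h. m ((+) h ` A) = m A) \<and>
     (\<forall>a b. abs_measurable e a b \<longrightarrow> m (block e a b) = block_volume e a b) \<and>
     (\<forall>A. A \<notin> block_ring e \<longrightarrow> m A = 0))"

definition outer_lam :: "(nat \<Rightarrow> 'a::real_inner) \<Rightarrow> 'a set \<Rightarrow> real" where
  "outer_lam e A = Inf {ring_measure e B |B. B \<in> block_ring e \<and> A \<subseteq> B}"

definition inner_lam :: "(nat \<Rightarrow> 'a::real_inner) \<Rightarrow> 'a set \<Rightarrow> real" where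
  "inner_lam e A = Sup {ring_measure e B |B. B \<in> block_ring e \<and> B \<subseteq> A}"

text \<open>
  As the measure is only finitely additive, the completion of the ring is the one with respect to
  finite covers (Jordan completion): the sets whose inner and outer measures are finite and equal.
\<close>

definition completed_ring :: "(nat \<Rightarrow> 'a::real_inner) \<Rightarrow> 'a set set" where
  "completed_ring e = {A. (\<exists>B\<in>block_ring e. A \<subseteq> B) \<and> inner_lam e A = outer_lam e A}"

definition lam :: "(nat \<Rightarrow> 'a::real_inner) \<Rightarrow> 'a set \<Rightarrow> real" where
  "lam e A = outer_lam e A"

definition step_fun :: "nat \<Rightarrow> (nat \<Rightarrow> complex) \<Rightarrow> (nat \<Rightarrow> 'a set) \<Rightarrow> 'a \<Rightarrow> complex" where
  "step_fun n c B = (\<lambda>x. \<Sum>k<n. c k * indicator (B k) x)"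

definition step_data :: "(nat \<Rightarrow> 'a::real_inner) \<Rightarrow> nat \<Rightarrow> (nat \<Rightarrow> 'a set) \<Rightarrow> bool" where
  "step_data e n B \<longleftrightarrow> (\<forall>k<n. B k \<in> completed_ring e) \<and> disjoint_family_on B {..<n}"

definition step_functions :: "(nat \<Rightarrow> 'a::real_inner) \<Rightarrow> ('a \<Rightarrow> complex) set" where
  "step_functions e = {step_fun n c B |n c B. step_data e n B}"

text \<open>
  A type cannot depend on the basis \<open>e\<close>, so the completion of the space of step functions modulo
  its null space is given by a complex Hilbert space \<open>'h\<close> together with the canonical map
  \<open>\<iota>\<close> into it: \<open>\<iota>\<close> is linear, carries the seminorm to the norm (so that its kernel is the null
  space) and has dense range. This determines \<open>('h, \<iota>)\<close> up to a unique unitary isomorphism.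
\<close>

definition is_HE :: "(nat \<Rightarrow> 'a::real_inner) \<Rightarrow> (('a \<Rightarrow> complex) \<Rightarrow> 'h::complex_hilbert) \<Rightarrow> bool" where
  "is_HE e \<iota> \<longleftrightarrow>
     (\<forall>f\<in>step_functions e. \<forall>g\<in>step_functions e. \<iota> (\<lambda>x. f x + g x) = \<iota> f + \<iota> g) \<and>
     (\<forall>f\<in>step_functions e. \<forall>c. \<iota> (\<lambda>x. c * f x) = c *\<^sub>C \<iota> f) \<and>
     (\<forall>n c B. step_data e n B \<longrightarrow>
        norm (\<iota> (step_fun n c B)) = sqrt (\<Sum>k<n. (cmod (c k))\<^sup>2 * lam e (B k))) \<and>
     closure (\<iota> ` step_functions e) = UNIV"

text \<open>The continuous extension to the completion of the shift \<open>f \<mapsto> (\<lambda>x. f (x - h))\<close>.\<close>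

definition shift_op ::
  "(nat \<Rightarrow> 'a::real_inner) \<Rightarrow> (('a \<Rightarrow> complex) \<Rightarrow> 'h::complex_hilbert) \<Rightarrow> 'a \<Rightarrow> 'h \<Rightarrow> 'h" where
  "shift_op e \<iota> h = (THE T. bounded_clinear T \<and>
     (\<forall>f\<in>step_functions e. T (\<iota> f) = \<iota> (\<lambda>x. f (x - h))))"

definition averaged_shift ::
  "(nat \<Rightarrow> 'a::{real_inner,complete_space}) \<Rightarrow> (('a \<Rightarrow> complex) \<Rightarrow> 'h::complex_hilbert) \<Rightarrow>
     ('a \<Rightarrow> 'a) \<Rightarrow> 'h \<Rightarrow> 'h" where
  "averaged_shift e \<iota> C f =
     (THE y. has_pettis_integral (gaussian_measure C) (\<lambda>h. shift_op e \<iota> h f) y)"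

end

theory Submission
  imports Defs
begin

text \<open>
  A nonnegative linear combination of indicators of blocks stays nonnegative after projection to
  sufficiently many coordinates, so integrating in finite dimensions shows that the volume is a
  positive functional on such combinations. This gives the finitely additive measure and its
  uniqueness, and hence unitary shifts. A shift by \<open>h\<close> with \<open>\<Sum>\<bar>h\<^sub>j\<bar> < \<infinity>\<close> changes a block by a set of
  measure \<open>O(\<Sum>\<bar>h\<^sub>j\<bar>)\<close>, so shifts are strongly continuous along such rays. As the square root of
  \<open>D\<close> is nuclear, the Gaussian measure with covariance \<open>tD\<close> is the law of \<open>\<surd>t G\<close> for one random
  vector \<open>G\<close> whose coordinates are almost surely absolutely summable. Continuity in \<open>t\<close> then follows
  by dominated convergence, and the semigroup law from the convolution of Gaussian measures.
\<close>

text \<open>For different \<open>t\<close> the measures with covariance \<open>t D\<close> are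
  mutually singular, so continuity in \<open>t\<close> cannot be read off from densities or total
  variation. With one vector \<open>G\<close> for all times, the isometry of the shifts reduces the
  comparison of times \<open>t\<close> and \<open>u\<close> to the single shift by
  \<open>(sqrt t - sqrt u) *\<^sub>R G y\<close>, which moves along a fixed ray for each sample
  \<open>y\<close>. Absolute summability is the natural condition on such a ray: a block of positive
  volume has widths tending to 1, and its overlap with a translate by \<open>h\<close> has relative
  volume equal to the product of the factors 1 - |h_j| / w_j, cut off at 0. It can only be positive
  if the |h_j| are summable. The mean of |G_j| is a constant times the j-th eigenvalue of the root
  of \<open>D\<close>, which is why nuclearity of the root enters. Integrals of vectors are reached
  only through the scalar functions \<open>cinner (S h f) g\<close> and the Riesz theorem. The ring
  measure, the shifts, the root of \<open>D\<close>, the Gaussian measures and the Pettis integrals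
  are all defined by \<open>THE\<close>, so each requires its own existence and uniqueness
  argument.\<close>

section \<open>Complex Hilbert spaces\<close>

lemma cinner_zero_left [simp]: "cinner 0 y = 0"
  using cinner_add_left[of 0 0 y] by simp

lemma cinner_zero_right [simp]: "cinner x 0 = 0"
  using cinner_commute[of x 0] by simp

lemma cinner_add_right: "cinner x (y + z) = cinner x y + cinner x z"
  using cinner_commute[of x "y + z"] cinner_commute[of x y] cinner_commute[of x z]
  by (simp add: cinner_add_left)

lemma cinner_scaleC_right: "cinner x (c *\<^sub>C y) = cnj c * cinner x y"
  using cinner_commute[of x "c *\<^sub>C y"] cinner_commute[of x y] by (simp add: cinner_scaleC_left)

lemma cinner_scaleR_left: "cinner (r *\<^sub>R x) y = of_real r * cinner x y"
  by (simp add: scaleR_scaleC cinner_scaleC_left)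

lemma cinner_scaleR_right: "cinner x (r *\<^sub>R y) = of_real r * cinner x y"
  by (simp add: scaleR_scaleC cinner_scaleC_right)

lemma cinner_minus_left: "cinner (- x) y = - cinner x y"
  using cinner_scaleR_left[of "-1" x y] by simp

lemma cinner_minus_right: "cinner x (- y) = - cinner x y"
  using cinner_scaleR_right[of x "-1" y] by simp

lemma cinner_diff_left: "cinner (x - y) z = cinner x z - cinner y z"
  using cinner_add_left[of x "- y" z] by (simp add: cinner_minus_left)

lemma cinner_diff_right: "cinner x (y - z) = cinner x y - cinner x z"
  using cinner_add_right[of x y "- z"] by (simp add: cinner_minus_right)

lemmas cinner_algebra = cinner_add_left cinner_add_right cinner_diff_left cinner_diff_right
  cinner_scaleC_left cinner_scaleC_right

lemma cinner_self: "cinner x x = complex_of_real ((norm x)\<^sup>2)"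
proof -
  have im: "Im (cinner x x) = 0"
    using arg_cong[OF cinner_commute[of x x], of Im] by simp
  have "Re (cinner x x) \<ge> 0"
  proof (rule ccontr)
    assume "\<not> Re (cinner x x) \<ge> 0"
    then have "norm x < 0" unfolding norm_eq_sqrt_cinner by (simp add: real_sqrt_lt_0_iff)
    then show False by simp
  qed
  then have "(norm x)\<^sup>2 = Re (cinner x x)" unfolding norm_eq_sqrt_cinner by simp
  then show ?thesis using im by (simp add: complex_eq_iff)
qed

lemma Re_cinner_commute: "Re (cinner x y) = Re (cinner y x)"
  using arg_cong[OF cinner_commute[of x y], of Re] by simp

lemma norm_diff_sq:
  fixes x y :: "'h::complex_hilbert"
  shows "(norm (x - y))\<^sup>2 = (norm x)\<^sup>2 + (norm y)\<^sup>2 - 2 * Re (cinner x y)"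
proof -
  have "Re (cinner (x - y) (x - y)) = Re (cinner x x) + Re (cinner y y) - Re (cinner x y) - Re (cinner y x)"
    by (simp add: cinner_algebra)
  then show ?thesis by (simp add: cinner_self Re_cinner_commute[of y x])
qed

lemma norm_add_sq:
  fixes x y :: "'h::complex_hilbert"
  shows "(norm (x + y))\<^sup>2 = (norm x)\<^sup>2 + (norm y)\<^sup>2 + 2 * Re (cinner x y)"
proof -
  have "Re (cinner (x + y) (x + y)) = Re (cinner x x) + Re (cinner y y) + Re (cinner x y) + Re (cinner y x)"
    by (simp add: cinner_algebra)
  then show ?thesis by (simp add: cinner_self Re_cinner_commute[of y x])
qed

lemma norm_scaleC: "norm (c *\<^sub>C (x::'h::complex_hilbert)) = cmod c * norm x"
proof -
  have "cinner (c *\<^sub>C x) (c *\<^sub>C x) = of_real ((cmod c)\<^sup>2 * (norm x)\<^sup>2)"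
    unfolding cinner_scaleC_left cinner_scaleC_right cinner_self[of x] of_real_mult
    unfolding complex_norm_square by (simp add: mult_ac complex_norm_square[symmetric, simplified])
  then have "Re (cinner (c *\<^sub>C x) (c *\<^sub>C x)) = (cmod c * norm x)\<^sup>2"
    by (simp add: power_mult_distrib)
  then show ?thesis unfolding norm_eq_sqrt_cinner[of "c *\<^sub>C x"] by (simp add: abs_mult)
qed

lemma scaleC_one [simp]: "1 *\<^sub>C (x::'h::complex_hilbert) = x"
  using scaleR_scaleC[of 1 x] by simp

lemma scaleC_zero_left [simp]: "0 *\<^sub>C (x::'h::complex_hilbert) = 0"
  using scaleR_scaleC[of 0 x] by simp

lemma scaleC_minus_one: "(-1) *\<^sub>C (x::'h::complex_hilbert) = - x"
  using scaleR_scaleC[of "-1" x] by simp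

text \<open>Equality in Cauchy-Schwarz occurs when the rescaled vectors
  \<open>norm y *\<^sub>R x\<close> and \<open>norm x *\<^sub>R y\<close> agree; the square of the
  norm of their difference, expanded, is the inequality.\<close>

lemma Re_cinner_le: "Re (cinner x y) \<le> norm x * norm (y::'h::complex_hilbert)"
proof (cases "x = 0 \<or> y = 0")
  case False
  then have p: "norm x > 0" "norm y > 0" by auto
  have "0 \<le> (norm (norm y *\<^sub>R x - norm x *\<^sub>R y))\<^sup>2" by simp
  also have "\<dots> = 2 * (norm x * norm y)\<^sup>2 - 2 * (norm x * norm y) * Re (cinner x y)"
    unfolding norm_diff_sq
    by (simp add: cinner_scaleR_left cinner_scaleR_right power2_eq_square algebra_simps)
  finally have "(norm x * norm y) * Re (cinner x y) \<le> (norm x * norm y) * (norm x * norm y)"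
    by (simp add: power2_eq_square)
  then show ?thesis using p by (simp add: mult_le_cancel_left_pos)
qed auto

lemma norm_cinner_le: "cmod (cinner x y) \<le> norm x * norm (y::'h::complex_hilbert)"
proof (cases "cinner x y = 0")
  case False
  \<comment> \<open>A unimodular phase that rotates \<open>cinner x y\<close> onto the positive real
    axis, so that the bound for real parts applies.\<close>
  define c where "c = cnj (cinner x y) / cmod (cinner x y)"
  have c1: "cmod c = 1" using False by (simp add: c_def norm_divide)
  have "c * cinner x y = of_real (cmod (cinner x y))"
    using False unfolding c_def
    by (simp add: mult.commute[of "cnj _"] complex_norm_square[symmetric] power2_eq_square)
  then have "cmod (cinner x y) = Re (cinner (c *\<^sub>C x) y)" by (simp add: cinner_scaleC_left)
  also have "\<dots> \<le> norm (c *\<^sub>C x) * norm y" by (rule Re_cinner_le)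
  finally show ?thesis by (simp add: norm_scaleC c1)
qed simp

lemma bounded_linear_cinner_left: "bounded_linear (\<lambda>x. cinner x (y::'h::complex_hilbert))"
  by (rule bounded_linear_intro[where K = "norm y"])
    (simp_all add: cinner_add_left cinner_scaleR_left scaleR_conv_of_real norm_cinner_le)

lemma bounded_linear_cinner_right: "bounded_linear (\<lambda>y. cinner (x::'h::complex_hilbert) y)"
  by (rule bounded_linear_intro[where K = "norm x"])
    (simp_all add: cinner_add_right cinner_scaleR_right scaleR_conv_of_real norm_cinner_le
      mult.commute[of _ "norm x"])

lemma bounded_cfunctional_cinner: "bounded_cfunctional (\<lambda>x. cinner x (y::'h::complex_hilbert))"
  by (simp add: bounded_cfunctional_def bounded_linear_cinner_left cinner_scaleC_left)

lemma bounded_linear_scaleC: "bounded_linear (\<lambda>x::'h::complex_hilbert. c *\<^sub>C x)"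
  by (rule bounded_linear_intro[where K = "cmod c"])
    (simp_all add: scaleC_add_right scaleR_scaleC scaleC_scaleC norm_scaleC mult.commute)

lemma cinner_ext:
  assumes "\<And>g. cinner x g = cinner (y::'h::complex_hilbert) g"
  shows "x = y"
proof -
  have "cinner (x - y) (x - y) = 0" using assms[of "x - y"] by (simp add: cinner_diff_left)
  then show ?thesis by (simp add: cinner_self)
qed

lemma parallelogram:
  fixes x y :: "'h::complex_hilbert"
  shows "(norm (x + y))\<^sup>2 + (norm (x - y))\<^sup>2 = 2 * (norm x)\<^sup>2 + 2 * (norm y)\<^sup>2"
  unfolding norm_diff_sq norm_add_sq by simp

lemma polarization:
  fixes x y :: "'h::complex_hilbert"
  shows "Re (cinner x y) = ((norm (x + y))\<^sup>2 - (norm x)\<^sup>2 - (norm y)\<^sup>2) / 2"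
  unfolding norm_add_sq by simp

text \<open>Lets identities known for real parts, such as those from polarization, pass to the full
  scalar product by replacing \<open>y\<close> with \<open>\<i> *\<^sub>C y\<close>.\<close>

lemma cinner_eq_Re: "cinner x y = Complex (Re (cinner x y)) (Re (cinner x (\<i> *\<^sub>C y)))"
  by (simp add: complex_eq_iff cinner_scaleC_right)

text \<open>The representing vector minimises \<open>\<parallel>x\<parallel>\<^sup>2 / 2 - u x\<close>.\<close>

lemma riesz_real:
  fixes u :: "'h::complex_hilbert \<Rightarrow> real"
  assumes u: "bounded_linear u"
  shows "\<exists>g. \<forall>x. u x = Re (cinner x g)"
proof -
  interpret u: bounded_linear u by (rule u)
  define J where "J x = (norm x)\<^sup>2 / 2 - u x" for x
  obtain K where K: "\<And>x. norm (u x) \<le> norm x * K" using u.bounded by blast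
  have lower: "J x \<ge> - K\<^sup>2 / 2" for x
  proof -
    have "0 \<le> (norm x - K)\<^sup>2" by simp
    then have "norm x * K \<le> (norm x)\<^sup>2 / 2 + K\<^sup>2 / 2" by (simp add: power2_diff)
    moreover have "u x \<le> norm x * K" using K[of x] by simp
    ultimately show ?thesis unfolding J_def by simp
  qed
  have bdd: "bdd_below (range J)" using lower by (auto intro!: bdd_belowI)
  define m where "m = Inf (range J)"
  have mle: "m \<le> J x" for x unfolding m_def by (rule cInf_lower) (auto intro: bdd)
  have "\<exists>x. J x < m + inverse (real (Suc n))" for n
    using cInf_lessD[of "range J" "m + inverse (real (Suc n))"] by (auto simp: m_def)
  then obtain X where X: "\<And>n. J (X n) < m + inverse (real (Suc n))" by metis
  \<comment> \<open>The parallelogram law makes \<open>J\<close> uniformly convex: two almost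
    minimal points are close, because their midpoint cannot go below \<open>m\<close>.\<close>
  have mid: "(norm (x - y))\<^sup>2 = 4 * (J x + J y - 2 * J ((1/2) *\<^sub>R (x + y)))" for x y
  proof -
    have e: "J ((1/2) *\<^sub>R (x + y)) = (norm (x + y))\<^sup>2 / 8 - (u x + u y) / 2"
      unfolding J_def by (simp add: u.scaleR u.add power_mult_distrib power_divide)
    show ?thesis unfolding e using parallelogram[of x y] by (simp add: J_def field_simps)
  qed
  have close: "(norm (X i - X j))\<^sup>2 \<le> 8 * inverse (real (Suc n))" if "i \<ge> n" "j \<ge> n" for i j n
  proof -
    have "inverse (real (Suc i)) \<le> inverse (real (Suc n))" "inverse (real (Suc j)) \<le> inverse (real (Suc n))"
      using that by (auto intro!: le_imp_inverse_le)
    then have "J (X i) + J (X j) - 2 * J ((1/2) *\<^sub>R (X i + X j)) \<le> 2 * inverse (real (Suc n))"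
      using X[of i] X[of j] mle[of "(1/2) *\<^sub>R (X i + X j)"] by linarith
    from mult_left_mono[OF this, of 4] show ?thesis unfolding mid[of "X i" "X j"] by simp
  qed
  have "Cauchy X"
  proof (rule metric_CauchyI)
    fix e :: real assume e: "e > 0"
    obtain n where n: "inverse (real (Suc n)) < e\<^sup>2 / 8"
      using reals_Archimedean[of "e\<^sup>2 / 8"] e by auto
    show "\<exists>M. \<forall>i\<ge>M. \<forall>j\<ge>M. dist (X i) (X j) < e"
    proof (intro exI allI impI)
      fix i j assume "n \<le> i" "n \<le> j"
      then have "(norm (X i - X j))\<^sup>2 < e\<^sup>2" using close[of n i j] n by linarith
      then show "dist (X i) (X j) < e" using e by (simp add: dist_norm power_less_imp_less_base)
    qed
  qed
  then obtain g where g: "X \<longlonglongrightarrow> g" using Cauchy_convergent convergent_def by blast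
  have "(\<lambda>n. J (X n)) \<longlonglongrightarrow> J g" unfolding J_def by (intro tendsto_intros g u.tendsto) simp
  moreover have "(\<lambda>n. m + inverse (real (Suc n))) \<longlonglongrightarrow> m + 0"
    by (intro tendsto_intros LIMSEQ_inverse_real_of_nat)
  ultimately have "J g \<le> m" using X by (intro LIMSEQ_le[of "\<lambda>n. J (X n)" _ "\<lambda>n. m + inverse (real (Suc n))"])
      (auto intro: less_imp_le)
  then have Jg: "J g \<le> J x" for x using mle[of x] by linarith
  have "u v = Re (cinner v g)" for v
  proof -
    define d where "d = Re (cinner g v) - u v"
    have "0 \<le> r * d + r\<^sup>2 * ((norm v)\<^sup>2 / 2)" for r
      using Jg[of "g + r *\<^sub>R v"]
      unfolding J_def norm_add_sq d_def
      by (simp add: u.add u.scaleR cinner_scaleR_right power_mult_distrib field_simps)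
    \<comment> \<open>The quadratic in \<open>r\<close> is smallest at - d / (norm v)^2; the added 1
      keeps the denominator positive for \<open>v = 0\<close> and still makes the value negative
      unless \<open>d = 0\<close>.\<close>
    from this[of "- d / (1 + (norm v)\<^sup>2)"]
    have q: "0 \<le> - d / (1 + (norm v)\<^sup>2) * d + (- d / (1 + (norm v)\<^sup>2))\<^sup>2 * ((norm v)\<^sup>2 / 2)" .
    define s where "s = 1 + (norm v)\<^sup>2"
    have s: "s > 0" unfolding s_def by (simp add: add_pos_nonneg)
    have "- d / s * d + (- d / s)\<^sup>2 * ((s - 1) / 2) = - (d\<^sup>2 * (s + 1)) / (2 * s\<^sup>2)"
      using s by (simp add: field_simps power2_eq_square)
    then have "0 \<le> - (d\<^sup>2 * (s + 1)) / (2 * s\<^sup>2)" using q unfolding s_def by simp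
    moreover have "2 * s\<^sup>2 > 0" using s by simp
    ultimately have "d\<^sup>2 * (s + 1) \<le> 0"
      using divide_pos_pos[of "d\<^sup>2 * (s + 1)" "2 * s\<^sup>2"] by fastforce
    then have "d = 0" using s
      by (smt (verit) mult_pos_pos power2_eq_square zero_less_power2)
    then show ?thesis by (simp add: d_def Re_cinner_commute[of v g])
  qed
  then show ?thesis by blast
qed

lemma riesz:
  fixes \<phi> :: "'h::complex_hilbert \<Rightarrow> complex"
  assumes "bounded_cfunctional \<phi>"
  shows "\<exists>g. \<forall>x. \<phi> x = cinner x g"
proof -
  have bl: "bounded_linear \<phi>" and sc: "\<And>c x. \<phi> (c *\<^sub>C x) = c * \<phi> x"
    using assms by (auto simp: bounded_cfunctional_def)
  obtain g where g: "\<And>x. Re (\<phi> x) = Re (cinner x g)"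
    using riesz_real[OF bounded_linear_compose[OF bounded_linear_Re bl]] by auto
  have "\<phi> x = cinner x g" for x
    using g[of x] g[of "\<i> *\<^sub>C x"] by (simp add: complex_eq_iff sc cinner_scaleC_left)
  then show ?thesis by blast
qed

section \<open>Orthonormal bases\<close>

locale onb =
  fixes e :: "nat \<Rightarrow> 'a::{real_inner,complete_space}"
  assumes onb: "orthonormal_basis e"
begin

lemma e_inner: "e i \<bullet> e j = (if i = j then 1 else 0)"
  using onb by (simp add: orthonormal_basis_def)

lemma e_self [simp]: "e i \<bullet> e i = 1"
  by (simp add: e_inner)

lemma norm_e [simp]: "norm (e i) = 1"
  by (simp add: norm_eq_sqrt_inner)

lemma sum_inner_e:
  assumes "finite I"
  shows "(\<Sum>j\<in>I. c j *\<^sub>R e j) \<bullet> e k = (if k \<in> I then c k else 0)"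
proof -
  have "(\<Sum>j\<in>I. c j *\<^sub>R e j) \<bullet> e k = (\<Sum>j\<in>I. if j = k then c j else 0)"
    by (auto simp: inner_sum_left e_inner intro!: sum.cong)
  then show ?thesis using assms by simp
qed

lemma norm_sum_e:
  assumes "finite I"
  shows "(norm (\<Sum>j\<in>I. c j *\<^sub>R e j))\<^sup>2 = (\<Sum>j\<in>I. (c j)\<^sup>2)"
proof -
  have "(norm (\<Sum>j\<in>I. c j *\<^sub>R e j))\<^sup>2 = (\<Sum>k\<in>I. c k * ((\<Sum>j\<in>I. c j *\<^sub>R e j) \<bullet> e k))"
    unfolding power2_norm_eq_inner by (subst (1) inner_sum_right) simp
  also have "\<dots> = (\<Sum>j\<in>I. (c j)\<^sup>2)"
    by (rule sum.cong) (simp_all add: sum_inner_e[OF assms] power2_eq_square)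
  finally show ?thesis .
qed

lemma bessel:
  assumes "finite I"
  shows "(\<Sum>j\<in>I. (x \<bullet> e j)\<^sup>2) \<le> (norm x)\<^sup>2"
proof -
  define p where "p = (\<Sum>j\<in>I. (x \<bullet> e j) *\<^sub>R e j)"
  have xp: "x \<bullet> p = (\<Sum>j\<in>I. (x \<bullet> e j)\<^sup>2)" by (simp add: p_def inner_sum_right power2_eq_square)
  have "0 \<le> (norm (x - p))\<^sup>2" by simp
  also have "\<dots> = (norm x)\<^sup>2 - 2 * (x \<bullet> p) + (norm p)\<^sup>2"
    by (simp add: power2_norm_eq_inner inner_diff_left inner_diff_right inner_commute)
  also have "(norm p)\<^sup>2 = x \<bullet> p" unfolding xp unfolding p_def by (rule norm_sum_e[OF assms])
  finally show ?thesis using xp by simp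
qed

lemma summable_coord_sq: "summable (\<lambda>j. (x \<bullet> e j)\<^sup>2)"
  using bessel by (intro bounded_imp_summable[where B = "(norm x)\<^sup>2"]) auto

text \<open>By orthogonality the squared distance of two partial sums equals the distance of the
  corresponding partial sums of squares, so the Cauchy property carries over.\<close>

lemma ell2_vector:
  assumes "summable (\<lambda>j. (c j)\<^sup>2)"
  shows "summable (\<lambda>j. c j *\<^sub>R e j)"
proof -
  have C: "Cauchy (\<lambda>n. \<Sum>j<n. (c j)\<^sup>2)"
    using assms by (simp add: summable_iff_convergent convergent_Cauchy)
  have "Cauchy (\<lambda>n. \<Sum>j<n. c j *\<^sub>R e j)"
  proof (rule metric_CauchyI)
    fix r :: real assume r: "r > 0"
    then obtain N where N: "\<And>m n. m \<ge> N \<Longrightarrow> n \<ge> N \<Longrightarrow> dist (\<Sum>j<m. (c j)\<^sup>2) (\<Sum>j<n. (c j)\<^sup>2) < r\<^sup>2"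
      using metric_CauchyD[OF C, of "r\<^sup>2"] by auto
    have main: "dist (\<Sum>j<m. c j *\<^sub>R e j) (\<Sum>j<n. c j *\<^sub>R e j) < r" if "m \<ge> N" "n \<ge> N" "m \<le> n" for m n
    proof -
      have s: "{..<n} = {..<m} \<union> {m..<n}" using that by auto
      have "(\<Sum>j<n. c j *\<^sub>R e j) = (\<Sum>j<m. c j *\<^sub>R e j) + (\<Sum>j\<in>{m..<n}. c j *\<^sub>R e j)"
        unfolding s by (rule sum.union_disjoint) auto
      moreover have "(\<Sum>j<n. (c j)\<^sup>2) = (\<Sum>j<m. (c j)\<^sup>2) + (\<Sum>j\<in>{m..<n}. (c j)\<^sup>2)"
        unfolding s by (rule sum.union_disjoint) auto
      ultimately have "(dist (\<Sum>j<m. c j *\<^sub>R e j) (\<Sum>j<n. c j *\<^sub>R e j))\<^sup>2 =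
          dist (\<Sum>j<m. (c j)\<^sup>2) (\<Sum>j<n. (c j)\<^sup>2)"
        by (simp add: dist_norm norm_sum_e sum_nonneg)
      then show ?thesis using N[OF that(1,2)] r by (intro power_less_imp_less_base[of _ 2 r]) simp_all
    qed
    show "\<exists>M. \<forall>m\<ge>M. \<forall>n\<ge>M. dist (\<Sum>j<m. c j *\<^sub>R e j) (\<Sum>j<n. c j *\<^sub>R e j) < r"
      by (metis main dist_commute nle_le)
  qed
  then show ?thesis by (simp add: summable_iff_convergent Cauchy_convergent_iff)
qed

lemma suminf_inner_e:
  assumes "summable (\<lambda>j. c j *\<^sub>R e j)"
  shows "(\<Sum>j. c j *\<^sub>R e j) \<bullet> e k = c k"
proof -
  have "(\<lambda>n. (\<Sum>j<n. c j *\<^sub>R e j) \<bullet> e k) \<longlonglongrightarrow> (\<Sum>j. c j *\<^sub>R e j) \<bullet> e k"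
    by (intro tendsto_intros summable_LIMSEQ assms)
  moreover have "(\<lambda>n. (\<Sum>j<n. c j *\<^sub>R e j) \<bullet> e k) \<longlonglongrightarrow> c k"
    by (rule tendsto_eventually) (auto simp: sum_inner_e eventually_sequentially intro!: exI[of _ "Suc k"])
  ultimately show ?thesis by (rule LIMSEQ_unique)
qed

lemma orthogonal_zero:
  assumes "\<And>j. x \<bullet> e j = 0"
  shows "x = 0"
proof -
  have "range e \<subseteq> {y. x \<bullet> y = 0}" using assms by auto
  then have "span (range e) \<subseteq> {y. x \<bullet> y = 0}"
    by (rule span_minimal) (auto simp: subspace_def inner_add_right)
  then have "closure (span (range e)) \<subseteq> {y. x \<bullet> y = 0}"
    by (rule closure_minimal) (intro closed_Collect_eq continuous_intros)
  moreover have "closure (span (range e)) = UNIV" using onb by (simp add: orthonormal_basis_def)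
  ultimately have "x \<bullet> x = 0" by blast
  then show ?thesis by simp
qed

lemma coord_ext:
  assumes "\<And>j. x \<bullet> e j = y \<bullet> e j"
  shows "x = y"
  using orthogonal_zero[of "x - y"] assms by (simp add: inner_diff_left)

lemma expansion: "(\<lambda>j. (x \<bullet> e j) *\<^sub>R e j) sums x"
proof -
  have s: "summable (\<lambda>j. (x \<bullet> e j) *\<^sub>R e j)" by (intro ell2_vector summable_coord_sq)
  have "(\<Sum>j. (x \<bullet> e j) *\<^sub>R e j) = x" by (rule coord_ext) (rule suminf_inner_e[OF s])
  then show ?thesis using s by (simp add: sums_iff)
qed

lemma obtain_vector:
  assumes "summable (\<lambda>j. (c j)\<^sup>2)"
  obtains x where "\<And>j. x \<bullet> e j = c j"
  using that suminf_inner_e[OF ell2_vector[OF assms]] by blast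

lemma bounded_linear_eqI:
  fixes A B :: "'a \<Rightarrow> 'b::real_normed_vector"
  assumes "bounded_linear A" "bounded_linear B" "\<And>j. A (e j) = B (e j)"
  shows "A = B"
proof
  fix x
  interpret A: bounded_linear A by fact
  interpret B: bounded_linear B by fact
  have "(\<lambda>j. A ((x \<bullet> e j) *\<^sub>R e j)) sums A x" by (rule A.sums[OF expansion])
  moreover have "(\<lambda>j. B ((x \<bullet> e j) *\<^sub>R e j)) sums B x" by (rule B.sums[OF expansion])
  ultimately show "A x = B x" by (simp add: A.scaleR B.scaleR assms(3) sums_unique2)
qed

text \<open>The type \<open>'a\<close> is not of class \<open>second_countable_topology\<close>, so sums of measurable
  \<open>'a\<close>-valued functions are handled through the sequence space \<open>nat \<Rightarrow> real\<close>, which is.\<close>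

lemma borel_measurable_coordI:
  assumes "\<And>j. (\<lambda>w. F w \<bullet> e j) \<in> borel_measurable M"
  shows "F \<in> borel_measurable M"
proof (rule borel_measurable_LIMSEQ_metric)
  fix n
  have c: "(\<lambda>w j. F w \<bullet> e j) \<in> borel_measurable M"
    by (rule measurable_coordinatewise_then_product) (rule assms)
  have "continuous_on UNIV (\<lambda>c. \<Sum>j<n. c j *\<^sub>R e j)"
    by (intro continuous_intros continuous_on_product_coordinates)
  then have "(\<lambda>c. \<Sum>j<n. c j *\<^sub>R e j) \<in> borel_measurable borel"
    by (rule borel_measurable_continuous_onI)
  from measurable_compose[OF c this]
  show "(\<lambda>w. \<Sum>j<n. (F w \<bullet> e j) *\<^sub>R e j) \<in> borel_measurable M" by simp
next
  fix w
  show "(\<lambda>n. \<Sum>j<n. (F w \<bullet> e j) *\<^sub>R e j) \<longlonglongrightarrow> F w"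
    using expansion[of "F w"] by (simp add: sums_def)
qed

lemma borel_measurable_inner [measurable]: "(\<lambda>x. x \<bullet> y) \<in> borel_measurable borel"
  by (intro borel_measurable_continuous_onI continuous_intros)

text \<open>Continuity of addition gives measurability only for the Borel sets of the product space,
  which may exceed the product sigma-algebra; the coordinates give it for the latter. The
  convolution of Gaussian measures needs this form.\<close>

lemma measurable_plus_pair: "(\<lambda>(x::'a, y). x + y) \<in> borel_measurable (borel \<Otimes>\<^sub>M borel)"
  by (rule borel_measurable_coordI) (simp add: inner_add_left split_beta)

end

section \<open>Rings of sets\<close>

text \<open>The cells of the Venn diagram of the family. The cell of \<open>J = {}\<close> is the
  complement of the union and in general not in the ring, hence the index set
  \<open>Pow I - {{}}\<close> below.\<close>

definition ring_atom :: "'i set \<Rightarrow> ('i \<Rightarrow> 'a set) \<Rightarrow> 'i set \<Rightarrow> 'a set" where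
  "ring_atom I A J = (\<Inter>i\<in>J. A i) - (\<Union>i\<in>I - J. A i)"

lemma mem_ring_atom_iff:
  "J \<subseteq> I \<Longrightarrow> x \<in> ring_atom I A J \<longleftrightarrow> J = {i\<in>I. x \<in> A i}"
  by (auto simp: ring_atom_def)

lemma disjoint_ring_atom: "disjoint_family_on (ring_atom I A) (Pow I)"
  unfolding disjoint_family_on_def
proof (intro ballI impI)
  fix J J' assume "J \<in> Pow I" "J' \<in> Pow I" "J \<noteq> J'"
  then show "ring_atom I A J \<inter> ring_atom I A J' = {}"
    using mem_ring_atom_iff[of J I _ A] mem_ring_atom_iff[of J' I _ A] by blast
qed

lemma UN_ring_atom:
  assumes "i \<in> I"
  shows "A i = (\<Union>J\<in>{J \<in> Pow I - {{}}. i \<in> J}. ring_atom I A J)"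
proof (intro set_eqI iffI)
  fix x assume "x \<in> A i"
  then have "x \<in> ring_atom I A {i\<in>I. x \<in> A i}" "{i\<in>I. x \<in> A i} \<in> {J \<in> Pow I - {{}}. i \<in> J}"
    using assms by (auto simp: ring_atom_def)
  then show "x \<in> (\<Union>J\<in>{J \<in> Pow I - {{}}. i \<in> J}. ring_atom I A J)" by (rule UN_I[rotated])
qed (auto simp: ring_atom_def)

lemma sum_ring_atom:
  fixes c :: "'i \<Rightarrow> 'b::comm_ring_1"
  assumes "finite I"
  shows "(\<Sum>i\<in>I. c i * indicator (A i) x) =
    (\<Sum>J\<in>Pow I - {{}}. (\<Sum>i\<in>J. c i) * indicator (ring_atom I A J) x)"
proof -
  define J0 where "J0 = {i\<in>I. x \<in> A i}"
  have "(\<Sum>i\<in>I. c i * indicator (A i) x) = (\<Sum>i\<in>J0. c i)"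
    unfolding J0_def by (rule sum.mono_neutral_cong_right) (auto simp: assms)
  also have "\<dots> = (\<Sum>J\<in>Pow I. if J = J0 then (\<Sum>i\<in>J0. c i) else 0)"
    using assms by (subst sum.delta) (auto simp: J0_def)
  also have "\<dots> = (\<Sum>J\<in>Pow I. (\<Sum>i\<in>J. c i) * indicator (ring_atom I A J) x)"
    by (rule sum.cong) (auto simp: mem_ring_atom_iff J0_def[symmetric] indicator_def)
  \<comment> \<open>The outer cell drops out because its coefficient is an empty sum.\<close>
  also have "\<dots> = (\<Sum>J\<in>Pow I - {{}}. (\<Sum>i\<in>J. c i) * indicator (ring_atom I A J) x)"
    using assms by (intro sum.mono_neutral_right) auto
  finally show ?thesis .
qed

context ring_of_sets
begin

lemma ring_atom_in:
  assumes "finite I" "\<And>i. i \<in> I \<Longrightarrow> A i \<in> M" "J \<subseteq> I" "J \<noteq> {}"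
  shows "ring_atom I A J \<in> M"
proof -
  have "(\<Inter>i\<in>J. A i) \<in> M" using assms by (intro finite_INT) (auto intro: finite_subset)
  moreover have "(\<Union>i\<in>I - J. A i) \<in> M" using assms by (intro finite_UN) auto
  ultimately show ?thesis unfolding ring_atom_def by (rule Diff)
qed

lemma additive_empty:
  fixes m :: "'a set \<Rightarrow> real"
  assumes "additive M m"
  shows "m {} = 0"
  using additiveD[OF assms, of "{}" "{}"] by simp

lemma additive_UN:
  fixes m :: "'a set \<Rightarrow> real"
  assumes m: "additive M m" and "finite I" "\<And>i. i \<in> I \<Longrightarrow> A i \<in> M" "disjoint_family_on A I"
  shows "m (\<Union>i\<in>I. A i) = (\<Sum>i\<in>I. m (A i))"
  using assms(2-)
proof (induction I rule: finite_induct)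
  case empty
  then show ?case by (simp add: additive_empty[OF m])
next
  case (insert i I)
  have "A i \<inter> (\<Union>k\<in>I. A k) = {}" using insert.prems insert.hyps by (auto simp: disjoint_family_on_def)
  then have "m (A i \<union> (\<Union>k\<in>I. A k)) = m (A i) + m (\<Union>k\<in>I. A k)"
    using insert.prems insert.hyps by (intro additiveD[OF m]) auto
  moreover have "m (\<Union>k\<in>I. A k) = (\<Sum>k\<in>I. m (A k))"
    using insert.prems by (intro insert.IH) (auto simp: disjoint_family_on_def)
  ultimately show ?case using insert.hyps by simp
qed

lemma additive_mono:
  fixes m :: "'a set \<Rightarrow> real"
  assumes "additive M m" "\<And>A. A \<in> M \<Longrightarrow> 0 \<le> m A" "A \<in> M" "B \<in> M" "A \<subseteq> B"
  shows "m A \<le> m B" and "m (B - A) = m B - m A"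
proof -
  have "m (A \<union> (B - A)) = m A + m (B - A)" using assms by (intro additiveD) auto
  moreover have "A \<union> (B - A) = B" using assms by auto
  ultimately show "m A \<le> m B" "m (B - A) = m B - m A"
    using assms(2)[of "B - A"] assms by (auto simp: Diff)
qed

lemma additive_subadd:
  fixes m :: "'a set \<Rightarrow> real"
  assumes m: "additive M m" "\<And>A. A \<in> M \<Longrightarrow> 0 \<le> m A" and AB: "A \<in> M" "B \<in> M"
  shows "m (A \<union> B) \<le> m A + m B"
proof -
  have "m (A \<union> (B - A)) = m A + m (B - A)" using AB by (intro additiveD[OF m(1)]) auto
  moreover have "m (B - A) \<le> m B" using AB by (intro additive_mono(1)[OF m]) auto
  ultimately show ?thesis by simp
qed

text \<open>On the atoms the relation decouples: a nonempty atom has coefficient 0, as evaluation at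
  one of its points shows, and an empty atom has measure 0. This is what forces an additive function
  to be determined by its values on blocks.\<close>

lemma additive_linear_relation:
  fixes m :: "'a set \<Rightarrow> real" and c :: "'i \<Rightarrow> real"
  assumes m: "additive M m" and I: "finite I" and A: "\<And>i. i \<in> I \<Longrightarrow> A i \<in> M"
    and zero: "\<And>x. (\<Sum>i\<in>I. c i * indicator (A i) x) = 0"
  shows "(\<Sum>i\<in>I. c i * m (A i)) = 0"
proof -
  let ?K = "Pow I - {{}}"
  have fK: "finite ?K" using I by simp
  have mA: "m (A i) = (\<Sum>J\<in>?K. if i \<in> J then m (ring_atom I A J) else 0)" if "i \<in> I" for i
  proof -
    have "m (A i) = m (\<Union>J\<in>{J \<in> ?K. i \<in> J}. ring_atom I A J)"
      using UN_ring_atom[OF that] by metis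
    also have "\<dots> = (\<Sum>J\<in>{J \<in> ?K. i \<in> J}. m (ring_atom I A J))"
      using I A fK disjoint_ring_atom[of I A]
      by (intro additive_UN[OF m]) (auto simp: disjoint_family_on_def intro!: ring_atom_in)
    finally show ?thesis using fK by (simp add: sum.If_cases Int_def)
  qed
  have "(\<Sum>i\<in>I. c i * m (A i)) = (\<Sum>i\<in>I. \<Sum>J\<in>?K. if i \<in> J then c i * m (ring_atom I A J) else 0)"
    by (intro sum.cong refl) (simp add: mA sum_distrib_left if_distrib cong: if_cong)
  also have "\<dots> = (\<Sum>J\<in>?K. \<Sum>i\<in>I. if i \<in> J then c i * m (ring_atom I A J) else 0)"
    by (rule sum.swap)
  also have "\<dots> = (\<Sum>J\<in>?K. (\<Sum>i\<in>J. c i) * m (ring_atom I A J))"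
    using I by (intro sum.cong refl) (auto simp: sum.If_cases sum_distrib_right Int_absorb1)
  also have "\<dots> = 0"
  proof (intro sum.neutral ballI)
    fix J assume J: "J \<in> ?K"
    show "(\<Sum>i\<in>J. c i) * m (ring_atom I A J) = 0"
    proof (cases "ring_atom I A J = {}")
      case True
      then show ?thesis by (simp add: additive_empty[OF m])
    next
      case False
      then obtain x where "x \<in> ring_atom I A J" by auto
      then have Jx: "J = {i\<in>I. x \<in> A i}" using J mem_ring_atom_iff[of J I x A] by auto
      have "(\<Sum>i\<in>I. c i * indicator (A i) x) = (\<Sum>i\<in>J. c i)"
        unfolding Jx by (rule sum.mono_neutral_cong_right) (auto simp: I)
      then show ?thesis using zero by simp
    qed
  qed
  finally show ?thesis .
qed

text \<open>Step functions are defined with disjoint sets, whereas sums of step functions produce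
  overlapping ones; refinement to atoms repairs this.\<close>

lemma disjointify_sum:
  fixes c :: "'i \<Rightarrow> 'b::comm_ring_1"
  assumes "finite I" "\<And>i. i \<in> I \<Longrightarrow> A i \<in> M"
  shows "\<exists>(n::nat) c' B. (\<forall>k<n. B k \<in> M) \<and> disjoint_family_on B {..<n} \<and>
    (\<forall>x. (\<Sum>i\<in>I. c i * indicator (A i) x) = (\<Sum>k<n. c' k * indicator (B k) x))"
proof -
  let ?K = "Pow I - {{}}"
  obtain h where h: "bij_betw h {..<card ?K} ?K"
    using ex_bij_betw_nat_finite[of ?K] assms(1) by (auto simp: atLeast0LessThan)
  show ?thesis
  proof (rule exI[of _ "card ?K"], rule exI[of _ "\<lambda>k. \<Sum>i\<in>h k. c i"],
      rule exI[of _ "\<lambda>k. ring_atom I A (h k)"], intro conjI allI impI)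
    fix k assume "k < card ?K"
    then have "h k \<in> ?K" using h by (auto simp: bij_betw_def)
    then show "ring_atom I A (h k) \<in> M" using assms by (intro ring_atom_in) auto
  next
    have "h i \<in> Pow I" if "i < card ?K" for i using h that by (auto simp: bij_betw_def)
    then show "disjoint_family_on (\<lambda>k. ring_atom I A (h k)) {..<card ?K}"
      using disjoint_ring_atom[of I A] h
      unfolding disjoint_family_on_def bij_betw_def inj_on_def by (metis lessThan_iff)
  next
    fix x
    show "(\<Sum>i\<in>I. c i * indicator (A i) x) =
        (\<Sum>k<card ?K. (\<Sum>i\<in>h k. c i) * indicator (ring_atom I A (h k)) x)"
      unfolding sum_ring_atom[OF assms(1)] by (rule sum.reindex_bij_betw[OF h, symmetric])
  qed
qed

end

section \<open>The measure on the ring generated by the blocks\<close>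

text \<open>The hypothesis is integrated against Lebesgue measure on the first \<open>n\<close>
  coordinates, where each product of indicators becomes the volume of its box.\<close>

lemma box_combination_nonneg:
  fixes a b :: "'i \<Rightarrow> nat \<Rightarrow> real" and c :: "'i \<Rightarrow> real"
  assumes I: "finite I" and ab: "\<And>i j. i \<in> I \<Longrightarrow> a i j \<le> b i j"
    and nonneg: "\<And>x::nat \<Rightarrow> real. 0 \<le> (\<Sum>i\<in>I. c i * (\<Prod>j<n. indicator {a i j..<b i j} (x j)))"
  shows "0 \<le> (\<Sum>i\<in>I. c i * (\<Prod>j<n. b i j - a i j))"
proof -
  interpret L: product_sigma_finite "\<lambda>_::nat. lborel :: real measure" ..
  let ?M = "Pi\<^sub>M {..<n} (\<lambda>_. lborel :: real measure)"
  have int1: "integrable lborel (indicator {a i j..<b i j} :: real \<Rightarrow> real)" if "i \<in> I" for i j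
    using ab[OF that, of j] by (intro integrable_real_indicator) auto
  have int: "integrable ?M (\<lambda>x. \<Prod>j<n. indicator {a i j..<b i j} (x j) :: real)" if "i \<in> I" for i
    using int1[OF that] by (intro L.product_integrable_prod) auto
  have eq: "(\<integral>x. (\<Prod>j<n. indicator {a i j..<b i j} (x j) :: real) \<partial>?M) = (\<Prod>j<n. b i j - a i j)"
    if "i \<in> I" for i
    using int1[OF that] ab[OF that] by (subst L.product_integral_prod) auto
  have "0 \<le> (\<integral>x. (\<Sum>i\<in>I. c i * (\<Prod>j<n. indicator {a i j..<b i j} (x j))) \<partial>?M)"
    by (intro Bochner_Integration.integral_nonneg nonneg)
  also have "\<dots> = (\<Sum>i\<in>I. c i * (\<Prod>j<n. b i j - a i j))"
    using int by (subst Bochner_Integration.integral_sum) (auto simp: eq)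
  finally show ?thesis .
qed

text \<open>Factors above 1 and below 1 are separated. The first product is the exponential of a
  convergent series, the second is decreasing and nonnegative; it may tend to 0, which is the case
  of a product diverging to 0.\<close>

lemma convergent_prod_ln_pos_part:
  fixes w :: "nat \<Rightarrow> real"
  assumes w: "\<And>j. w j > 0" and s: "summable (\<lambda>j. max 0 (ln (w j)))"
  shows "convergent (\<lambda>n. \<Prod>j<n. w j)"
proof -
  have "(\<Prod>j<n. max 1 (w j)) = exp (\<Sum>j<n. max 0 (ln (w j)))" for n
  proof -
    have "max 1 (w j) = exp (max 0 (ln (w j)))" for j
      using w[of j] by (simp add: max_def)
    then show ?thesis by (simp add: exp_sum)
  qed
  moreover have "convergent (\<lambda>n. exp (\<Sum>j<n. max 0 (ln (w j))))"
    using s tendsto_exp unfolding summable_iff_convergent convergent_def by blast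
  ultimately have 1: "convergent (\<lambda>n. \<Prod>j<n. max 1 (w j))" by simp
  have "decseq (\<lambda>n. \<Prod>j<n. min 1 (w j))"
    using w by (intro decseq_SucI) (auto intro!: mult_right_le_one_le prod_nonneg simp: less_imp_le)
  moreover have "0 \<le> (\<Prod>j<n. min 1 (w j))" for n
    using w by (intro prod_nonneg) (auto simp: less_imp_le)
  ultimately have 2: "convergent (\<lambda>n. \<Prod>j<n. min 1 (w j))"
    by (intro Bseq_monoseq_convergent decseq_imp_monoseq)
       (auto intro!: BseqI'[of _ 1] prod_le_1 simp: less_imp_le w)
  have "(\<Prod>j<n. w j) = (\<Prod>j<n. max 1 (w j)) * (\<Prod>j<n. min 1 (w j))" for n
    unfolding prod.distrib[symmetric] by (rule prod.cong) (auto simp: max_def min_def)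
  then show ?thesis using convergent_mult[OF 1 2] by simp
qed

lemma bounded_range_max:
  fixes a c :: "nat \<Rightarrow> real"
  assumes "bounded (range a)" "bounded (range c)"
  shows "bounded (range (\<lambda>j. max (a j) (c j)))"
proof -
  obtain A C where "\<And>j. \<bar>a j\<bar> \<le> A" "\<And>j. \<bar>c j\<bar> \<le> C"
    using assms unfolding bounded_iff by auto
  then have "\<bar>max (a j) (c j)\<bar> \<le> max A C" for j
    by (smt (verit))
  then show ?thesis unfolding bounded_iff by auto
qed

lemma bounded_range_uminus:
  fixes a :: "nat \<Rightarrow> real"
  shows "bounded (range a) \<Longrightarrow> bounded (range (\<lambda>j. - a j))"
  unfolding bounded_iff by auto

lemma bounded_range_min:
  fixes a c :: "nat \<Rightarrow> real"
  assumes "bounded (range a)" "bounded (range c)"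
  shows "bounded (range (\<lambda>j. min (a j) (c j)))"
proof -
  have "bounded (range (\<lambda>j. - max (- a j) (- c j)))"
    using assms by (intro bounded_range_uminus bounded_range_max)
  moreover have "(\<lambda>j. - max (- a j) (- c j)) = (\<lambda>j. min (a j) (c j))" by (auto simp: max_def min_def)
  ultimately show ?thesis by (simp only:)
qed

section \<open>Intersections of blocks and positivity of the volume\<close>

context onb
begin

lemma mem_block: "x \<in> block e a b \<longleftrightarrow> (\<forall>j. a j \<le> x \<bullet> e j \<and> x \<bullet> e j < b j)"
  by (simp add: block_def)

lemma block_Int: "block e a b \<inter> block e c d = block e (\<lambda>j. max (a j) (c j)) (\<lambda>j. min (b j) (d j))"
  by (auto simp: mem_block)

lemma block_volume_LIMSEQ:
  assumes "abs_measurable e a b" "block e a b \<noteq> {}"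
  shows "(\<lambda>n. \<Prod>j<n. b j - a j) \<longlonglongrightarrow> block_volume e a b"
  using assms convergent_prod_ln_pos_part[of "\<lambda>j. b j - a j"]
  by (simp add: block_volume_def abs_measurable_def block_bounds_def convergent_LIMSEQ_iff)

text \<open>Clamping a common point \<open>q\<close> of the intervals to \<open>[-s, s]\<close>, where \<open>s\<close> is the sum of the moduli
  of points of the individual intervals, keeps it in every interval.\<close>

lemma blocks_common_point:
  assumes I: "finite I" and p: "\<And>i. i \<in> I \<Longrightarrow> p i \<in> block e (a i) (b i)"
    and q: "\<And>i j. i \<in> I \<Longrightarrow> a i j \<le> q j \<and> q j < b i j"
  shows "(\<Inter>i\<in>I. block e (a i) (b i)) \<noteq> {}"
proof -
  define s where "s j = (\<Sum>i\<in>I. \<bar>p i \<bullet> e j\<bar>)" for j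
  define c where "c j = max (- s j) (min (s j) (q j))" for j
  have s0: "s j \<ge> 0" for j by (simp add: s_def sum_nonneg)
  \<comment> \<open>Cauchy-Schwarz for a finite sum gives the factor \<open>card I\<close> and makes
    \<open>s\<close> square summable, so that the clamped sequence is the coordinate sequence of a
    vector.\<close>
  have sq: "(s j)\<^sup>2 \<le> of_nat (card I) * (\<Sum>i\<in>I. (p i \<bullet> e j)\<^sup>2)" for j
    using sum_squared_le_sum_of_squares[of "\<lambda>i. \<bar>p i \<bullet> e j\<bar>" I] by (simp add: s_def mult.commute)
  have "summable (\<lambda>j. of_nat (card I) * (\<Sum>i\<in>I. (p i \<bullet> e j)\<^sup>2))"
    by (intro summable_mult summable_sum summable_coord_sq)
  note sm = this
  have cle: "(c j)\<^sup>2 \<le> of_nat (card I) * (\<Sum>i\<in>I. (p i \<bullet> e j)\<^sup>2)" for j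
  proof -
    have "\<bar>c j\<bar> \<le> \<bar>s j\<bar>" using s0[of j] by (auto simp: c_def)
    then show ?thesis using sq[of j] by (simp only: abs_le_square_iff)
  qed
  have "summable (\<lambda>j. (c j)\<^sup>2)"
    by (rule summable_comparison_test'[OF sm, of 0]) (simp add: cle)
  then obtain z where z: "\<And>j. z \<bullet> e j = c j" using obtain_vector by blast
  have "z \<in> block e (a i) (b i)" if i: "i \<in> I" for i
    unfolding mem_block z
  proof
    fix j
    \<comment> \<open>The interval contains a point of [-s, s], namely the coordinate of
      \<open>p i\<close>, so clamping moves \<open>q j\<close> towards this point and never past
      it.\<close>
    have "\<bar>p i \<bullet> e j\<bar> \<le> s j" unfolding s_def using I i by (intro member_le_sum) auto
    moreover have "a i j \<le> p i \<bullet> e j \<and> p i \<bullet> e j < b i j" using p[OF i] by (simp add: mem_block)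
    ultimately show "a i j \<le> c j \<and> c j < b i j" using q[OF i, of j] by (auto simp: c_def)
  qed
  then show ?thesis by blast
qed

text \<open>Disjointness is decided in a single coordinate. If all intervals meet, the left end
  points \<open>max (a j) (c j)\<close> need not be the coordinates of a vector, but
  \<open>blocks_common_point\<close> replaces them by ones that are.\<close>

lemma block_Int_empty_iff:
  assumes "block e a b \<noteq> {}" "block e c d \<noteq> {}"
  shows "block e a b \<inter> block e c d = {} \<longleftrightarrow> (\<exists>j. min (b j) (d j) \<le> max (a j) (c j))"
proof
  assume emp: "block e a b \<inter> block e c d = {}"
  show "\<exists>j. min (b j) (d j) \<le> max (a j) (c j)"
  proof (rule ccontr)
    assume "\<not> ?thesis"
    then have lt: "max (a j) (c j) < min (b j) (d j)" for j by (auto simp: not_le)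
    obtain x y where xy: "x \<in> block e a b" "y \<in> block e c d" using assms by auto
    have "(\<Inter>i\<in>{True, False}. block e (if i then a else c) (if i then b else d)) \<noteq> {}"
    proof (rule blocks_common_point)
      show "(if i then x else y) \<in> block e (if i then a else c) (if i then b else d)" for i
        using xy by simp
      show "(if i then a else c) j \<le> max (a j) (c j) \<and> max (a j) (c j) < (if i then b else d) j" for i j
        using lt[of j] by auto
    qed simp
    then show False using emp by auto
  qed
next
  assume "\<exists>j. min (b j) (d j) \<le> max (a j) (c j)"
  then obtain j where j: "min (b j) (d j) \<le> max (a j) (c j)" by blast
  have "x \<notin> block e a b \<inter> block e c d" for x
  proof
    assume "x \<in> block e a b \<inter> block e c d"
    then have "a j \<le> x \<bullet> e j" "x \<bullet> e j < b j" "c j \<le> x \<bullet> e j" "x \<bullet> e j < d j" by (auto simp: mem_block)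
    then show False using j by linarith
  qed
  then show "block e a b \<inter> block e c d = {}" by blast
qed

text \<open>A common point makes the intersected intervals nondegenerate, as
  \<open>block_bounds\<close> demands; their widths only shrink. For disjoint blocks the bounds of
  the intersection can be reversed, so that case is always treated separately.\<close>

lemma block_Int_cases:
  assumes "abs_measurable e a b" "abs_measurable e c d" "block e a b \<inter> block e c d \<noteq> {}"
  shows "abs_measurable e (\<lambda>j. max (a j) (c j)) (\<lambda>j. min (b j) (d j))"
proof -
  have ne: "block e a b \<noteq> {}" "block e c d \<noteq> {}" using assms(3) by auto
  have lt: "max (a j) (c j) < min (b j) (d j)" for j
    using block_Int_empty_iff[OF ne] assms(3) by (auto simp: not_le)
  have bd: "bounded (range a)" "bounded (range b)" "bounded (range c)" "bounded (range d)"
    and s: "summable (\<lambda>j. max 0 (ln (b j - a j)))"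
    using assms(1,2) ne by (auto simp: abs_measurable_def block_bounds_def)
  have "bounded (range (\<lambda>j. max (a j) (c j)))" "bounded (range (\<lambda>j. min (b j) (d j)))"
    using bd by (auto intro: bounded_range_max bounded_range_min)
  moreover have "summable (\<lambda>j. max 0 (ln (min (b j) (d j) - max (a j) (c j))))"
  proof (rule summable_comparison_test'[OF s])
    fix j
    show "norm (max 0 (ln (min (b j) (d j) - max (a j) (c j)))) \<le> max 0 (ln (b j - a j))"
    proof -
      have "ln (min (b j) (d j) - max (a j) (c j)) \<le> ln (b j - a j)"
        using lt[of j] by (subst ln_le_cancel_iff) auto
      then show ?thesis by simp
    qed
  qed
  ultimately show ?thesis using lt by (auto simp: abs_measurable_def block_bounds_def)
qed

text \<open>Choose \<open>N0\<close> so large that every subfamily of the blocks with empty intersection already has an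
  empty intersection in the first \<open>N0\<close> coordinates. Then for \<open>n \<ge> N0\<close> every point of \<open>\<real>\<^sup>n\<close>
  that lies in some projected block extends to a vector \<open>y\<close> contained in exactly the blocks whose
  projections contain the point.\<close>

lemma blocks_combination_nonneg_aux:
  assumes I: "finite I" and m: "\<And>i. i \<in> I \<Longrightarrow> abs_measurable e (a i) (b i)"
    and ne: "\<And>i. i \<in> I \<Longrightarrow> block e (a i) (b i) \<noteq> {}"
    and nonneg: "\<And>x. 0 \<le> (\<Sum>i\<in>I. c i * indicator (block e (a i) (b i)) x)"
  shows "0 \<le> (\<Sum>i\<in>I. c i * block_volume e (a i) (b i))"
proof -
  have "\<forall>J\<in>Pow I. \<exists>N. (\<Inter>i\<in>J. block e (a i) (b i)) = {} \<longrightarrow>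
      (\<forall>q. \<exists>j<N. \<exists>i\<in>J. \<not> (a i j \<le> q j \<and> q j < b i j))"
  proof
    fix J assume J: "J \<in> Pow I"
    then have fJ: "finite J" using I by (auto intro: finite_subset)
    show "\<exists>N. (\<Inter>i\<in>J. block e (a i) (b i)) = {} \<longrightarrow>
      (\<forall>q. \<exists>j<N. \<exists>i\<in>J. \<not> (a i j \<le> q j \<and> q j < b i j))"
    proof (rule ccontr)
      assume "\<not> ?thesis"
      then have h: "\<forall>N. (\<Inter>i\<in>J. block e (a i) (b i)) = {} \<and>
          (\<exists>q. \<forall>j<N. \<forall>i\<in>J. a i j \<le> q j \<and> q j < b i j)" by simp
      then have "\<exists>q. \<forall>N. \<forall>j<N. \<forall>i\<in>J. a i j \<le> q N j \<and> q N j < b i j" by (intro choice) simp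
      then obtain q where q: "\<And>N j i. j < N \<Longrightarrow> i \<in> J \<Longrightarrow> a i j \<le> q N j \<and> q N j < b i j" by auto
      have p: "(SOME x. x \<in> block e (a i) (b i)) \<in> block e (a i) (b i)" if "i \<in> J" for i
        using ne[of i] J that by (auto simp: some_in_eq)
      \<comment> \<open>The point \<open>q N\<close> is only controlled in coordinates below
        \<open>N\<close>; the diagonal takes coordinate \<open>j\<close> from
        \<open>q (Suc j)\<close> and is controlled everywhere.\<close>
      have q': "a i j \<le> q (Suc j) j \<and> q (Suc j) j < b i j" if "i \<in> J" for i j
        using q[of j "Suc j" i] that by simp
      have "(\<Inter>i\<in>J. block e (a i) (b i)) \<noteq> {}"
        by (rule blocks_common_point[OF fJ p q'])
      then show False using h by blast
    qed
  qed
  from bchoice[OF this] obtain N where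
    "\<forall>J\<in>Pow I. (\<Inter>i\<in>J. block e (a i) (b i)) = {} \<longrightarrow>
      (\<forall>q. \<exists>j<N J. \<exists>i\<in>J. \<not> (a i j \<le> q j \<and> q j < b i j))" ..
  then have N: "\<exists>j<N J. \<exists>i\<in>J. \<not> (a i j \<le> q j \<and> q j < b i j)"
    if "J \<subseteq> I" "(\<Inter>i\<in>J. block e (a i) (b i)) = {}" for J q
    using that by simp
  define N0 where "N0 = Max (N ` Pow I)"
  have N0: "N J \<le> N0" if "J \<subseteq> I" for J unfolding N0_def using I that by (intro Max_ge) auto
  have box: "0 \<le> (\<Sum>i\<in>I. c i * (\<Prod>j<n. indicator {a i j..<b i j} (x j)))" if n: "n \<ge> N0" for n and x :: "nat \<Rightarrow> real"
  proof -
    define J where "J = {i\<in>I. \<forall>j<n. x j \<in> {a i j..<b i j}}"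
    have JI: "J \<subseteq> I" by (auto simp: J_def)
    have "(\<Inter>i\<in>J. block e (a i) (b i)) \<noteq> {}"
    proof
      assume "(\<Inter>i\<in>J. block e (a i) (b i)) = {}"
      from N[OF JI this, of x] obtain j i where "j < N J" "i \<in> J" "\<not> (a i j \<le> x j \<and> x j < b i j)" by blast
      then show False using N0[OF JI] n by (auto simp: J_def)
    qed
    then obtain z where z: "\<And>i. i \<in> J \<Longrightarrow> z \<in> block e (a i) (b i)" by blast
    \<comment> \<open>A finite change of \<open>z\<close> stays in the space. It keeps
      \<open>y\<close> in the blocks of \<open>J\<close>, and every other block already fails in one
      of the first \<open>n\<close> coordinates.\<close>
    define y where "y = z + (\<Sum>j<n. (x j - z \<bullet> e j) *\<^sub>R e j)"
    have ye: "y \<bullet> e j = (if j < n then x j else z \<bullet> e j)" for j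
      by (simp add: y_def inner_add_left sum_inner_e)
    have "y \<in> block e (a i) (b i) \<longleftrightarrow> i \<in> J" if "i \<in> I" for i
      using z[of i] that by (auto simp: mem_block ye J_def)
    then have "indicator (block e (a i) (b i)) y = (\<Prod>j<n. indicator {a i j..<b i j} (x j) :: real)" if "i \<in> I" for i
      using that by (auto simp: indicator_def J_def prod_eq_1_iff intro!: prod_zero[symmetric] prod.neutral[symmetric])
    then show ?thesis using nonneg[of y] by (simp cong: sum.cong)
  qed
  have "0 \<le> (\<Sum>i\<in>I. c i * (\<Prod>j<n. b i j - a i j))" if "n \<ge> N0" for n
    using m box[OF that] by (intro box_combination_nonneg[OF I]) (auto simp: abs_measurable_def block_bounds_def less_imp_le)
  moreover have "(\<lambda>n. \<Sum>i\<in>I. c i * (\<Prod>j<n. b i j - a i j)) \<longlonglongrightarrow> (\<Sum>i\<in>I. c i * block_volume e (a i) (b i))"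
    by (intro tendsto_intros block_volume_LIMSEQ m ne)
  ultimately show ?thesis by (intro LIMSEQ_le_const) auto
qed

text \<open>Empty blocks are removed first because their bounds say nothing about their volume: with
  all intervals equal to [1,2) the block is empty, yet every partial product is 1.\<close>

lemma blocks_combination_nonneg:
  assumes I: "finite I" and m: "\<And>i. i \<in> I \<Longrightarrow> abs_measurable e (a i) (b i)"
    and nonneg: "\<And>x. 0 \<le> (\<Sum>i\<in>I. c i * indicator (block e (a i) (b i)) x)"
  shows "0 \<le> (\<Sum>i\<in>I. c i * block_volume e (a i) (b i))"
proof -
  let ?I = "{i\<in>I. block e (a i) (b i) \<noteq> {}}"
  have "(\<Sum>i\<in>I. c i * indicator (block e (a i) (b i)) x) = (\<Sum>i\<in>?I. c i * indicator (block e (a i) (b i)) x)" for x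
    by (rule sum.mono_neutral_right) (auto simp: I)
  then have "0 \<le> (\<Sum>i\<in>?I. c i * block_volume e (a i) (b i))"
    using I m nonneg by (intro blocks_combination_nonneg_aux) auto
  also have "\<dots> = (\<Sum>i\<in>I. c i * block_volume e (a i) (b i))"
    by (rule sum.mono_neutral_left) (auto simp: I block_volume_def)
  finally show ?thesis .
qed

end

section \<open>The generated ring and the extension of the volume to it\<close>

lemma ring_of_sets_Inter:
  assumes "\<And>R. R \<in> \<R> \<Longrightarrow> ring_of_sets UNIV R"
  shows "ring_of_sets UNIV (\<Inter>\<R>)"
  using assms by (auto simp: ring_of_sets_iff)

context onb
begin

lemma ring_block_ring: "ring_of_sets UNIV (block_ring e)"
  unfolding block_ring_def by (rule ring_of_sets_Inter) blast

lemma block_in_block_ring: "abs_measurable e a b \<Longrightarrow> block e a b \<in> block_ring e"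
  unfolding block_ring_def by blast

lemma block_ring_minimal:
  assumes "ring_of_sets UNIV R" "\<And>a b. abs_measurable e a b \<Longrightarrow> block e a b \<in> R"
  shows "block_ring e \<subseteq> R"
  unfolding block_ring_def using assms by blast

text \<open>Lists serve as formal linear combinations: concatenation is addition, and the same set
  may occur repeatedly or with different bounds.\<close>

definition comb :: "(real \<times> (nat \<Rightarrow> real) \<times> (nat \<Rightarrow> real)) list \<Rightarrow> 'a \<Rightarrow> real" where
  "comb xs x = (\<Sum>(c, a, b)\<leftarrow>xs. c * indicator (block e a b) x)"

definition comb_volume :: "(real \<times> (nat \<Rightarrow> real) \<times> (nat \<Rightarrow> real)) list \<Rightarrow> real" where
  "comb_volume xs = (\<Sum>(c, a, b)\<leftarrow>xs. c * block_volume e a b)"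

definition valid_comb :: "(real \<times> (nat \<Rightarrow> real) \<times> (nat \<Rightarrow> real)) list \<Rightarrow> bool" where
  "valid_comb xs \<longleftrightarrow> (\<forall>(c, a, b)\<in>set xs. abs_measurable e a b)"

definition scale_comb ::
  "real \<Rightarrow> (real \<times> (nat \<Rightarrow> real) \<times> (nat \<Rightarrow> real)) list \<Rightarrow> (real \<times> (nat \<Rightarrow> real) \<times> (nat \<Rightarrow> real)) list" where
  "scale_comb r = map (\<lambda>(c, a, b). (r * c, a, b))"

lemma comb_simps [simp]:
  "comb [] x = 0" "comb ((c, a, b) # xs) x = c * indicator (block e a b) x + comb xs x"
  "comb (xs @ ys) x = comb xs x + comb ys x" "comb (scale_comb r xs) x = r * comb xs x"
proof -
  show "comb (scale_comb r xs) x = r * comb xs x"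
    by (induction xs) (auto simp: comb_def scale_comb_def algebra_simps)
qed (simp_all add: comb_def)

lemma comb_volume_simps [simp]:
  "comb_volume [] = 0" "comb_volume ((c, a, b) # xs) = c * block_volume e a b + comb_volume xs"
  "comb_volume (xs @ ys) = comb_volume xs + comb_volume ys"
  "comb_volume (scale_comb r xs) = r * comb_volume xs"
proof -
  show "comb_volume (scale_comb r xs) = r * comb_volume xs"
    by (induction xs) (auto simp: comb_volume_def scale_comb_def algebra_simps)
qed (simp_all add: comb_volume_def)

lemma valid_comb_simps [simp]:
  "valid_comb []" "valid_comb ((c, a, b) # xs) \<longleftrightarrow> abs_measurable e a b \<and> valid_comb xs"
  "valid_comb (xs @ ys) \<longleftrightarrow> valid_comb xs \<and> valid_comb ys"
  "valid_comb (scale_comb r xs) \<longleftrightarrow> valid_comb xs"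
  by (simp_all add: valid_comb_def scale_comb_def ball_Un split_beta)

lemma comb_eq_sum:
  "comb xs x = (\<Sum>i<length xs. fst (xs ! i) * indicator (block e (fst (snd (xs ! i))) (snd (snd (xs ! i)))) x)"
  by (simp add: comb_def sum_list_sum_nth atLeast0LessThan split_beta)

lemma comb_volume_eq_sum:
  "comb_volume xs = (\<Sum>i<length xs. fst (xs ! i) * block_volume e (fst (snd (xs ! i))) (snd (snd (xs ! i))))"
  by (simp add: comb_volume_def sum_list_sum_nth atLeast0LessThan split_beta)

lemma valid_comb_nth:
  "valid_comb xs \<Longrightarrow> i < length xs \<Longrightarrow> abs_measurable e (fst (snd (xs ! i))) (snd (snd (xs ! i)))"
  by (auto simp: valid_comb_def split_beta)

lemma comb_volume_nonneg:
  assumes "valid_comb xs" "\<And>x. 0 \<le> comb xs x"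
  shows "0 \<le> comb_volume xs"
  unfolding comb_volume_eq_sum using assms
  by (intro blocks_combination_nonneg) (auto simp: comb_eq_sum valid_comb_nth)

text \<open>Positivity applied to both differences. This makes the volume of a set independent of
  the combination that represents its indicator.\<close>

lemma comb_volume_cong:
  assumes "valid_comb xs" "valid_comb ys" "\<And>x. comb xs x = comb ys x"
  shows "comb_volume xs = comb_volume ys"
proof (rule antisym)
  show "comb_volume xs \<le> comb_volume ys"
    using comb_volume_nonneg[of "ys @ scale_comb (-1) xs"] assms by simp
  show "comb_volume ys \<le> comb_volume xs"
    using comb_volume_nonneg[of "xs @ scale_comb (-1) ys"] assms by simp
qed

text \<open>Products of indicators are indicators of intersections, and those are blocks again.
  Disjoint pairs contribute nothing and are skipped, since their formal bounds may be
  inadmissible.\<close>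

lemma comb_mult_single:
  assumes ab: "abs_measurable e a b"
  shows "valid_comb ys \<Longrightarrow> \<exists>zs. valid_comb zs \<and> (\<forall>x. comb zs x = indicator (block e a b) x * comb ys x)"
proof (induction ys)
  case Nil
  then show ?case by (intro exI[of _ "[]"]) simp
next
  case (Cons y ys)
  obtain c a' b' where y: "y = (c, a', b')" by (cases y)
  have ab': "abs_measurable e a' b'" and v: "valid_comb ys" using Cons.prems by (auto simp: y)
  from Cons.IH[OF v] obtain zs where zs: "valid_comb zs" "\<And>x. comb zs x = indicator (block e a b) x * comb ys x"
    by blast
  show ?case
  proof (cases "block e a b \<inter> block e a' b' = {}")
    case True
    have "comb zs x = indicator (block e a b) x * comb (y # ys) x" for x
      using True by (auto simp: y zs(2) indicator_def)
    then show ?thesis using zs(1) by blast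
  next
    case False
    let ?z = "(c, \<lambda>j. max (a j) (a' j), \<lambda>j. min (b j) (b' j))"
    have "comb (?z # zs) x = indicator (block e a b) x * comb (y # ys) x" for x
      by (auto simp: y zs(2) indicator_def block_Int[symmetric])
    moreover have "valid_comb (?z # zs)" using block_Int_cases[OF ab ab' False] zs(1) by simp
    ultimately show ?thesis by blast
  qed
qed

lemma comb_mult:
  assumes ys: "valid_comb ys"
  shows "valid_comb xs \<Longrightarrow> \<exists>zs. valid_comb zs \<and> (\<forall>x. comb zs x = comb xs x * comb ys x)"
proof (induction xs)
  case Nil
  then show ?case by (intro exI[of _ "[]"]) simp
next
  case (Cons y xs)
  obtain c a b where y: "y = (c, a, b)" by (cases y)
  have ab: "abs_measurable e a b" and v: "valid_comb xs" using Cons.prems by (auto simp: y)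
  from Cons.IH[OF v] obtain zs where zs: "valid_comb zs" "\<And>x. comb zs x = comb xs x * comb ys x" by blast
  from comb_mult_single[OF ab ys] obtain ws
    where ws: "valid_comb ws" "\<And>x. comb ws x = indicator (block e a b) x * comb ys x" by blast
  have "comb (scale_comb c ws @ zs) x = comb (y # xs) x * comb ys x" for x
    by (simp add: y ws(2) zs(2) algebra_simps)
  moreover have "valid_comb (scale_comb c ws @ zs)" using ws zs by simp
  ultimately show ?case by blast
qed

definition represents :: "(real \<times> (nat \<Rightarrow> real) \<times> (nat \<Rightarrow> real)) list \<Rightarrow> 'a set \<Rightarrow> bool" where
  "represents xs A \<longleftrightarrow> valid_comb xs \<and> (\<forall>x. comb xs x = indicator A x)"

lemma represents_block: "abs_measurable e a b \<Longrightarrow> represents [(1, a, b)] (block e a b)"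
  by (simp add: represents_def)

lemma represents_Un_disjoint:
  "represents xs A \<Longrightarrow> represents ys B \<Longrightarrow> A \<inter> B = {} \<Longrightarrow> represents (xs @ ys) (A \<union> B)"
  by (auto simp: represents_def indicator_def)

text \<open>With 1_A for the indicator: 1_(A Un B) = 1_A + 1_B - 1_A 1_B and 1_(A - B) = 1_A - 1_A
  1_B, and combinations are closed under products. By minimality every set of the generated ring is
  represented.\<close>

lemma ring_represented: "ring_of_sets UNIV {A. \<exists>xs. represents xs A}"
proof (rule ring_of_setsI)
  show "{} \<in> {A. \<exists>xs. represents xs A}" by (auto simp: represents_def intro!: exI[of _ "[]"])
  fix A B assume "A \<in> {A. \<exists>xs. represents xs A}" "B \<in> {A. \<exists>xs. represents xs A}"
  then obtain xs ys where xs: "valid_comb xs" "\<And>x. comb xs x = indicator A x"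
    and ys: "valid_comb ys" "\<And>x. comb ys x = indicator B x" by (auto simp: represents_def)
  from comb_mult[OF ys(1) xs(1)] obtain zs
    where zs: "valid_comb zs" "\<And>x. comb zs x = comb xs x * comb ys x" by blast
  have "represents (xs @ ys @ scale_comb (-1) zs) (A \<union> B)"
    using xs ys zs by (auto simp: represents_def indicator_def)
  moreover have "represents (xs @ scale_comb (-1) zs) (A - B)"
    using xs ys zs by (auto simp: represents_def indicator_def)
  ultimately show "A \<union> B \<in> {A. \<exists>xs. represents xs A}" "A - B \<in> {A. \<exists>xs. represents xs A}" by blast+
qed simp

lemma block_ring_represented: "A \<in> block_ring e \<Longrightarrow> \<exists>xs. represents xs A"
  using block_ring_minimal[OF ring_represented] represents_block by blast

text \<open>The chosen representation is immaterial by \<open>comb_volume_cong\<close>. The value 0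
  off the ring matches the last condition in \<open>ring_measure\<close>.\<close>

definition ring_volume :: "'a set \<Rightarrow> real" where
  "ring_volume A = (if A \<in> block_ring e then comb_volume (SOME xs. represents xs A) else 0)"

lemma ring_volume_eq:
  assumes A: "A \<in> block_ring e" and xs: "represents xs A"
  shows "ring_volume A = comb_volume xs"
proof -
  have "represents (SOME xs. represents xs A) A" using someI_ex[OF block_ring_represented[OF A]] .
  then show ?thesis using A xs by (auto simp: ring_volume_def represents_def intro!: comb_volume_cong)
qed

lemma shift_block:
  "(+) h ` block e a b = block e (\<lambda>j. a j + h \<bullet> e j) (\<lambda>j. b j + h \<bullet> e j)" (is "?L = ?R")
proof
  show "?L \<subseteq> ?R" by (auto simp: mem_block inner_add_left)
  show "?R \<subseteq> ?L"
  proof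
    fix x assume "x \<in> ?R"
    then have "x - h \<in> block e a b" by (auto simp: mem_block inner_diff_left algebra_simps)
    then show "x \<in> ?L" by (force intro!: image_eqI[of _ _ "x - h"])
  qed
qed

lemma abs_inner_e_le: "\<bar>h \<bullet> e j\<bar> \<le> norm h"
  using Cauchy_Schwarz_ineq2[of h "e j"] by simp

lemma bounded_range_shift:
  assumes "bounded (range a)"
  shows "bounded (range (\<lambda>j. a j + h \<bullet> e j))"
proof -
  obtain A where A: "\<And>j. \<bar>a j\<bar> \<le> A" using assms unfolding bounded_iff by auto
  have "\<bar>a j + h \<bullet> e j\<bar> \<le> A + norm h" for j using A[of j] abs_inner_e_le[of h j] by linarith
  then show ?thesis unfolding bounded_iff by auto
qed

lemma block_shift_empty_iff:
  "block e (\<lambda>j. a j + h \<bullet> e j) (\<lambda>j. b j + h \<bullet> e j) = {} \<longleftrightarrow> block e a b = {}"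
  unfolding shift_block[symmetric] by simp

lemma abs_measurable_shift:
  "abs_measurable e a b \<Longrightarrow> abs_measurable e (\<lambda>j. a j + h \<bullet> e j) (\<lambda>j. b j + h \<bullet> e j)"
  by (auto simp: abs_measurable_def block_bounds_def bounded_range_shift block_shift_empty_iff)

lemma block_volume_shift:
  "block_volume e (\<lambda>j. a j + h \<bullet> e j) (\<lambda>j. b j + h \<bullet> e j) = block_volume e a b"
  by (simp add: block_volume_def block_shift_empty_iff)

lemma shift_Diff: "(+) (h::'a) ` (A - B) = (+) h ` A - (+) h ` B"
  by (rule image_set_diff) (simp add: inj_def)

text \<open>The sets whose translate lies in the ring form a ring containing all blocks, so
  minimality applies.\<close>

lemma block_ring_shift: "A \<in> block_ring e \<Longrightarrow> (+) h ` A \<in> block_ring e"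
proof -
  interpret ring_of_sets UNIV "block_ring e" by (rule ring_block_ring)
  have "block_ring e \<subseteq> {A. (+) h ` A \<in> block_ring e}"
  proof (rule block_ring_minimal)
    show "ring_of_sets UNIV {A. (+) h ` A \<in> block_ring e}"
      by (rule ring_of_setsI) (auto simp: shift_Diff image_Un)
  qed (simp add: shift_block block_in_block_ring abs_measurable_shift)
  then show "A \<in> block_ring e \<Longrightarrow> (+) h ` A \<in> block_ring e" by blast
qed

lemma indicator_shift: "indicator ((+) h ` A) x = (indicator A (x - h) :: 'c::zero_neq_one)" for h :: 'a
proof -
  have "x \<in> (+) h ` A \<longleftrightarrow> x - h \<in> A" by (force intro!: image_eqI[of _ _ "x - h"])
  then show ?thesis by (simp add: indicator_def)
qed

lemma represents_shift:
  assumes "represents xs A"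
  shows "\<exists>ys. represents ys ((+) h ` A) \<and> comb_volume ys = comb_volume xs"
proof -
  let ?f = "\<lambda>(c, a, b). (c::real, \<lambda>j. a j + h \<bullet> e j, \<lambda>j. b j + h \<bullet> e j)"
  have "comb (map ?f xs) x = comb xs (x - h)" for x
    by (induction xs) (auto simp: shift_block[symmetric] indicator_shift)
  moreover have "comb_volume (map ?f xs) = comb_volume xs"
    by (induction xs) (auto simp: block_volume_shift)
  moreover have "valid_comb xs \<Longrightarrow> valid_comb (map ?f xs)"
    by (induction xs) (auto simp: abs_measurable_shift)
  ultimately show ?thesis using assms
    by (intro exI[of _ "map ?f xs"]) (auto simp: represents_def indicator_shift)
qed

definition is_ring_measure :: "('a set \<Rightarrow> real) \<Rightarrow> bool" where
  "is_ring_measure m \<longleftrightarrow>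
     (\<forall>A\<in>block_ring e. 0 \<le> m A) \<and>
     additive (block_ring e) m \<and>
     (\<forall>A\<in>block_ring e. \<forall>h. m ((+) h ` A) = m A) \<and>
     (\<forall>a b. abs_measurable e a b \<longrightarrow> m (block e a b) = block_volume e a b) \<and>
     (\<forall>A. A \<notin> block_ring e \<longrightarrow> m A = 0)"

lemma is_ring_measure_ring_volume: "is_ring_measure ring_volume"
  unfolding is_ring_measure_def
proof (intro conjI ballI allI impI)
  interpret ring_of_sets UNIV "block_ring e" by (rule ring_block_ring)
  show "0 \<le> ring_volume A" if A: "A \<in> block_ring e" for A
  proof -
    obtain xs where xs: "represents xs A" using block_ring_represented[OF A] by blast
    show ?thesis unfolding ring_volume_eq[OF A xs]
      using xs by (intro comb_volume_nonneg) (auto simp: represents_def)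
  qed
  show "additive (block_ring e) ring_volume"
    unfolding additive_def
  proof (intro ballI impI)
    fix A B assume AB: "A \<in> block_ring e" "B \<in> block_ring e" "A \<inter> B = {}"
    obtain xs where xs: "represents xs A" using block_ring_represented[OF AB(1)] by blast
    obtain ys where ys: "represents ys B" using block_ring_represented[OF AB(2)] by blast
    show "ring_volume (A \<union> B) = ring_volume A + ring_volume B"
      using ring_volume_eq[OF Un[OF AB(1,2)] represents_Un_disjoint[OF xs ys AB(3)]]
        ring_volume_eq[OF AB(1) xs] ring_volume_eq[OF AB(2) ys] by simp
  qed
  show "ring_volume ((+) h ` A) = ring_volume A" if A: "A \<in> block_ring e" for A h
  proof -
    obtain xs where xs: "represents xs A" using block_ring_represented[OF A] by blast
    from represents_shift[OF this] obtain ys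
      where ys: "represents ys ((+) h ` A)" "comb_volume ys = comb_volume xs" by blast
    show ?thesis
      using ring_volume_eq[OF A xs] ring_volume_eq[OF block_ring_shift[OF A] ys(1)] ys(2) by simp
  qed
  show "ring_volume (block e a b) = block_volume e a b" if "abs_measurable e a b" for a b
    using ring_volume_eq[OF block_in_block_ring[OF that] represents_block[OF that]] by simp
  show "ring_volume A = 0" if "A \<notin> block_ring e" for A using that by (simp add: ring_volume_def)
qed

text \<open>A representing combination minus the indicator of \<open>A\<close> vanishes identically;
  an additive function respects this relation, so its value at \<open>A\<close> is fixed by the
  volumes of blocks.\<close>

lemma is_ring_measure_unique:
  assumes m: "is_ring_measure m"
  shows "m = ring_volume"
proof
  fix A
  interpret ring_of_sets UNIV "block_ring e" by (rule ring_block_ring)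
  show "m A = ring_volume A"
  proof (cases "A \<in> block_ring e")
    case False
    then show ?thesis using m by (simp add: is_ring_measure_def ring_volume_def)
  next
    case A: True
    obtain xs where xs: "represents xs A" using block_ring_represented[OF A] by blast
    have add: "additive (block_ring e) m" and mb: "\<And>a b. abs_measurable e a b \<Longrightarrow> m (block e a b) = block_volume e a b"
      using m by (auto simp: is_ring_measure_def)
    define n where "n = length xs"
    \<comment> \<open>The set \<open>A\<close> is appended as entry \<open>n\<close> with
      coefficient -1, which turns the representation into one relation with right-hand side
      0.\<close>
    define B where "B i = (if i = n then A else block e (fst (snd (xs ! i))) (snd (snd (xs ! i))))" for i
    define c where "c i = (if i = n then -1 else fst (xs ! i))" for i
    have v: "\<And>i. i < n \<Longrightarrow> abs_measurable e (fst (snd (xs ! i))) (snd (snd (xs ! i)))"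
      using xs by (auto simp: represents_def valid_comb_nth n_def)
    have "(\<Sum>i\<in>{..n}. c i * m (B i)) = 0"
    proof (rule additive_linear_relation[OF add])
      show "B i \<in> block_ring e" if "i \<in> {..n}" for i
        using that A v by (auto simp: B_def intro: block_in_block_ring)
      fix x
      have "(\<Sum>i\<in>{..n}. c i * indicator (B i) x) = (\<Sum>i<n. c i * indicator (B i) x) - indicator A x"
        by (simp add: lessThan_Suc_atMost[symmetric] c_def B_def)
      also have "(\<Sum>i<n. c i * indicator (B i) x) = comb xs x"
        unfolding comb_eq_sum n_def[symmetric] by (rule sum.cong) (auto simp: c_def B_def)
      finally show "(\<Sum>i\<in>{..n}. c i * indicator (B i) x) = 0" using xs by (simp add: represents_def)
    qed simp
    moreover have "(\<Sum>i\<in>{..n}. c i * m (B i)) = (\<Sum>i<n. c i * m (B i)) - m A"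
      by (simp add: lessThan_Suc_atMost[symmetric] c_def B_def)
    moreover have "(\<Sum>i<n. c i * m (B i)) = comb_volume xs"
      unfolding comb_volume_eq_sum n_def[symmetric] by (rule sum.cong) (auto simp: c_def B_def mb v)
    ultimately show ?thesis using ring_volume_eq[OF A xs] by simp
  qed
qed

lemma is_ring_measure: "is_ring_measure (ring_measure e)"
proof -
  have "ring_measure e = (THE m. is_ring_measure m)"
    unfolding ring_measure_def is_ring_measure_def ..
  also have "\<dots> = ring_volume"
    using is_ring_measure_ring_volume is_ring_measure_unique by (rule the_equality)
  finally show ?thesis using is_ring_measure_ring_volume by simp
qed

lemma ring_measure_nonneg: "A \<in> block_ring e \<Longrightarrow> 0 \<le> ring_measure e A"
  and ring_measure_additive: "additive (block_ring e) (ring_measure e)"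
  and ring_measure_shift: "A \<in> block_ring e \<Longrightarrow> ring_measure e ((+) h ` A) = ring_measure e A"
  and ring_measure_block: "abs_measurable e a b \<Longrightarrow> ring_measure e (block e a b) = block_volume e a b"
  using is_ring_measure by (auto simp: is_ring_measure_def)

end

section \<open>The completion of the ring\<close>

context onb
begin

sublocale br: ring_of_sets UNIV "block_ring e"
  by (rule ring_block_ring)

lemmas ring_measure_mono = br.additive_mono(1)[OF ring_measure_additive ring_measure_nonneg]
lemmas ring_measure_Diff = br.additive_mono(2)[OF ring_measure_additive ring_measure_nonneg]
lemmas ring_measure_subadd = br.additive_subadd[OF ring_measure_additive ring_measure_nonneg]

lemma outer_lam_le:
  assumes "D \<in> block_ring e" "A \<subseteq> D"
  shows "outer_lam e A \<le> ring_measure e D"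
  unfolding outer_lam_def using assms
  by (intro cInf_lower) (auto intro!: bdd_belowI[of _ 0] ring_measure_nonneg)

lemma outer_lam_greatest:
  assumes "B \<in> block_ring e" "A \<subseteq> B" "\<And>D. D \<in> block_ring e \<Longrightarrow> A \<subseteq> D \<Longrightarrow> r \<le> ring_measure e D"
  shows "r \<le> outer_lam e A"
  unfolding outer_lam_def using assms by (intro cInf_greatest) auto

lemma inner_lam_ge:
  assumes B: "B \<in> block_ring e" "A \<subseteq> B" and C: "C \<in> block_ring e" "C \<subseteq> A"
  shows "ring_measure e C \<le> inner_lam e A"
  unfolding inner_lam_def
proof (rule cSup_upper)
  show "bdd_above {ring_measure e B |B. B \<in> block_ring e \<and> B \<subseteq> A}"
    using B by (auto intro!: bdd_aboveI[of _ "ring_measure e B"] ring_measure_mono)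
qed (use C in auto)

lemma inner_lam_least:
  assumes "\<And>C. C \<in> block_ring e \<Longrightarrow> C \<subseteq> A \<Longrightarrow> ring_measure e C \<le> r"
  shows "inner_lam e A \<le> r"
  unfolding inner_lam_def using assms by (intro cSup_least) (auto intro: br.empty_sets)

text \<open>The sandwich form of Jordan measurability: the measure of \<open>D - C\<close> bounds
  the gap between outer and inner measure. Closure properties then need only a choice of sets
  \<open>C\<close> and \<open>D\<close>.\<close>

lemma completed_ring_iff:
  "A \<in> completed_ring e \<longleftrightarrow>
    (\<forall>\<epsilon>>0. \<exists>C\<in>block_ring e. \<exists>D\<in>block_ring e. C \<subseteq> A \<and> A \<subseteq> D \<and> ring_measure e (D - C) < \<epsilon>)"
proof
  assume "A \<in> completed_ring e"
  then obtain B where B: "B \<in> block_ring e" "A \<subseteq> B" and eq: "inner_lam e A = outer_lam e A"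
    by (auto simp: completed_ring_def)
  show "\<forall>\<epsilon>>0. \<exists>C\<in>block_ring e. \<exists>D\<in>block_ring e. C \<subseteq> A \<and> A \<subseteq> D \<and> ring_measure e (D - C) < \<epsilon>"
  proof (intro allI impI)
    fix \<epsilon> :: real assume \<epsilon>: "\<epsilon> > 0"
    have "\<exists>D. D \<in> block_ring e \<and> A \<subseteq> D \<and> ring_measure e D < outer_lam e A + \<epsilon> / 2"
    proof (rule ccontr)
      assume "\<not> ?thesis"
      then have "outer_lam e A + \<epsilon> / 2 \<le> outer_lam e A"
        by (intro outer_lam_greatest[OF B]) (auto simp: not_less)
      then show False using \<epsilon> by simp
    qed
    then obtain D where D: "D \<in> block_ring e" "A \<subseteq> D" "ring_measure e D < outer_lam e A + \<epsilon> / 2" by blast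
    have "\<exists>C. C \<in> block_ring e \<and> C \<subseteq> A \<and> ring_measure e C > inner_lam e A - \<epsilon> / 2"
    proof (rule ccontr)
      assume "\<not> ?thesis"
      then have "inner_lam e A \<le> inner_lam e A - \<epsilon> / 2"
        by (intro inner_lam_least) (auto simp: not_less)
      then show False using \<epsilon> by simp
    qed
    then obtain C where C: "C \<in> block_ring e" "C \<subseteq> A" "ring_measure e C > inner_lam e A - \<epsilon> / 2" by blast
    have "ring_measure e (D - C) = ring_measure e D - ring_measure e C"
      using C D by (intro ring_measure_Diff) auto
    then show "\<exists>C\<in>block_ring e. \<exists>D\<in>block_ring e. C \<subseteq> A \<and> A \<subseteq> D \<and> ring_measure e (D - C) < \<epsilon>"
      using C D eq by (intro bexI[of _ C] bexI[of _ D]) auto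
  qed
next
  assume H: "\<forall>\<epsilon>>0. \<exists>C\<in>block_ring e. \<exists>D\<in>block_ring e. C \<subseteq> A \<and> A \<subseteq> D \<and> ring_measure e (D - C) < \<epsilon>"
  from H[rule_format, of 1] obtain B where B: "B \<in> block_ring e" "A \<subseteq> B" by auto
  have "inner_lam e A \<le> outer_lam e A"
    by (rule inner_lam_least, rule outer_lam_greatest[OF B]) (auto intro: ring_measure_mono)
  moreover have "outer_lam e A \<le> inner_lam e A"
  proof (rule field_le_epsilon)
    fix \<epsilon> :: real assume "\<epsilon> > 0"
    from H[rule_format, OF this] obtain C D where CD: "C \<in> block_ring e" "D \<in> block_ring e" "C \<subseteq> A" "A \<subseteq> D"
      "ring_measure e (D - C) < \<epsilon>" by blast
    have "ring_measure e (D - C) = ring_measure e D - ring_measure e C"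
      using CD by (intro ring_measure_Diff) auto
    then show "outer_lam e A \<le> inner_lam e A + \<epsilon>"
      using outer_lam_le[OF CD(2,4)] inner_lam_ge[OF CD(2,4) CD(1,3)] CD(5) by linarith
  qed
  ultimately show "A \<in> completed_ring e" using B by (auto simp: completed_ring_def)
qed

lemma completed_ringE:
  assumes "A \<in> completed_ring e" "\<epsilon> > 0"
  obtains C D where "C \<in> block_ring e" "D \<in> block_ring e" "C \<subseteq> A" "A \<subseteq> D" "ring_measure e (D - C) < \<epsilon>"
proof -
  have "\<exists>C\<in>block_ring e. \<exists>D\<in>block_ring e. C \<subseteq> A \<and> A \<subseteq> D \<and> ring_measure e (D - C) < \<epsilon>"
    using assms(1)[unfolded completed_ring_iff] assms(2) by simp
  then show thesis by (elim bexE conjE) (rule that)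
qed

text \<open>Common core of closure under union and difference: the new gap is covered by the two old
  ones, each of measure below half of the tolerance.\<close>

lemma completed_ringI2:
  assumes A: "A1 \<in> completed_ring e" "A2 \<in> completed_ring e"
    and ex: "\<And>C1 D1 C2 D2. C1 \<in> block_ring e \<Longrightarrow> D1 \<in> block_ring e \<Longrightarrow> C2 \<in> block_ring e \<Longrightarrow> D2 \<in> block_ring e \<Longrightarrow>
      C1 \<subseteq> A1 \<Longrightarrow> A1 \<subseteq> D1 \<Longrightarrow> C2 \<subseteq> A2 \<Longrightarrow> A2 \<subseteq> D2 \<Longrightarrow>
      \<exists>C\<in>block_ring e. \<exists>D\<in>block_ring e. C \<subseteq> A \<and> A \<subseteq> D \<and> D - C \<subseteq> (D1 - C1) \<union> (D2 - C2)"
  shows "A \<in> completed_ring e"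
  unfolding completed_ring_iff
proof (intro allI impI)
  fix \<epsilon> :: real assume "\<epsilon> > 0"
  then have \<epsilon>: "\<epsilon> / 2 > 0" by simp
  obtain C1 D1 where 1: "C1 \<in> block_ring e" "D1 \<in> block_ring e" "C1 \<subseteq> A1" "A1 \<subseteq> D1" "ring_measure e (D1 - C1) < \<epsilon> / 2"
    using completed_ringE[OF A(1) \<epsilon>] .
  obtain C2 D2 where 2: "C2 \<in> block_ring e" "D2 \<in> block_ring e" "C2 \<subseteq> A2" "A2 \<subseteq> D2" "ring_measure e (D2 - C2) < \<epsilon> / 2"
    using completed_ringE[OF A(2) \<epsilon>] .
  obtain C D where CD: "C \<in> block_ring e" "D \<in> block_ring e" "C \<subseteq> A" "A \<subseteq> D" "D - C \<subseteq> (D1 - C1) \<union> (D2 - C2)"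
    using ex[OF 1(1,2) 2(1,2) 1(3,4) 2(3,4)] by blast
  have "ring_measure e (D - C) \<le> ring_measure e ((D1 - C1) \<union> (D2 - C2))"
    using CD 1 2 by (intro ring_measure_mono) auto
  also have "\<dots> \<le> ring_measure e (D1 - C1) + ring_measure e (D2 - C2)"
    using 1 2 by (intro ring_measure_subadd) auto
  also have "\<dots> < \<epsilon>" using 1(5) 2(5) by simp
  finally show "\<exists>C\<in>block_ring e. \<exists>D\<in>block_ring e. C \<subseteq> A \<and> A \<subseteq> D \<and> ring_measure e (D - C) < \<epsilon>"
    using CD by blast
qed

lemma block_ring_completed: "A \<in> block_ring e \<Longrightarrow> A \<in> completed_ring e"
  unfolding completed_ring_iff
  using br.additive_empty[OF ring_measure_additive] by (auto intro!: bexI[of _ A])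

lemma ring_completed: "ring_of_sets UNIV (completed_ring e)"
proof (rule ring_of_setsI)
  fix A1 A2 assume A: "A1 \<in> completed_ring e" "A2 \<in> completed_ring e"
  show "A1 \<union> A2 \<in> completed_ring e"
  proof (rule completed_ringI2[OF A])
    fix C1 D1 C2 D2
    assume "C1 \<in> block_ring e" "D1 \<in> block_ring e" "C2 \<in> block_ring e" "D2 \<in> block_ring e"
      "C1 \<subseteq> A1" "A1 \<subseteq> D1" "C2 \<subseteq> A2" "A2 \<subseteq> D2"
    then show "\<exists>C\<in>block_ring e. \<exists>D\<in>block_ring e. C \<subseteq> A1 \<union> A2 \<and> A1 \<union> A2 \<subseteq> D \<and> D - C \<subseteq> (D1 - C1) \<union> (D2 - C2)"
      by (intro bexI[of _ "C1 \<union> C2"] bexI[of _ "D1 \<union> D2"]) auto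
  qed
  show "A1 - A2 \<in> completed_ring e"
  proof (rule completed_ringI2[OF A])
    fix C1 D1 C2 D2
    assume "C1 \<in> block_ring e" "D1 \<in> block_ring e" "C2 \<in> block_ring e" "D2 \<in> block_ring e"
      "C1 \<subseteq> A1" "A1 \<subseteq> D1" "C2 \<subseteq> A2" "A2 \<subseteq> D2"
    then show "\<exists>C\<in>block_ring e. \<exists>D\<in>block_ring e. C \<subseteq> A1 - A2 \<and> A1 - A2 \<subseteq> D \<and> D - C \<subseteq> (D1 - C1) \<union> (D2 - C2)"
      \<comment> \<open>Subtraction reverses the roles: the inner set removes the outer
        approximation of \<open>A2\<close>, the outer set removes the inner one.\<close>
      by (intro bexI[of _ "C1 - D2"] bexI[of _ "D1 - C2"]) auto
  qed
qed (auto intro: block_ring_completed)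

sublocale cr: ring_of_sets UNIV "completed_ring e"
  by (rule ring_completed)

lemma lam_block_ring: "A \<in> block_ring e \<Longrightarrow> lam e A = ring_measure e A"
  unfolding lam_def
  by (rule antisym[OF outer_lam_le outer_lam_greatest[of A]]) (simp_all add: ring_measure_mono)

lemma lam_nonneg: "A \<in> completed_ring e \<Longrightarrow> 0 \<le> lam e A"
  unfolding lam_def completed_ring_def
  using outer_lam_greatest[OF _ _ ring_measure_nonneg] by auto

text \<open>Translation carries covers to covers of the same measure; the same inclusion for the
  opposite translation gives equality of the two sets of values.\<close>

lemma outer_lam_shift: "outer_lam e ((+) h ` A) = outer_lam e A"
proof -
  have sub: "{ring_measure e B |B. B \<in> block_ring e \<and> A \<subseteq> B} \<subseteq>
      {ring_measure e B |B. B \<in> block_ring e \<and> (+) h ` A \<subseteq> B}" for h A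
  proof safe
    fix B assume "B \<in> block_ring e" "A \<subseteq> B"
    then show "\<exists>B'. ring_measure e B = ring_measure e B' \<and> B' \<in> block_ring e \<and> (+) h ` A \<subseteq> B'"
      using ring_measure_shift[of B h] block_ring_shift[of B h] by (intro exI[of _ "(+) h ` B"]) auto
  qed
  have "(+) (- h) ` (+) h ` A = A" by (simp add: image_image)
  then show ?thesis
    unfolding outer_lam_def using sub[of A h] sub[of "(+) h ` A" "- h"]
    by (intro arg_cong[where f = Inf] subset_antisym) (simp_all only:)
qed

lemma completed_ring_shift: "A \<in> completed_ring e \<Longrightarrow> (+) h ` A \<in> completed_ring e"
  unfolding completed_ring_iff[of "(+) h ` A"]
proof (intro allI impI)
  fix \<epsilon> :: real assume A: "A \<in> completed_ring e" and "\<epsilon> > 0"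
  from completed_ringE[OF this] obtain C D where CD: "C \<in> block_ring e" "D \<in> block_ring e"
    "C \<subseteq> A" "A \<subseteq> D" "ring_measure e (D - C) < \<epsilon>" .
  have "ring_measure e ((+) h ` D - (+) h ` C) = ring_measure e (D - C)"
    unfolding shift_Diff[symmetric] using CD by (intro ring_measure_shift) auto
  then show "\<exists>C\<in>block_ring e. \<exists>D\<in>block_ring e. C \<subseteq> (+) h ` A \<and> (+) h ` A \<subseteq> D \<and> ring_measure e (D - C) < \<epsilon>"
    using CD block_ring_shift[of C h] block_ring_shift[of D h]
    by (intro bexI[of _ "(+) h ` C"] bexI[of _ "(+) h ` D"]) auto
qed

lemma lam_shift: "lam e ((+) h ` A) = lam e A"
  by (simp add: lam_def outer_lam_shift)

lemma completed_ring_inner_approx: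
  assumes "A \<in> completed_ring e" "\<epsilon> > 0"
  obtains C where "C \<in> block_ring e" "C \<subseteq> A" "lam e (A - C) < \<epsilon>"
proof -
  obtain C D where CD: "C \<in> block_ring e" "D \<in> block_ring e" "C \<subseteq> A" "A \<subseteq> D" "ring_measure e (D - C) < \<epsilon>"
    using completed_ringE[OF assms] .
  have "lam e (A - C) \<le> ring_measure e (D - C)"
    unfolding lam_def using CD by (intro outer_lam_le) auto
  then show thesis using that CD by auto
qed

text \<open>Cutting the factors off at 0 covers disjoint blocks too, where one factor vanishes. The
  resulting formula holds for every translate without case distinction, which both the measurability
  in \<open>h\<close> and the overlap estimate rely on.\<close>

lemma lam_block_Int_LIMSEQ:
  assumes ab: "abs_measurable e a b" "block e a b \<noteq> {}" and cd: "abs_measurable e c d" "block e c d \<noteq> {}"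
  shows "(\<lambda>n. \<Prod>j<n. max 0 (min (b j) (d j) - max (a j) (c j))) \<longlonglongrightarrow> lam e (block e a b \<inter> block e c d)"
proof (cases "block e a b \<inter> block e c d = {}")
  case True
  then obtain j where "min (b j) (d j) \<le> max (a j) (c j)" using block_Int_empty_iff[OF ab(2) cd(2)] by blast
  \<comment> \<open>The product runs below \<open>n\<close>, so the vanishing factor is included
    from \<open>Suc j\<close> on.\<close>
  then have "(\<Prod>j<n. max 0 (min (b j) (d j) - max (a j) (c j))) = 0" if "n \<ge> Suc j" for n
    using that by (intro prod_zero) (auto intro!: bexI[of _ j] simp: max_def)
  then have "eventually (\<lambda>n. (\<Prod>j<n. max 0 (min (b j) (d j) - max (a j) (c j))) = 0) sequentially"
    unfolding eventually_sequentially by blast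
  moreover have "lam e {} = 0"
    using lam_block_ring[OF br.empty_sets] br.additive_empty[OF ring_measure_additive] by simp
  ultimately show ?thesis using True by (simp add: tendsto_eventually)
next
  case False
  have m: "abs_measurable e (\<lambda>j. max (a j) (c j)) (\<lambda>j. min (b j) (d j))"
    by (rule block_Int_cases[OF ab(1) cd(1) False])
  have ne: "block e (\<lambda>j. max (a j) (c j)) (\<lambda>j. min (b j) (d j)) \<noteq> {}" using False by (simp add: block_Int)
  have eq: "max 0 (min (b j) (d j) - max (a j) (c j)) = min (b j) (d j) - max (a j) (c j)" for j
  proof -
    have "max (a j) (c j) < min (b j) (d j)" using m unfolding abs_measurable_def block_bounds_def by blast
    then show ?thesis by simp
  qed
  have "lam e (block e a b \<inter> block e c d) = block_volume e (\<lambda>j. max (a j) (c j)) (\<lambda>j. min (b j) (d j))"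
    unfolding block_Int using m by (simp add: lam_block_ring block_in_block_ring ring_measure_block)
  then show ?thesis unfolding eq using block_volume_LIMSEQ[OF m ne] by simp
qed

end

section \<open>The Hilbert space of the measure and its shifts\<close>

locale shift_space = onb e for e :: "nat \<Rightarrow> 'a::{real_inner,complete_space}" +
  fixes \<iota> :: "('a \<Rightarrow> complex) \<Rightarrow> 'h::complex_hilbert"
  assumes HE: "is_HE e \<iota>"
begin

lemma sum_in_step_functions:
  assumes "finite I" "\<And>i. i \<in> I \<Longrightarrow> A i \<in> completed_ring e"
  shows "(\<lambda>x. \<Sum>i\<in>I. c i * indicator (A i) x) \<in> step_functions e"
proof -
  have "\<exists>(n::nat) c' B. (\<forall>k<n. B k \<in> completed_ring e) \<and> disjoint_family_on B {..<n} \<and>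
    (\<forall>x. (\<Sum>i\<in>I. c i * indicator (A i) x) = (\<Sum>k<n. c' k * indicator (B k) x))"
    by (rule cr.disjointify_sum[OF assms])
  then obtain n :: nat and c' B where B: "\<forall>k<n. B k \<in> completed_ring e" "disjoint_family_on B {..<n}"
    and eq: "\<forall>x. (\<Sum>i\<in>I. c i * indicator (A i) x) = (\<Sum>k<n. c' k * indicator (B k) x)" by (elim exE conjE)
  have "(\<lambda>x. \<Sum>i\<in>I. c i * indicator (A i) x) = step_fun n c' B"
    unfolding step_fun_def using eq by (intro ext) (rule spec)
  moreover have "step_data e n B" using B by (simp add: step_data_def)
  ultimately show ?thesis unfolding step_functions_def by blast
qed

lemma step_functionsE:
  assumes "f \<in> step_functions e"
  obtains n c B where "f = step_fun n c B" "step_data e n B"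
  using assms unfolding step_functions_def by auto

lemma step_add:
  assumes "f \<in> step_functions e" "g \<in> step_functions e"
  shows "(\<lambda>x. f x + g x) \<in> step_functions e"
proof -
  from assms(1) obtain n c B where f: "f = step_fun n c B" "step_data e n B" by (rule step_functionsE)
  from assms(2) obtain n' c' B' where g: "g = step_fun n' c' B'" "step_data e n' B'" by (rule step_functionsE)
  \<comment> \<open>The two families together form one overlapping family, indexed by the disjoint
    sum of the index sets.\<close>
  have "(\<lambda>x. \<Sum>i\<in>{..<n} <+> {..<n'}. (case i of Inl k \<Rightarrow> c k | Inr k \<Rightarrow> c' k) *
      indicator (case i of Inl k \<Rightarrow> B k | Inr k \<Rightarrow> B' k) x) \<in> step_functions e"
    using f g by (intro sum_in_step_functions) (auto simp: step_data_def)
  also have "(\<lambda>x. \<Sum>i\<in>{..<n} <+> {..<n'}. (case i of Inl k \<Rightarrow> c k | Inr k \<Rightarrow> c' k) *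
      indicator (case i of Inl k \<Rightarrow> B k | Inr k \<Rightarrow> B' k) x) = (\<lambda>x. f x + g x)"
    unfolding f g step_fun_def by (subst sum.Plus) (simp_all only: finite_lessThan sum.case o_def)
  finally show ?thesis .
qed

lemma step_scale:
  assumes "f \<in> step_functions e"
  shows "(\<lambda>x. c * f x) \<in> step_functions e"
proof -
  from assms obtain n d B where f: "f = step_fun n d B" "step_data e n B" by (rule step_functionsE)
  have "(\<lambda>x. c * f x) = step_fun n (\<lambda>k. c * d k) B"
    unfolding f step_fun_def sum_distrib_left mult.assoc ..
  then show ?thesis using f unfolding step_functions_def by auto
qed

lemma step_indicator:
  assumes "A \<in> completed_ring e"
  shows "indicator A \<in> step_functions e"
  using sum_in_step_functions[of "{0::nat}" "\<lambda>_. A" "\<lambda>_. 1"] assms by simp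

lemma step_zero: "(\<lambda>x. 0) \<in> step_functions e"
  using sum_in_step_functions[of "{}::nat set" "\<lambda>_. {}" "\<lambda>_. 1"] by simp

lemma \<iota>_add: "f \<in> step_functions e \<Longrightarrow> g \<in> step_functions e \<Longrightarrow> \<iota> (\<lambda>x. f x + g x) = \<iota> f + \<iota> g"
  and \<iota>_scale: "f \<in> step_functions e \<Longrightarrow> \<iota> (\<lambda>x. c * f x) = c *\<^sub>C \<iota> f"
  and norm_\<iota>: "step_data e n B \<Longrightarrow> norm (\<iota> (step_fun n d B)) = sqrt (\<Sum>k<n. (cmod (d k))\<^sup>2 * lam e (B k))"
  and closure_\<iota>: "closure (\<iota> ` step_functions e) = UNIV"
  using HE by (auto simp: is_HE_def)

lemma \<iota>_diff:
  assumes "f \<in> step_functions e" "g \<in> step_functions e"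
  shows "\<iota> (\<lambda>x. f x - g x) = \<iota> f - \<iota> g"
  using \<iota>_add[OF assms(1) step_scale[OF assms(2), of "-1"]] \<iota>_scale[OF assms(2), of "-1"]
  by (simp add: scaleC_minus_one)

lemma step_diff:
  assumes "f \<in> step_functions e" "g \<in> step_functions e"
  shows "(\<lambda>x. f x - g x) \<in> step_functions e"
  using step_add[OF assms(1) step_scale[OF assms(2), of "-1"]] by simp

lemma \<iota>_zero: "\<iota> (\<lambda>x. 0) = 0"
  using \<iota>_scale[OF step_zero, of 0] by simp

abbreviation \<kappa> :: "'a set \<Rightarrow> 'h" where "\<kappa> A \<equiv> \<iota> (indicator A)"

lemma norm_\<kappa>_sq:
  assumes "A \<in> completed_ring e"
  shows "(norm (\<kappa> A))\<^sup>2 = lam e A"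
proof -
  have "step_data e 1 (\<lambda>_. A)" using assms by (simp add: step_data_def disjoint_family_on_def)
  from norm_\<iota>[OF this, of "\<lambda>_. 1"] show ?thesis using lam_nonneg[OF assms] by (simp add: step_fun_def)
qed

text \<open>The norm formula for step functions is Pythagoras for \<open>\<kappa> A\<close> and any
  complex multiple of \<open>\<kappa> B\<close>; the multiples by 1 and \<open>\<i>\<close> give
  both parts of the scalar product.\<close>

lemma cinner_\<kappa>_disjoint:
  assumes AB: "A \<in> completed_ring e" "B \<in> completed_ring e" "A \<inter> B = {}"
  shows "cinner (\<kappa> A) (\<kappa> B) = 0"
proof -
  have Re0: "Re (cinner (\<kappa> A) (c *\<^sub>C \<kappa> B)) = 0" for c
  proof -
    let ?B = "\<lambda>k::nat. if k = 0 then A else B" and ?c = "\<lambda>k::nat. if k = 0 then 1 else c"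
    have sd: "step_data e 2 ?B"
      using AB by (auto simp: step_data_def disjoint_family_on_def)
    have "step_fun 2 ?c ?B = (\<lambda>x. indicator A x + c * indicator B x)"
      by (auto simp: step_fun_def numeral_2_eq_2)
    moreover have "\<iota> (\<lambda>x. indicator A x + c * indicator B x) = \<kappa> A + c *\<^sub>C \<kappa> B"
      using \<iota>_add[OF step_indicator[OF AB(1)] step_scale[OF step_indicator[OF AB(2)]]]
        \<iota>_scale[OF step_indicator[OF AB(2)]] by simp
    ultimately have "norm (\<kappa> A + c *\<^sub>C \<kappa> B) = sqrt (lam e A + (cmod c)\<^sup>2 * lam e B)"
      using norm_\<iota>[OF sd, of ?c] by (simp add: numeral_2_eq_2)
    then have "(norm (\<kappa> A + c *\<^sub>C \<kappa> B))\<^sup>2 = (norm (\<kappa> A))\<^sup>2 + (norm (c *\<^sub>C \<kappa> B))\<^sup>2"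
      using lam_nonneg[OF AB(1)] lam_nonneg[OF AB(2)]
      by (simp add: norm_\<kappa>_sq AB norm_scaleC power_mult_distrib)
    then show ?thesis unfolding norm_add_sq by simp
  qed
  show ?thesis using Re0[of 1] Re0[of \<i>] by (subst cinner_eq_Re) (simp add: complex_eq_iff)
qed

lemma \<kappa>_diff:
  assumes "A \<in> completed_ring e" "B \<in> completed_ring e" "B \<subseteq> A"
  shows "\<kappa> A - \<kappa> B = \<kappa> (A - B)"
proof -
  have "(\<lambda>x. indicator A x - indicator B x :: complex) = indicator (A - B)"
    using assms(3) by (intro ext) (auto simp: indicator_def)
  then show ?thesis using \<iota>_diff[OF step_indicator step_indicator, OF assms(1,2)] by simp
qed

text \<open>Splitting both sets along their intersection leaves only the common part, the other
  three pairs being disjoint.\<close>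

lemma cinner_\<kappa>:
  assumes "A \<in> completed_ring e" "B \<in> completed_ring e"
  shows "cinner (\<kappa> A) (\<kappa> B) = of_real (lam e (A \<inter> B))"
proof -
  have AB: "A \<inter> B \<in> completed_ring e" "A - B \<in> completed_ring e" "B - A \<in> completed_ring e"
    using assms by auto
  have eq: "\<kappa> A = \<kappa> (A - B) + \<kappa> (A \<inter> B)" "\<kappa> B = \<kappa> (B - A) + \<kappa> (A \<inter> B)"
    using \<kappa>_diff[OF assms(1) AB(1)] \<kappa>_diff[OF assms(2) AB(1)]
    by (simp_all add: algebra_simps Diff_Int Int_absorb1)
  have z: "cinner (\<kappa> (A - B)) (\<kappa> (B - A)) = 0" "cinner (\<kappa> (A - B)) (\<kappa> (A \<inter> B)) = 0"
    "cinner (\<kappa> (A \<inter> B)) (\<kappa> (B - A)) = 0"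
    using AB by (intro cinner_\<kappa>_disjoint; blast)+
  have "cinner (\<kappa> A) (\<kappa> B) = cinner (\<kappa> (A - B) + \<kappa> (A \<inter> B)) (\<kappa> (B - A) + \<kappa> (A \<inter> B))"
    by (simp only: eq[symmetric])
  also have "\<dots> = cinner (\<kappa> (A \<inter> B)) (\<kappa> (A \<inter> B))"
    by (simp add: cinner_add_left cinner_add_right z)
  finally have "cinner (\<kappa> A) (\<kappa> B) = cinner (\<kappa> (A \<inter> B)) (\<kappa> (A \<inter> B))" .
  then show ?thesis by (simp add: cinner_self norm_\<kappa>_sq AB)
qed

lemma dense_induct:
  assumes "closed {f. P f}" "\<And>f. f \<in> step_functions e \<Longrightarrow> P (\<iota> f)"
  shows "P y"
proof -
  have "closure (\<iota> ` step_functions e) \<subseteq> {f. P f}"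
    using assms by (intro closure_minimal) auto
  then show ?thesis using closure_\<iota> by auto
qed

text \<open>Linear combinations of blocks give the ring, and inner approximation gives the completed
  ring, because the squared norm of \<open>\<kappa> A - \<kappa> C\<close> is the measure of
  \<open>A - C\<close>. Step functions are dense. Later facts about the shifts are thereby checked
  on blocks only.\<close>

lemma block_induct [consumes 0, case_names closed zero add scale block]:
  assumes cl: "closed {f. P f}" and zero: "P 0"
    and add: "\<And>f g. P f \<Longrightarrow> P g \<Longrightarrow> P (f + g)" and scale: "\<And>c f. P f \<Longrightarrow> P (c *\<^sub>C f)"
    and block: "\<And>a b. abs_measurable e a b \<Longrightarrow> P (\<kappa> (block e a b))"
  shows "P f"
proof -
  have comb: "valid_comb xs \<Longrightarrow> (\<lambda>x. of_real (comb xs x)) \<in> step_functions e \<and> P (\<iota> (\<lambda>x. of_real (comb xs x)))" for xs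
  proof (induction xs)
    case Nil
    then show ?case using zero step_zero by (simp add: \<iota>_zero)
  next
    case (Cons y xs)
    obtain c a b where y: "y = (c, a, b)" by (cases y)
    have ab: "abs_measurable e a b" and v: "valid_comb xs" using Cons.prems by (auto simp: y)
    have s: "indicator (block e a b) \<in> step_functions e"
      using ab by (intro step_indicator block_ring_completed block_in_block_ring)
    have "(\<lambda>x. complex_of_real (comb (y # xs) x)) = (\<lambda>x. of_real c * indicator (block e a b) x + of_real (comb xs x))"
      by (auto simp: y indicator_def)
    moreover have "\<iota> (\<lambda>x. of_real c * indicator (block e a b) x + of_real (comb xs x)) =
        of_real c *\<^sub>C \<kappa> (block e a b) + \<iota> (\<lambda>x. of_real (comb xs x))"
      using \<iota>_add[OF step_scale[OF s]] Cons.IH[OF v] \<iota>_scale[OF s] by simp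
    ultimately show ?case
      using step_add[OF step_scale[OF s]] Cons.IH[OF v] add scale block[OF ab] by simp
  qed
  have ring: "P (\<kappa> A)" if "A \<in> block_ring e" for A
  proof -
    obtain xs where xs: "represents xs A" using block_ring_represented[OF \<open>A \<in> block_ring e\<close>] by blast
    have "(\<lambda>x. complex_of_real (comb xs x)) = indicator A"
      using xs by (auto simp: represents_def indicator_def)
    then show ?thesis using comb[of xs] xs by (simp add: represents_def)
  qed
  have completed: "P (\<kappa> A)" if A: "A \<in> completed_ring e" for A
  proof -
    have "\<exists>C. C \<in> block_ring e \<and> C \<subseteq> A \<and> lam e (A - C) < inverse (real (Suc n))" for n
    proof -
      have "inverse (real (Suc n)) > 0" by simp
      from completed_ring_inner_approx[OF A this] show ?thesis by blast
    qed
    then obtain C where C: "\<And>n. C n \<in> block_ring e" "\<And>n. C n \<subseteq> A"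
      "\<And>n. lam e (A - C n) < inverse (real (Suc n))" by metis
    have AC: "A - C n \<in> completed_ring e" for n using A C(1) block_ring_completed by auto
    have "(\<lambda>n. \<kappa> A - \<kappa> (C n)) \<longlonglongrightarrow> 0"
    proof (rule Lim_null_comparison)
      show "(\<lambda>n. sqrt (inverse (real (Suc n)))) \<longlonglongrightarrow> 0"
        using tendsto_real_sqrt[OF LIMSEQ_inverse_real_of_nat] by simp
      have "(norm (\<kappa> A - \<kappa> (C n)))\<^sup>2 \<le> inverse (real (Suc n))" for n
        using C(3)[of n] A C(1,2) AC by (simp add: \<kappa>_diff block_ring_completed norm_\<kappa>_sq less_imp_le)
      then show "\<forall>\<^sub>F n in sequentially. norm (\<kappa> A - \<kappa> (C n)) \<le> sqrt (inverse (real (Suc n)))"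
        by (intro always_eventually allI real_le_rsqrt)
    qed
    then have lim: "(\<lambda>n. \<kappa> (C n)) \<longlonglongrightarrow> \<kappa> A"
      using tendsto_diff[of "\<lambda>n. \<kappa> A" "\<kappa> A" sequentially "\<lambda>n. \<kappa> A - \<kappa> (C n)" 0] by simp
    have "\<kappa> (C n) \<in> {f. P f}" for n by (simp add: ring C(1))
    from closed_sequentially[OF cl this lim] show ?thesis by simp
  qed
  show ?thesis
  proof (rule dense_induct[OF cl])
    fix f assume "f \<in> step_functions e"
    then obtain n c B where f: "f = step_fun n c B" "step_data e n B" by (rule step_functionsE)
    have B: "B k \<in> completed_ring e" if "k < n" for k using f(2) that by (simp add: step_data_def)
    \<comment> \<open>Induction over initial segments, since the sets \<open>B k\<close> are
      controlled only for \<open>k < n\<close>.\<close>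
    have "m \<le> n \<Longrightarrow> P (\<iota> (step_fun m c B))" for m
    proof (induction m)
      case 0
      then show ?case using zero by (simp add: step_fun_def \<iota>_zero)
    next
      case (Suc m)
      then have Bm: "B m \<in> completed_ring e" using B by simp
      have "step_fun m c B \<in> step_functions e"
        unfolding step_fun_def using Suc.prems B by (intro sum_in_step_functions) auto
      from \<iota>_add[OF this step_scale[OF step_indicator[OF Bm]], of "c m"]
      have "\<iota> (step_fun (Suc m) c B) = \<iota> (step_fun m c B) + c m *\<^sub>C \<kappa> (B m)"
        using \<iota>_scale[OF step_indicator[OF Bm], of "c m"] by (simp add: step_fun_def)
      then show ?case using Suc add scale completed[OF Bm] by simp
    qed
    then show "P (\<iota> f)" unfolding f(1) by simp
  qed
qed

end

section \<open>The unitary shift operators and their measurability\<close>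

context shift_space
begin

lemma step_shift:
  assumes "f \<in> step_functions e"
  shows "(\<lambda>x. f (x - h)) \<in> step_functions e" and "norm (\<iota> (\<lambda>x. f (x - h))) = norm (\<iota> f)"
proof -
  from assms obtain n c B where f: "f = step_fun n c B" "step_data e n B" by (rule step_functionsE)
  have eq: "(\<lambda>x. f (x - h)) = step_fun n c (\<lambda>k. (+) h ` B k)"
    unfolding f step_fun_def indicator_shift ..
  have "B i \<inter> B j = {} \<Longrightarrow> (+) h ` B i \<inter> (+) h ` B j = {}" for i j by auto
  then have sd: "step_data e n (\<lambda>k. (+) h ` B k)"
    using f(2) unfolding step_data_def disjoint_family_on_def by (simp add: completed_ring_shift)
  show "(\<lambda>x. f (x - h)) \<in> step_functions e" unfolding eq step_functions_def using sd by blast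
  show "norm (\<iota> (\<lambda>x. f (x - h))) = norm (\<iota> f)"
    unfolding eq unfolding f(1) norm_\<iota>[OF sd] norm_\<iota>[OF f(2)] by (simp add: lam_shift)
qed

text \<open>The shift preserves norms of differences of step functions. Hence it is well defined
  modulo the null space, and as an isometry on a dense set it extends to the completion.\<close>

lemma shift_exists:
  "\<exists>T. bounded_clinear T \<and> (\<forall>f\<in>step_functions e. T (\<iota> f) = \<iota> (\<lambda>x. f (x - h))) \<and> (\<forall>y. norm (T y) = norm y)"
proof -
  let ?X = "\<iota> ` step_functions e"
  \<comment> \<open>The map \<open>\<iota>\<close> may identify step functions, so a representative
    is chosen; \<open>dist_shift\<close> shows that the choice does not affect the value.\<close>
  define T0 where "T0 y = \<iota> (\<lambda>x. (SOME f. f \<in> step_functions e \<and> \<iota> f = y) (x - h))" for y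
  have dist_shift: "norm (\<iota> (\<lambda>x. f (x - h)) - \<iota> (\<lambda>x. g (x - h))) = norm (\<iota> f - \<iota> g)"
    if "f \<in> step_functions e" "g \<in> step_functions e" for f g
    using step_shift(2)[OF step_diff[OF that], of h]
    unfolding \<iota>_diff[OF that] \<iota>_diff[OF step_shift(1)[OF that(1)] step_shift(1)[OF that(2)]] .
  have T0: "T0 (\<iota> f) = \<iota> (\<lambda>x. f (x - h))" if f: "f \<in> step_functions e" for f
  proof -
    have "\<exists>g. g \<in> step_functions e \<and> \<iota> g = \<iota> f" using f by blast
    from someI_ex[OF this] show ?thesis
      unfolding T0_def using dist_shift[OF _ f, of "SOME g. g \<in> step_functions e \<and> \<iota> g = \<iota> f"] by simp
  qed
  have iso: "dist (T0 y) (T0 z) = dist y z" if "y \<in> ?X" "z \<in> ?X" for y z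
    using that dist_shift by (auto simp: dist_norm T0)
  have "uniformly_continuous_on ?X T0"
    unfolding uniformly_continuous_on_def
  proof (intro allI impI)
    fix r :: real assume "r > 0"
    then show "\<exists>d>0. \<forall>x\<in>?X. \<forall>x'\<in>?X. dist x' x < d \<longrightarrow> dist (T0 x') (T0 x) < r"
      using iso by (intro exI[of _ r]) simp
  qed
  then obtain T where uc: "uniformly_continuous_on (closure ?X) T" and T: "\<And>y. y \<in> ?X \<Longrightarrow> T0 y = T y"
    by (rule uniformly_continuous_on_extension_on_closure) blast
  have cont: "continuous_on UNIV T"
    using uniformly_continuous_imp_continuous[OF uc] closure_\<iota> by simp
  note cont_T = continuous_on_compose2[OF cont]
  have T\<iota>: "T (\<iota> f) = \<iota> (\<lambda>x. f (x - h))" if "f \<in> step_functions e" for f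
    using T[of "\<iota> f"] T0[OF that] that by simp
  have norm_T: "norm (T y) = norm y" for y
  proof (rule dense_induct[where P = "\<lambda>y. norm (T y) = norm y"])
    show "closed {y. norm (T y) = norm y}" by (intro closed_Collect_eq continuous_intros cont)
  qed (simp add: T\<iota> step_shift)
  \<comment> \<open>Additivity is extended one argument at a time, with the second argument first
    kept in the dense set.\<close>
  have add\<iota>: "T (y + \<iota> g) = T y + T (\<iota> g)" if g: "g \<in> step_functions e" for y g
  proof (rule dense_induct[where P = "\<lambda>y. T (y + \<iota> g) = T y + T (\<iota> g)"])
    show "closed {y. T (y + \<iota> g) = T y + T (\<iota> g)}"
      by (intro closed_Collect_eq continuous_intros cont cont_T) auto
    fix f assume f: "f \<in> step_functions e"
    show "T (\<iota> f + \<iota> g) = T (\<iota> f) + T (\<iota> g)"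
      using T\<iota>[OF step_add[OF f g]] T\<iota>[OF f] T\<iota>[OF g] \<iota>_add[OF f g]
        \<iota>_add[OF step_shift(1)[OF f, of h] step_shift(1)[OF g, of h]] by simp
  qed
  have add: "T (y + z) = T y + T z" for y z
  proof (rule dense_induct[where P = "\<lambda>z. T (y + z) = T y + T z"])
    show "closed {z. T (y + z) = T y + T z}"
      by (intro closed_Collect_eq continuous_intros cont cont_T) auto
  qed (rule add\<iota>)
  have scale: "T (c *\<^sub>C y) = c *\<^sub>C T y" for c y
  proof (rule dense_induct[where P = "\<lambda>y. T (c *\<^sub>C y) = c *\<^sub>C T y"])
    have c: "continuous_on UNIV (\<lambda>y::'h. c *\<^sub>C y)"
      by (rule linear_continuous_on[OF bounded_linear_scaleC])
    show "closed {y. T (c *\<^sub>C y) = c *\<^sub>C T y}"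
      by (intro closed_Collect_eq cont_T[OF c] continuous_on_compose2[OF c cont]) auto
    fix f assume f: "f \<in> step_functions e"
    show "T (c *\<^sub>C \<iota> f) = c *\<^sub>C T (\<iota> f)"
      using T\<iota>[OF step_scale[OF f, of c]] T\<iota>[OF f] \<iota>_scale[OF f] \<iota>_scale[OF step_shift(1)[OF f, of h], of c]
      by simp
  qed
  have "bounded_linear T"
    by (rule bounded_linear_intro[where K = 1]) (simp_all add: add scaleR_scaleC scale norm_T)
  then show ?thesis using T\<iota> norm_T scale by (auto simp: bounded_clinear_def)
qed

lemma shift_unique:
  assumes "bounded_clinear T" "\<forall>f\<in>step_functions e. T (\<iota> f) = \<iota> (\<lambda>x. f (x - h))"
    and "bounded_clinear T'" "\<forall>f\<in>step_functions e. T' (\<iota> f) = \<iota> (\<lambda>x. f (x - h))"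
  shows "T = T'"
proof
  fix y
  show "T y = T' y"
  proof (rule dense_induct[where P = "\<lambda>y. T y = T' y"])
    show "closed {y. T y = T' y}"
      using assms(1,3) by (intro closed_Collect_eq linear_continuous_on) (auto simp: bounded_clinear_def)
  qed (use assms(2,4) in simp)
qed

abbreviation S :: "'a \<Rightarrow> 'h \<Rightarrow> 'h" where "S \<equiv> shift_op e \<iota>"

lemma S_props:
  "bounded_clinear (S h) \<and> (\<forall>f\<in>step_functions e. S h (\<iota> f) = \<iota> (\<lambda>x. f (x - h))) \<and> (\<forall>y. norm (S h y) = norm y)"
proof -
  obtain T where T: "bounded_clinear T" "\<forall>f\<in>step_functions e. T (\<iota> f) = \<iota> (\<lambda>x. f (x - h))"
    "\<forall>y. norm (T y) = norm y"
    using shift_exists[of h] by blast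
  have "S h = T"
    unfolding shift_op_def using T shift_unique by (intro the_equality) auto
  then show ?thesis using T by simp
qed

lemma bounded_clinear_S: "bounded_clinear (S h)"
  and S_\<iota>: "f \<in> step_functions e \<Longrightarrow> S h (\<iota> f) = \<iota> (\<lambda>x. f (x - h))"
  and norm_S [simp]: "norm (S h y) = norm y"
  using S_props[of h] by blast+

lemma bounded_linear_S: "bounded_linear (S h)"
  and S_scale: "S h (c *\<^sub>C y) = c *\<^sub>C S h y"
  using bounded_clinear_S[of h] by (auto simp: bounded_clinear_def)

lemma S_add: "S h (y + z) = S h y + S h z"
  using bounded_linear_S by (rule linear_simps)

lemma S_diff: "S h (y - z) = S h y - S h z"
  using bounded_linear_S by (rule linear_simps)

lemma S_zero: "S h 0 = 0"
  using bounded_linear_S by (rule linear_simps)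

lemma S_S: "S h (S k y) = S (h + k) y"
proof (rule dense_induct[where P = "\<lambda>y. S h (S k y) = S (h + k) y"])
  show "closed {y. S h (S k y) = S (h + k) y}"
    by (intro closed_Collect_eq linear_continuous_on bounded_linear_S bounded_linear_compose[OF bounded_linear_S])
  fix f assume f: "f \<in> step_functions e"
  show "S h (S k (\<iota> f)) = S (h + k) (\<iota> f)"
    using f step_shift(1)[OF f, of k] by (simp add: S_\<iota> algebra_simps)
qed

lemma S_0: "S 0 y = y"
proof (rule dense_induct[where P = "\<lambda>y. S 0 y = y"])
  show "closed {y. S 0 y = y}"
    by (intro closed_Collect_eq linear_continuous_on bounded_linear_S continuous_on_id)
qed (simp add: S_\<iota>)

text \<open>Polarization turns preservation of norms into preservation of real parts, and
  \<open>\<i> *\<^sub>C z\<close> supplies the imaginary parts.\<close>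

lemma cinner_S_S: "cinner (S h y) (S h z) = cinner y z"
proof -
  have "Re (cinner (S h y) (S h z)) = Re (cinner y z)" for y z
    unfolding polarization S_add[symmetric] by simp
  from this[of y z] this[of y "\<i> *\<^sub>C z"] show ?thesis
    by (subst (1 2) cinner_eq_Re) (simp add: S_scale)
qed

lemma cinner_S: "cinner (S h y) z = cinner y (S (- h) z)"
  using cinner_S_S[of "- h" "S h y" z] by (simp add: S_S S_0)

lemma S_\<kappa>: "A \<in> completed_ring e \<Longrightarrow> S h (\<kappa> A) = \<kappa> ((+) h ` A)"
  using S_\<iota>[OF step_indicator] by (simp add: indicator_shift[symmetric])

lemma \<kappa>_empty_block: "\<kappa> {} = 0"
proof -
  have "indicator {} = (\<lambda>x::'a. 0::complex)" by auto
  then show ?thesis using \<iota>_zero by simp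
qed

text \<open>The scalar product is the volume of an overlap, hence a pointwise limit of finite
  products of continuous functions of the coordinates of \<open>h\<close>.\<close>

lemma borel_measurable_cinner_S_block:
  assumes ab: "abs_measurable e a b" and cd: "abs_measurable e c d"
  shows "(\<lambda>h. cinner (S h (\<kappa> (block e a b))) (\<kappa> (block e c d))) \<in> borel_measurable borel"
proof (cases "block e a b = {} \<or> block e c d = {}")
  case True
  then show ?thesis by (auto simp: \<kappa>_empty_block S_zero)
next
  case False
  have cr: "block e a b \<in> completed_ring e" "block e c d \<in> completed_ring e"
    using ab cd by (auto intro: block_ring_completed block_in_block_ring)
  have eq: "cinner (S h (\<kappa> (block e a b))) (\<kappa> (block e c d)) =
      of_real (lam e (block e (\<lambda>j. a j + h \<bullet> e j) (\<lambda>j. b j + h \<bullet> e j) \<inter> block e c d))" for h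
    using cr completed_ring_shift[OF cr(1), of h] by (simp add: S_\<kappa> cinner_\<kappa> shift_block)
  have "(\<lambda>h. lam e (block e (\<lambda>j. a j + h \<bullet> e j) (\<lambda>j. b j + h \<bullet> e j) \<inter> block e c d)) \<in> borel_measurable borel"
  proof (rule borel_measurable_LIMSEQ_metric)
    show "(\<lambda>n. \<Prod>j<n. max 0 (min (b j + h \<bullet> e j) (d j) - max (a j + h \<bullet> e j) (c j)))
      \<longlonglongrightarrow> lam e (block e (\<lambda>j. a j + h \<bullet> e j) (\<lambda>j. b j + h \<bullet> e j) \<inter> block e c d)" for h
      using False ab cd by (intro lam_block_Int_LIMSEQ abs_measurable_shift) (auto simp: block_shift_empty_iff)
  qed measurable
  then show ?thesis unfolding eq by measurable
qed

text \<open>Pointwise limits preserve measurability, so \<open>block_induct\<close> extends the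
  block case first in \<open>f\<close> and then in \<open>g\<close>. Scalar measurability is what a
  Pettis integral asks for.\<close>

lemma borel_measurable_cinner_S: "(\<lambda>h. cinner (S h f) g) \<in> borel_measurable borel"
proof -
  have lim: "closed {x. (\<lambda>h. F h x) \<in> borel_measurable borel}"
    if "\<And>h. continuous_on UNIV (F h)" for F :: "'a \<Rightarrow> 'h \<Rightarrow> complex"
    unfolding closed_sequential_limits
  proof (intro allI impI, elim conjE)
    fix X l assume X: "\<forall>n. X n \<in> {x. (\<lambda>h. F h x) \<in> borel_measurable borel}" "X \<longlonglongrightarrow> l"
    have "(\<lambda>n. F h (X n)) \<longlonglongrightarrow> F h l" for h
      using continuous_on_tendsto_compose[OF that X(2)] by simp
    with X(1) show "l \<in> {x. (\<lambda>h. F h x) \<in> borel_measurable borel}"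
      using borel_measurable_LIMSEQ_metric[of "\<lambda>n h. F h (X n)" borel "\<lambda>h. F h l"] by simp
  qed
  have 1: "(\<lambda>h. cinner (S h f) (\<kappa> (block e c d))) \<in> borel_measurable borel" if cd: "abs_measurable e c d" for c d
  proof (rule block_induct[where P = "\<lambda>f. (\<lambda>h. cinner (S h f) (\<kappa> (block e c d))) \<in> borel_measurable borel"])
    show "closed {f. (\<lambda>h. cinner (S h f) (\<kappa> (block e c d))) \<in> borel_measurable borel}"
      by (intro lim linear_continuous_on bounded_linear_compose[OF bounded_linear_cinner_left bounded_linear_S])
  qed (use borel_measurable_cinner_S_block[OF _ cd] in \<open>simp_all add: S_add S_scale S_zero cinner_add_left cinner_scaleC_left\<close>)
  show ?thesis
  proof (rule block_induct[where P = "\<lambda>g. (\<lambda>h. cinner (S h f) g) \<in> borel_measurable borel"])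
    show "closed {g. (\<lambda>h. cinner (S h f) g) \<in> borel_measurable borel}"
      by (intro lim linear_continuous_on bounded_linear_cinner_right)
  qed (use 1 in \<open>simp_all add: cinner_add_right cinner_scaleC_right\<close>)
qed

lemma norm_S_diff_sq: "(norm (S h f - f))\<^sup>2 = 2 * (norm f)\<^sup>2 - 2 * Re (cinner (S h f) f)"
  unfolding norm_diff_sq by simp

text \<open>Unitarity writes the norm through one scalar product, so the norm inherits measurability
  in \<open>h\<close>.\<close>

lemma norm_S_diff: "norm (S h f - f) = sqrt (2 * (norm f)\<^sup>2 - 2 * Re (cinner (S h f) f))"
  unfolding norm_S_diff_sq[symmetric] by simp

lemma borel_measurable_norm_S_diff: "(\<lambda>h. norm (S h f - f)) \<in> borel_measurable borel"
  unfolding norm_S_diff using borel_measurable_cinner_S by measurable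

end

section \<open>Continuity of the shifts along rays\<close>

context shift_space
begin

text \<open>In coordinate \<open>j\<close> the overlap loses the fraction |r h_j| / w_j of the
  width, and the product of the factors 1 - x_j is at least 1 minus the sum of the x_j. The constant
  \<open>K\<close> is uniform in \<open>r\<close> because positive volume bounds the inverse
  widths.\<close>

lemma lam_block_shift_ge:
  assumes ab: "abs_measurable e a b" "block e a b \<noteq> {}"
    and H: "summable (\<lambda>j. \<bar>h \<bullet> e j\<bar>)"
  shows "\<exists>K. \<forall>r. lam e (block e a b) * (1 - \<bar>r\<bar> * K) \<le> lam e (((+) (r *\<^sub>R h) ` block e a b) \<inter> block e a b)"
proof (cases "lam e (block e a b) = 0")
  case True
  have "0 \<le> lam e (((+) (r *\<^sub>R h) ` block e a b) \<inter> block e a b)" for r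
    using ab by (intro lam_nonneg cr.Int completed_ring_shift block_ring_completed block_in_block_ring)
  then show ?thesis using True by simp
next
  case False
  define w where "w j = b j - a j" for j
  define V where "V = lam e (block e a b)"
  have w: "w j > 0" for j using ab(1) by (auto simp: w_def abs_measurable_def block_bounds_def)
  have V: "V = block_volume e a b" using ab by (simp add: V_def lam_block_ring block_in_block_ring ring_measure_block)
  have P: "(\<lambda>n. \<Prod>j<n. w j) \<longlonglongrightarrow> V" unfolding w_def V by (rule block_volume_LIMSEQ[OF ab])
  \<comment> \<open>Consecutive partial products with a common nonzero limit have quotients tending
    to 1, and these quotients are the inverse widths.\<close>
  have "(\<lambda>n. (\<Prod>j<n. w j) / (\<Prod>j<Suc n. w j)) \<longlonglongrightarrow> V / V"
    using P False by (intro tendsto_divide LIMSEQ_Suc) (auto simp: V_def)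
  moreover have "(\<Prod>j<n. w j) / (\<Prod>j<Suc n. w j) = inverse (w n)" for n
    using w by (simp add: field_simps less_imp_neq[symmetric])
  ultimately have "convergent (\<lambda>n. inverse (w n))" by (auto simp: convergent_def)
  then obtain M where M: "\<And>n. norm (inverse (w n)) \<le> M"
    using convergent_imp_Bseq BseqE by metis
  have M: "inverse (w n) \<le> M" for n using M[of n] w[of n] by simp
  define K where "K = (\<Sum>j. \<bar>h \<bullet> e j\<bar>) * M"
  have "V * (1 - \<bar>r\<bar> * K) \<le> lam e (((+) (r *\<^sub>R h) ` block e a b) \<inter> block e a b)" for r
  proof (rule LIMSEQ_le)
    let ?k = "r *\<^sub>R h"
    show "(\<lambda>n. \<Prod>j<n. max 0 (min (b j + ?k \<bullet> e j) (b j) - max (a j + ?k \<bullet> e j) (a j)))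
      \<longlonglongrightarrow> lam e (((+) ?k ` block e a b) \<inter> block e a b)"
      unfolding shift_block
      by (intro lam_block_Int_LIMSEQ abs_measurable_shift ab) (simp only: block_shift_empty_iff ab not_False_eq_True)
    show "(\<lambda>n. (\<Prod>j<n. w j) * (1 - \<bar>r\<bar> * K)) \<longlonglongrightarrow> V * (1 - \<bar>r\<bar> * K)"
      by (intro tendsto_intros P)
    have "(\<Prod>j<n. w j) * (1 - \<bar>r\<bar> * K) \<le> (\<Prod>j<n. max 0 (min (b j + ?k \<bullet> e j) (b j) - max (a j + ?k \<bullet> e j) (a j)))" for n
    proof -
      \<comment> \<open>The cap at 1 keeps \<open>x j\<close> in the range required by the
        Weierstrass inequality and corresponds to the cut-off at 0 of the overlap.\<close>
      define x where "x j = min 1 (\<bar>r\<bar> * \<bar>h \<bullet> e j\<bar> * inverse (w j))" for j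
      have x: "x j \<in> {0..1}" for j using w[of j] by (simp add: x_def)
      have "(\<Sum>j<n. x j) \<le> (\<Sum>j<n. \<bar>r\<bar> * M * \<bar>h \<bullet> e j\<bar>)"
      proof (rule sum_mono)
        fix j
        have "\<bar>r\<bar> * \<bar>h \<bullet> e j\<bar> * inverse (w j) \<le> \<bar>r\<bar> * \<bar>h \<bullet> e j\<bar> * M"
          by (rule mult_left_mono[OF M]) simp
        then show "x j \<le> \<bar>r\<bar> * M * \<bar>h \<bullet> e j\<bar>" by (simp add: x_def mult_ac min_le_iff_disj)
      qed
      also have "\<dots> = \<bar>r\<bar> * M * (\<Sum>j<n. \<bar>h \<bullet> e j\<bar>)" by (simp add: sum_distrib_left)
      also have "\<dots> \<le> \<bar>r\<bar> * M * (\<Sum>j. \<bar>h \<bullet> e j\<bar>)"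
      proof (rule mult_left_mono)
        show "(\<Sum>j<n. \<bar>h \<bullet> e j\<bar>) \<le> (\<Sum>j. \<bar>h \<bullet> e j\<bar>)" by (rule sum_le_suminf[OF H]) auto
        have "0 \<le> M" using M[of 0] w[of 0] by (meson less_imp_le order_trans positive_imp_inverse_positive)
        then show "0 \<le> \<bar>r\<bar> * M" by simp
      qed
      finally have "1 - \<bar>r\<bar> * K \<le> 1 - (\<Sum>j<n. x j)" by (simp add: K_def mult_ac)
      also have "\<dots> \<le> (\<Prod>j<n. 1 - x j)" by (rule Weierstrass_prod_ineq) (rule x)
      finally have "(\<Prod>j<n. w j) * (1 - \<bar>r\<bar> * K) \<le> (\<Prod>j<n. w j) * (\<Prod>j<n. 1 - x j)"
        using w by (intro mult_left_mono prod_nonneg) (auto intro: less_imp_le)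
      also have "\<dots> = (\<Prod>j<n. w j * (1 - x j))" by (simp add: prod.distrib)
      also have "\<dots> \<le> (\<Prod>j<n. max 0 (min (b j + ?k \<bullet> e j) (b j) - max (a j + ?k \<bullet> e j) (a j)))"
      proof (rule prod_mono)
        fix j
        have "w j * (1 - x j) = w j - min (w j) (\<bar>r\<bar> * \<bar>h \<bullet> e j\<bar>)"
          using w[of j] by (auto simp: x_def min_def field_simps)
        also have "\<dots> = max 0 (w j - \<bar>?k \<bullet> e j\<bar>)" by (simp add: abs_mult max_def min_def)
        also have "\<dots> = max 0 (min (b j + ?k \<bullet> e j) (b j) - max (a j + ?k \<bullet> e j) (a j))"
          by (auto simp: w_def max_def min_def)
        finally show "0 \<le> w j * (1 - x j) \<and>
            w j * (1 - x j) \<le> max 0 (min (b j + ?k \<bullet> e j) (b j) - max (a j + ?k \<bullet> e j) (a j))" by simp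
      qed
      finally show ?thesis .
    qed
    then show "\<exists>N. \<forall>n\<ge>N. (\<Prod>j<n. w j) * (1 - \<bar>r\<bar> * K) \<le>
        (\<Prod>j<n. max 0 (min (b j + ?k \<bullet> e j) (b j) - max (a j + ?k \<bullet> e j) (a j)))" by blast
  qed
  then show ?thesis unfolding V_def by blast
qed

text \<open>Shifts are not strongly continuous with respect to the norm of \<open>'a\<close>, but they are along
  rays whose direction has absolutely summable coordinates.\<close>

lemma S_ray_LIMSEQ:
  assumes H: "summable (\<lambda>j. \<bar>h \<bullet> e j\<bar>)" and r: "r \<longlonglongrightarrow> 0"
  shows "(\<lambda>n. S (r n *\<^sub>R h) f) \<longlonglongrightarrow> f"
proof (rule block_induct[where P = "\<lambda>f. (\<lambda>n. S (r n *\<^sub>R h) f) \<longlonglongrightarrow> f"])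
  show "closed {f. (\<lambda>n. S (r n *\<^sub>R h) f) \<longlonglongrightarrow> f}"
    unfolding closed_sequential_limits
  proof (intro allI impI, elim conjE, rule CollectI)
    fix X l assume X: "\<forall>n. X n \<in> {f. (\<lambda>n. S (r n *\<^sub>R h) f) \<longlonglongrightarrow> f}" "X \<longlonglongrightarrow> l"
    show "(\<lambda>n. S (r n *\<^sub>R h) l) \<longlonglongrightarrow> l"
    proof (rule metric_LIMSEQ_I)
      fix \<epsilon> :: real assume \<epsilon>: "\<epsilon> > 0"
      then obtain m where m: "dist (X m) l < \<epsilon> / 3"
        using metric_LIMSEQ_D[OF X(2), of "\<epsilon> / 3"] by auto
      have "(\<lambda>n. S (r n *\<^sub>R h) (X m)) \<longlonglongrightarrow> X m" using X(1) by simp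
      from metric_LIMSEQ_D[OF this, of "\<epsilon> / 3"]
      obtain N where N: "\<And>n. n \<ge> N \<Longrightarrow> dist (S (r n *\<^sub>R h) (X m)) (X m) < \<epsilon> / 3"
        using \<epsilon> by auto
      have "dist (S (r n *\<^sub>R h) l) l < \<epsilon>" if "n \<ge> N" for n
      proof -
        \<comment> \<open>By isometry the approximation error is the same for all \<open>n\<close>,
          as the three-epsilon argument requires.\<close>
        have "dist (S (r n *\<^sub>R h) l) (S (r n *\<^sub>R h) (X m)) = dist (X m) l"
          by (simp add: dist_norm S_diff[symmetric] norm_minus_commute)
        then show ?thesis
          using N[OF that] m dist_triangle[of "S (r n *\<^sub>R h) l" l "S (r n *\<^sub>R h) (X m)"]
            dist_triangle[of "S (r n *\<^sub>R h) (X m)" l "X m"] by linarith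
      qed
      then show "\<exists>N. \<forall>n\<ge>N. dist (S (r n *\<^sub>R h) l) l < \<epsilon>" by blast
    qed
  qed
next
  fix a b assume ab: "abs_measurable e a b"
  let ?B = "block e a b"
  show "(\<lambda>n. S (r n *\<^sub>R h) (\<kappa> ?B)) \<longlonglongrightarrow> \<kappa> ?B"
  proof (cases "?B = {}")
    case True
    then show ?thesis by (simp add: \<kappa>_empty_block S_zero)
  next
    case False
    obtain K where K: "\<And>r. lam e ?B * (1 - \<bar>r\<bar> * K) \<le> lam e (((+) (r *\<^sub>R h) ` ?B) \<inter> ?B)"
      using lam_block_shift_ge[OF ab False H] by blast
    have cr: "?B \<in> completed_ring e" using ab by (intro block_ring_completed block_in_block_ring)
    \<comment> \<open>By unitarity the squared norm is twice the volume lost under the shift, and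
      the preceding estimate makes that loss linear in |s|.\<close>
    have bound: "(norm (S (s *\<^sub>R h) (\<kappa> ?B) - \<kappa> ?B))\<^sup>2 \<le> 2 * lam e ?B * K * \<bar>s\<bar>" for s
    proof -
      have "cinner (S (s *\<^sub>R h) (\<kappa> ?B)) (\<kappa> ?B) = of_real (lam e (((+) (s *\<^sub>R h) ` ?B) \<inter> ?B))"
        by (simp only: S_\<kappa>[OF cr] cinner_\<kappa>[OF completed_ring_shift[OF cr] cr])
      then show ?thesis
        using K[of s] norm_\<kappa>_sq[OF cr] unfolding norm_S_diff_sq by (simp add: algebra_simps)
    qed
    have "(\<lambda>n. S (r n *\<^sub>R h) (\<kappa> ?B) - \<kappa> ?B) \<longlonglongrightarrow> 0"
    proof (rule Lim_null_comparison)
      show "\<forall>\<^sub>F n in sequentially. norm (S (r n *\<^sub>R h) (\<kappa> ?B) - \<kappa> ?B) \<le> sqrt (2 * lam e ?B * K * \<bar>r n\<bar>)"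
        using bound by (intro always_eventually allI real_le_rsqrt)
      have "(\<lambda>n. sqrt (2 * lam e ?B * K * \<bar>r n\<bar>)) \<longlonglongrightarrow> sqrt (2 * lam e ?B * K * \<bar>0\<bar>)"
        by (intro tendsto_intros r)
      then show "(\<lambda>n. sqrt (2 * lam e ?B * K * \<bar>r n\<bar>)) \<longlonglongrightarrow> 0" by simp
    qed
    then show ?thesis by (rule LIM_zero_cancel)
  qed
qed (auto simp: S_add S_scale S_zero intro: tendsto_add bounded_linear.tendsto[OF bounded_linear_scaleC])

end

section \<open>Gaussian measures\<close>

text \<open>After division by the total weight the weights become probability densities, and the
  hypothesis equates the characteristic functions of the resulting laws. If the total weight is 0,
  both sides are squeezed to 0.\<close>

lemma weighted_Levy_uniqueness:
  fixes w1 X1 :: "'x \<Rightarrow> real" and w2 X2 :: "'y \<Rightarrow> real"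
  assumes M: "prob_space M1" "prob_space M2"
    and m1[measurable]: "w1 \<in> borel_measurable M1" "X1 \<in> borel_measurable M1"
    and m2[measurable]: "w2 \<in> borel_measurable M2" "X2 \<in> borel_measurable M2"
    and w1: "\<And>x. 0 \<le> w1 x" "\<And>x. w1 x \<le> K" and w2: "\<And>x. 0 \<le> w2 x" "\<And>x. w2 x \<le> K"
    and eq: "\<And>s. (\<integral>x. of_real (w1 x) * iexp (s * X1 x) \<partial>M1) = (\<integral>x. of_real (w2 x) * iexp (s * X2 x) \<partial>M2)"
    and A[measurable]: "A \<in> sets borel"
  shows "(\<integral>x. w1 x * indicator A (X1 x) \<partial>M1) = (\<integral>x. w2 x * indicator A (X2 x) \<partial>M2)"
proof -
  interpret M1: prob_space M1 by fact
  interpret M2: prob_space M2 by fact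
  have K: "0 \<le> K" using order_trans[OF w1] .
  have i1: "integrable M1 w1" "integrable M1 (\<lambda>x. w1 x * indicator A (X1 x))"
    using w1 by (auto intro!: M1.integrable_const_bound[where B = K] simp: indicator_def K)
  have i2: "integrable M2 w2" "integrable M2 (\<lambda>x. w2 x * indicator A (X2 x))"
    using w2 by (auto intro!: M2.integrable_const_bound[where B = K] simp: indicator_def K)
  define c where "c = (\<integral>x. w1 x \<partial>M1)"
  \<comment> \<open>Frequency 0 shows that both total weights agree, so one normalising constant
    serves both sides.\<close>
  have c2: "c = (\<integral>x. w2 x \<partial>M2)" using eq[of 0] by (simp add: c_def)
  have c0: "c \<ge> 0" unfolding c_def using w1 by simp
  show ?thesis
  proof (cases "c = 0")
    case True
    have "(\<integral>x. w1 x * indicator A (X1 x) \<partial>M1) \<le> c" unfolding c_def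
      by (intro integral_mono i1) (auto simp: indicator_def w1)
    moreover have "(\<integral>x. w2 x * indicator A (X2 x) \<partial>M2) \<le> c" unfolding c2
      by (intro integral_mono i2) (auto simp: indicator_def w2)
    moreover have "0 \<le> (\<integral>x. w1 x * indicator A (X1 x) \<partial>M1)" "0 \<le> (\<integral>x. w2 x * indicator A (X2 x) \<partial>M2)"
      by (auto intro!: Bochner_Integration.integral_nonneg simp: w1 w2)
    ultimately show ?thesis using True by simp
  next
    case False
    then have c: "c > 0" using c0 by simp
    have real_dist: "real_distribution (distr (density M (\<lambda>x. ennreal (w x / c))) borel X)"
      and char: "char (distr (density M (\<lambda>x. ennreal (w x / c))) borel X) s =
        (\<integral>x. of_real (w x) * iexp (s * X x) \<partial>M) / of_real c"
      and meas: "measure (distr (density M (\<lambda>x. ennreal (w x / c))) borel X) A =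
        (\<integral>x. w x * indicator A (X x) \<partial>M) / c"
      if [measurable]: "w \<in> borel_measurable M" "X \<in> borel_measurable M"
        and w: "\<And>x. 0 \<le> w x" "integrable M w" "c = (\<integral>x. w x \<partial>M)"
      for M and w X :: "'z \<Rightarrow> real" and s
    proof -
      let ?D = "density M (\<lambda>x. ennreal (w x / c))"
      have "emeasure ?D (space ?D) = (\<integral>\<^sup>+ x. ennreal (w x / c) \<partial>M)"
        by (subst emeasure_density) (auto intro!: nn_integral_cong)
      also have "\<dots> = ennreal (\<integral>x. w x / c \<partial>M)"
        using w c by (intro nn_integral_eq_integral) auto
      also have "\<dots> = 1" using w c by simp
      finally have "prob_space ?D" by (rule prob_spaceI)
      then interpret D: prob_space ?D .
      show rd: "real_distribution (distr ?D borel X)"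
        by (simp add: real_distribution_def real_distribution_axioms_def D.prob_space_distr)
      show "char (distr ?D borel X) s = (\<integral>x. of_real (w x) * iexp (s * X x) \<partial>M) / of_real c"
        unfolding char_def using w c
        by (simp add: integral_distr integral_density scaleR_conv_of_real)
      have "measure (distr ?D borel X) A = (\<integral>x. indicator A (X x) \<partial>?D)"
        by (simp add: measure_distr indicator_vimage[symmetric] del: indicator_vimage)
      also have "\<dots> = (\<integral>x. w x * indicator A (X x) \<partial>M) / c"
        using w c by (subst integral_density) auto
      finally show "measure (distr ?D borel X) A = (\<integral>x. w x * indicator A (X x) \<partial>M) / c" .
    qed
    have "distr (density M1 (\<lambda>x. ennreal (w1 x / c))) borel X1 = distr (density M2 (\<lambda>x. ennreal (w2 x / c))) borel X2"
      by (intro Levy_uniqueness real_dist ext) (simp_all add: char i1 i2 w1 w2 c_def[symmetric] c2[symmetric] eq[simplified])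
    from arg_cong[OF this, of "\<lambda>M. measure M A"] show ?thesis
      using c by (simp add: meas i1 i2 w1 w2 c_def[symmetric] c2[symmetric])
  qed
qed

text \<open>A complex weight \<open>u * iexp \<theta>\<close> is reduced to the nonnegative weights \<open>u * (1 + cos (\<theta> + \<phi>))\<close>.\<close>

lemma phase_Levy_uniqueness:
  fixes u1 X1 \<theta>1 :: "'x \<Rightarrow> real" and u2 X2 \<theta>2 :: "'y \<Rightarrow> real"
  assumes M: "prob_space M1" "prob_space M2"
    and m1[measurable]: "u1 \<in> borel_measurable M1" "X1 \<in> borel_measurable M1" "\<theta>1 \<in> borel_measurable M1"
    and m2[measurable]: "u2 \<in> borel_measurable M2" "X2 \<in> borel_measurable M2" "\<theta>2 \<in> borel_measurable M2"
    and u1: "\<And>x. 0 \<le> u1 x" "\<And>x. u1 x \<le> 1" and u2: "\<And>x. 0 \<le> u2 x" "\<And>x. u2 x \<le> 1"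
    and eq: "\<And>s \<sigma>. (\<integral>x. of_real (u1 x) * iexp (\<sigma> * \<theta>1 x + s * X1 x) \<partial>M1) =
        (\<integral>x. of_real (u2 x) * iexp (\<sigma> * \<theta>2 x + s * X2 x) \<partial>M2)"
    and A[measurable]: "A \<in> sets borel"
  shows "(\<integral>x. of_real (u1 x * indicator A (X1 x)) * iexp (\<theta>1 x) \<partial>M1) =
    (\<integral>x. of_real (u2 x * indicator A (X2 x)) * iexp (\<theta>2 x) \<partial>M2)"
proof -
  interpret M1: prob_space M1 by fact
  interpret M2: prob_space M2 by fact
  \<comment> \<open>The cosine splits into two exponentials, so the weighted integrals involve
    \<open>\<theta>\<close> only with the frequencies 0, 1 and -1.\<close>
  have cexp: "of_real (u * (1 + cos (\<theta> + \<phi>))) * iexp y = of_real u * iexp (0 * \<theta> + y)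
      + (iexp \<phi> / 2) * (of_real u * iexp (1 * \<theta> + y)) + (iexp (- \<phi>) / 2) * (of_real u * iexp ((-1) * \<theta> + y))" for u \<theta> \<phi> y
  proof -
    have "complex_of_real (cos (\<theta> + \<phi>)) = (iexp (\<theta> + \<phi>) + iexp (- (\<theta> + \<phi>))) / 2"
      by (simp add: cos_of_real[symmetric] cos_exp_eq algebra_simps)
    moreover have "iexp (\<theta> + \<phi>) = iexp \<theta> * iexp \<phi>" "iexp (- (\<theta> + \<phi>)) = iexp (- \<theta>) * iexp (- \<phi>)"
      "iexp (1 * \<theta> + y) = iexp \<theta> * iexp y" "iexp ((-1) * \<theta> + y) = iexp (- \<theta>) * iexp y"
      by (simp_all add: exp_add[symmetric] algebra_simps)
    ultimately show ?thesis by (simp only: of_real_mult of_real_add) (simp add: field_simps)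
  qed
  have int: "integrable M (\<lambda>x. of_real (u x) * iexp (f x))"
    if "prob_space M" and [measurable]: "u \<in> borel_measurable M" "f \<in> borel_measurable M"
      and "\<And>x. 0 \<le> u x" "\<And>x. u x \<le> 1" for M and u f :: "'z \<Rightarrow> real"
  proof -
    interpret prob_space M by fact
    show ?thesis using that(4,5) by (intro integrable_const_bound[where B = 1]) (auto simp: norm_mult)
  qed
  have split: "(\<integral>x. of_real (u x * (1 + cos (\<theta> x + \<phi>))) * iexp (s * X x) \<partial>M) =
      (\<integral>x. of_real (u x) * iexp (0 * \<theta> x + s * X x) \<partial>M)
      + (iexp \<phi> / 2) * (\<integral>x. of_real (u x) * iexp (1 * \<theta> x + s * X x) \<partial>M)
      + (iexp (- \<phi>) / 2) * (\<integral>x. of_real (u x) * iexp ((-1) * \<theta> x + s * X x) \<partial>M)"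
    if "prob_space M" and [measurable]: "u \<in> borel_measurable M" "\<theta> \<in> borel_measurable M" "X \<in> borel_measurable M"
      and "\<And>x. 0 \<le> u x" "\<And>x. u x \<le> 1" for M and u \<theta> X :: "'z \<Rightarrow> real" and s \<phi>
  proof -
    have I: "integrable M (\<lambda>x. of_real (u x) * iexp (\<sigma> * \<theta> x + s * X x))" for \<sigma>
      using that by (intro int) auto
    have lin: "(\<integral>x. F x + a * G x + b * H x \<partial>M) = (\<integral>x. F x \<partial>M) + a * (\<integral>x. G x \<partial>M) + b * (\<integral>x. H x \<partial>M)"
      if "integrable M F" "integrable M G" "integrable M H" for F G H :: "'z \<Rightarrow> complex" and a b
      using that by simp
    show ?thesis unfolding cexp by (rule lin[OF I I I])
  qed
  have c0: "0 \<le> 1 + cos x" "1 + cos x \<le> 2" for x :: real using cos_ge_minus_one[of x] cos_le_one[of x] by linarith+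
  have le2: "u * (1 + cos x) \<le> 2" if "0 \<le> u" "u \<le> 1" for u x :: real
    using mult_mono[of u 1 "1 + cos x" 2] that c0[of x] by simp
  have w: "(\<integral>x. u1 x * (1 + cos (\<theta>1 x + \<phi>)) * indicator A (X1 x) \<partial>M1) =
      (\<integral>x. u2 x * (1 + cos (\<theta>2 x + \<phi>)) * indicator A (X2 x) \<partial>M2)" for \<phi>
  proof (rule weighted_Levy_uniqueness[OF M, where K = 2])
    fix s
    show "(\<integral>x. of_real (u1 x * (1 + cos (\<theta>1 x + \<phi>))) * iexp (s * X1 x) \<partial>M1) =
        (\<integral>x. of_real (u2 x * (1 + cos (\<theta>2 x + \<phi>))) * iexp (s * X2 x) \<partial>M2)"
      unfolding split[OF M(1) m1(1,3,2) u1] split[OF M(2) m2(1,3,2) u2] eq ..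
  qed (simp_all add: u1 u2 c0 le2)
  have w0: "(\<integral>x. u1 x * indicator A (X1 x) \<partial>M1) = (\<integral>x. u2 x * indicator A (X2 x) \<partial>M2)"
    using eq[of 0] by (intro weighted_Levy_uniqueness[OF M, where K = 1]) (simp_all add: u1 u2)
  have i1: "integrable M1 (\<lambda>x. u1 x * indicator A (X1 x))" "integrable M1 (\<lambda>x. u1 x * indicator A (X1 x) * cos (\<theta>1 x + \<phi>))" for \<phi>
    using u1 by (auto intro!: M1.integrable_const_bound[where B = 1] simp: indicator_def abs_mult mult_le_one)
  have i2: "integrable M2 (\<lambda>x. u2 x * indicator A (X2 x))" "integrable M2 (\<lambda>x. u2 x * indicator A (X2 x) * cos (\<theta>2 x + \<phi>))" for \<phi>
    using u2 by (auto intro!: M2.integrable_const_bound[where B = 1] simp: indicator_def abs_mult mult_le_one)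
  have cosw: "(\<integral>x. u1 x * indicator A (X1 x) * cos (\<theta>1 x + \<phi>) \<partial>M1) = (\<integral>x. u2 x * indicator A (X2 x) * cos (\<theta>2 x + \<phi>) \<partial>M2)" for \<phi>
  proof -
    have e: "u * (1 + cos y) * i = u * i + u * i * cos y" for u y i :: real by (simp add: algebra_simps)
    show ?thesis using w[of \<phi>] w0 unfolding e
      by (simp add: Bochner_Integration.integral_add i1 i2)
  qed
  \<comment> \<open>The phases 0 and -pi/2 recover cosine and sine, that is, the real and imaginary
    parts.\<close>
  have dec: "of_real v * iexp \<theta> = complex_of_real (v * cos (\<theta> + 0)) + \<i> * complex_of_real (v * cos (\<theta> + (- (pi / 2))))" for v \<theta>
    by (simp add: complex_eq_iff Re_exp Im_exp sin_cos_eq cos_minus[of "pi/2 - \<theta>", symmetric] del: cos_minus)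
  have lin: "(\<integral>x. complex_of_real (F x) + \<i> * of_real (G x) \<partial>M) = of_real (\<integral>x. F x \<partial>M) + \<i> * of_real (\<integral>x. G x \<partial>M)"
    if "integrable M F" "integrable M G" for M and F G :: "'z \<Rightarrow> real"
    using that by simp
  have "(\<integral>x. of_real (u1 x * indicator A (X1 x)) * iexp (\<theta>1 x) \<partial>M1) =
    of_real (\<integral>x. u1 x * indicator A (X1 x) * cos (\<theta>1 x + 0) \<partial>M1) + \<i> * of_real (\<integral>x. u1 x * indicator A (X1 x) * cos (\<theta>1 x + (- (pi / 2))) \<partial>M1)"
    unfolding dec by (rule lin[OF i1(2) i1(2)])
  moreover have "(\<integral>x. of_real (u2 x * indicator A (X2 x)) * iexp (\<theta>2 x) \<partial>M2) =
    of_real (\<integral>x. u2 x * indicator A (X2 x) * cos (\<theta>2 x + 0) \<partial>M2) + \<i> * of_real (\<integral>x. u2 x * indicator A (X2 x) * cos (\<theta>2 x + (- (pi / 2))) \<partial>M2)"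
    unfolding dec by (rule lin[OF i2(2) i2(2)])
  ultimately show ?thesis unfolding cosw by simp
qed

text \<open>Induction through mixed functionals: indicators in the first \<open>k\<close>
  coordinates, an exponential in the others. Each step converts one exponential into an indicator;
  at \<open>k = n\<close> cylinder sets remain, and they determine the measure.\<close>

lemma sequence_char_uniqueness:
  fixes \<mu> \<nu> :: "(nat \<Rightarrow> real) measure"
  assumes \<mu>: "prob_space \<mu>" "sets \<mu> = sets (PiM UNIV (\<lambda>_. borel))"
    and \<nu>: "prob_space \<nu>" "sets \<nu> = sets (PiM UNIV (\<lambda>_. borel))"
    and eq: "\<And>n \<xi>. (\<integral>x. iexp (\<Sum>j<n. \<xi> j * x j) \<partial>\<mu>) = (\<integral>x. iexp (\<Sum>j<n. \<xi> j * x j) \<partial>\<nu>)"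
  shows "\<mu> = \<nu>"
proof -
  interpret \<mu>: prob_space \<mu> by fact
  interpret \<nu>: prob_space \<nu> by fact
  note [measurable_cong] = \<mu>(2) \<nu>(2)
  have mixed: "(\<And>j. A j \<in> sets borel) \<Longrightarrow>
      (\<integral>x. of_real (\<Prod>j<k. indicator (A j) (x j)) * iexp (\<Sum>j\<in>{k..<n}. \<xi> j * x j) \<partial>\<mu>) =
      (\<integral>x. of_real (\<Prod>j<k. indicator (A j) (x j)) * iexp (\<Sum>j\<in>{k..<n}. \<xi> j * x j) \<partial>\<nu>)"
    if "k \<le> n" for k n \<xi> and A :: "nat \<Rightarrow> real set"
    using that
  proof (induction k arbitrary: \<xi>)
    case 0
    then show ?case using eq[of \<xi> n] by (simp add: atLeast0LessThan)
  next
    case (Suc k)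
    note A[measurable] = Suc.prems(1)
    define u where "u x = (\<Prod>j<k. indicator (A j) (x j) :: real)" for x :: "nat \<Rightarrow> real"
    define \<theta> where "\<theta> x = (\<Sum>j\<in>{Suc k..<n}. \<xi> j * x j)" for x :: "nat \<Rightarrow> real"
    have u01: "0 \<le> u x" "u x \<le> 1" for x unfolding u_def by (auto intro!: prod_nonneg prod_le_1)
    have ins: "{k..<n} = insert k {Suc k..<n}" using Suc.prems by auto
    have [measurable]: "u \<in> borel_measurable \<mu>" "u \<in> borel_measurable \<nu>"
      "\<theta> \<in> borel_measurable \<mu>" "\<theta> \<in> borel_measurable \<nu>"
      unfolding u_def \<theta>_def by measurable
    have IH: "(\<integral>x. of_real (u x) * iexp (\<sigma> * \<theta> x + s * x k) \<partial>\<mu>) =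
        (\<integral>x. of_real (u x) * iexp (\<sigma> * \<theta> x + s * x k) \<partial>\<nu>)" for s \<sigma>
    proof -
      \<comment> \<open>The induction hypothesis is used with frequency \<open>s\<close> in
        coordinate \<open>k\<close> and the remaining frequencies scaled by \<open>\<sigma>\<close>,
        the two parameters of \<open>phase_Levy_uniqueness\<close>.\<close>
      have "(\<Sum>j\<in>{k..<n}. (if j = k then s else \<sigma> * \<xi> j) * x j) = \<sigma> * \<theta> x + s * x k" for x :: "nat \<Rightarrow> real"
        unfolding ins \<theta>_def by (simp add: sum_distrib_left mult.assoc)
      then show ?thesis
        using Suc.IH[OF A, of "\<lambda>j. if j = k then s else \<sigma> * \<xi> j"] Suc.prems unfolding u_def by simp
    qed
    have "(\<integral>x. of_real (u x * indicator (A k) (x k)) * iexp (\<theta> x) \<partial>\<mu>) =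
        (\<integral>x. of_real (u x * indicator (A k) (x k)) * iexp (\<theta> x) \<partial>\<nu>)"
      by (rule phase_Levy_uniqueness[OF \<mu>(1) \<nu>(1)]) (use IH u01 in simp_all)
    then show ?case unfolding u_def \<theta>_def by simp
  qed
  show ?thesis
  proof (rule measure_eqI_PiM_infinite[OF \<mu>(2) \<nu>(2)])
    show "finite_measure \<mu>" by unfold_locales
    fix B :: "nat \<Rightarrow> real set" and J assume J: "finite J" and B: "\<And>i. i \<in> J \<Longrightarrow> B i \<in> sets borel"
    \<comment> \<open>Unconstrained coordinates get \<open>UNIV\<close>, which turns a cylinder over
      any finite \<open>J\<close> into one over an initial segment; \<open>insert 0\<close> below
      covers empty \<open>J\<close>.\<close>
    define A where "A i = (if i \<in> J then B i else UNIV)" for i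
    have A[measurable]: "A i \<in> sets borel" for i using B by (simp add: A_def)
    define n where "n = Suc (Max (insert 0 J))"
    have Jn: "j < n" if "j \<in> J" for j
      unfolding n_def less_Suc_eq_le using J that by (intro Max_ge) auto
    let ?C = "{x. \<forall>j<n. x j \<in> A j}"
    have C: "prod_emb UNIV (\<lambda>_. borel) J (Pi\<^sub>E J B) = ?C"
      using Jn by (auto simp: prod_emb_def A_def space_PiM PiE_iff extensional_def split: if_splits)
    have [measurable]: "?C \<in> sets (PiM UNIV (\<lambda>_. borel))"
      unfolding C[symmetric] using J B by (intro sets_PiM_I) auto
    have ind: "complex_of_real (\<Prod>j<n. indicator (A j) (x j)) * iexp (\<Sum>j\<in>{n..<n}. 0 * x j) = of_real (indicator ?C x)"
      for x :: "nat \<Rightarrow> real"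
      by (auto simp: indicator_def prod_eq_1_iff)
    have "complex_of_real (measure \<mu> ?C) = of_real (measure \<nu> ?C)"
      using mixed[of n n A "\<lambda>_. 0"] A unfolding ind
      by (simp add: \<mu>(2) \<nu>(2) sets_eq_imp_space_eq[OF \<mu>(2)] sets_eq_imp_space_eq[OF \<nu>(2)] space_PiM del: of_real_eq_iff)
    then show "emeasure \<mu> (prod_emb UNIV (\<lambda>_. borel) J (Pi\<^sub>E J B)) = emeasure \<nu> (prod_emb UNIV (\<lambda>_. borel) J (Pi\<^sub>E J B))"
      unfolding C by (simp add: \<mu>.emeasure_eq_measure \<nu>.emeasure_eq_measure)
  qed
qed

context onb
begin

text \<open>The coordinate sequences have the same law by the preceding lemma, applied with finite
  combinations of basis vectors as frequencies. The coordinates generate the Borel sets, so the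
  measures themselves agree.\<close>

lemma centered_gaussian_unique:
  assumes M: "centered_gaussian C M" and N: "centered_gaussian C N"
  shows "M = (N :: 'a measure)"
proof -
  have pM: "prob_space M" "sets M = sets borel" and pN: "prob_space N" "sets N = sets borel"
    using M N by (auto simp: centered_gaussian_def)
  define X where "X x = (\<lambda>j. x \<bullet> e j)" for x :: 'a
  let ?P = "PiM UNIV (\<lambda>_::nat. borel :: real measure)"
  have X: "X \<in> measurable borel ?P"
    unfolding X_def by (rule measurable_PiM_single') auto
  have XM: "X \<in> measurable M ?P" and XN: "X \<in> measurable N ?P"
    using X measurable_cong_sets[OF pM(2) refl] measurable_cong_sets[OF pN(2) refl] by auto
  have char: "(\<integral>x. iexp (\<Sum>j<n. \<xi> j * x j) \<partial>distr L ?P X) = complex_of_real (exp (- (C v \<bullet> v) / 2))"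
    if "centered_gaussian C L" and XL: "X \<in> measurable L ?P" and v: "v = (\<Sum>j<n. \<xi> j *\<^sub>R e j)" for L n \<xi> v
  proof -
    have "(\<integral>x. iexp (\<Sum>j<n. \<xi> j * x j) \<partial>distr L ?P X) = (\<integral>x. iexp (x \<bullet> v) \<partial>L)"
      by (subst integral_distr[OF XL]) (simp_all add: X_def v inner_sum_right)
    then show ?thesis using that(1) by (simp add: centered_gaussian_def)
  qed
  have eq: "distr M ?P X = distr N ?P X"
  proof (rule sequence_char_uniqueness)
    show "prob_space (distr M ?P X)" by (rule prob_space.prob_space_distr[OF pM(1) XM])
    show "prob_space (distr N ?P X)" by (rule prob_space.prob_space_distr[OF pN(1) XN])
    show "(\<integral>x. iexp (\<Sum>j<n. \<xi> j * x j) \<partial>distr M ?P X) = (\<integral>x. iexp (\<Sum>j<n. \<xi> j * x j) \<partial>distr N ?P X)" for n \<xi>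
      unfolding char[OF M XM refl] char[OF N XN refl] ..
  qed simp_all
  \<comment> \<open>Measurability of the identity from the sigma-algebra generated by the
    coordinates says that every Borel set is a preimage under \<open>X\<close>.\<close>
  let ?V = "vimage_algebra UNIV X ?P"
  have XV: "X \<in> measurable ?V ?P" by (rule measurable_vimage_algebra1) (simp add: space_PiM)
  have id: "(\<lambda>x. x) \<in> borel_measurable ?V"
  proof (rule borel_measurable_coordI)
    fix j
    have "(\<lambda>x. X x j) \<in> borel_measurable ?V"
      by (rule measurable_compose[OF XV]) simp
    then show "(\<lambda>x. x \<bullet> e j) \<in> borel_measurable ?V" by (simp add: X_def)
  qed
  show ?thesis
  proof (rule measure_eqI)
    show "sets M = sets N" using pM pN by simp
    fix B assume "B \<in> sets M"
    then have "B \<in> sets borel" using pM by simp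
    from measurable_sets[OF id this] have "B \<in> sets ?V" by simp
    then obtain B' where B': "B' \<in> sets ?P" "B = X -` B'"
      by (subst (asm) sets_vimage_algebra2) (auto simp: space_PiM)
    have "emeasure (distr M ?P X) B' = emeasure (distr N ?P X) B'" by (simp only: eq)
    then show "emeasure M B = emeasure N B"
      using B' XM XN sets_eq_imp_space_eq[OF pM(2)] sets_eq_imp_space_eq[OF pN(2)]
      by (simp add: emeasure_distr)
  qed
qed

lemma gaussian_measure_eq:
  assumes "centered_gaussian C (M :: 'a measure)"
  shows "gaussian_measure C = M"
  unfolding gaussian_measure_def using assms centered_gaussian_unique by (intro the_equality) auto

lemma centered_gaussian_convolution:
  assumes M: "centered_gaussian C M" and N: "centered_gaussian C' (N :: 'a measure)"
  shows "centered_gaussian (\<lambda>x. C x + C' x) (distr (M \<Otimes>\<^sub>M N) borel (\<lambda>(x, y). x + y))"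
proof -
  have pM: "prob_space M" "sets M = sets borel" and pN: "prob_space N" "sets N = sets borel"
    using M N by (auto simp: centered_gaussian_def)
  interpret M: prob_space M by fact
  interpret N: prob_space N by fact
  interpret pair_prob_space M N ..
  note [measurable_cong] = pM(2) pN(2)
  have plus[measurable]: "(\<lambda>(x, y). x + y) \<in> borel_measurable (M \<Otimes>\<^sub>M N)"
    using measurable_plus_pair measurable_cong_sets[OF sets_pair_measure_cong[OF pM(2) pN(2)] refl] by blast
  show ?thesis
    unfolding centered_gaussian_def
  proof (intro conjI allI)
    show "prob_space (distr (M \<Otimes>\<^sub>M N) borel (\<lambda>(x, y). x + y))" by (rule prob_space_distr[OF plus])
    fix \<xi>
    have [simp]: "integrable (M \<Otimes>\<^sub>M N) (\<lambda>(x, y). iexp (x \<bullet> \<xi>) * iexp (y \<bullet> \<xi>))"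
      by (rule integrable_const_bound[where B = 1]) (auto simp: norm_mult split_beta)
    have "(\<integral>z. iexp (z \<bullet> \<xi>) \<partial>distr (M \<Otimes>\<^sub>M N) borel (\<lambda>(x, y). x + y)) =
        (\<integral>(x, y). iexp (x \<bullet> \<xi>) * iexp (y \<bullet> \<xi>) \<partial>(M \<Otimes>\<^sub>M N))"
      by (subst integral_distr[OF plus]) (auto simp: split_beta inner_add_left exp_add[symmetric] distrib_left intro!: Bochner_Integration.integral_cong)
    also have "\<dots> = (\<integral>x. \<integral>y. iexp (x \<bullet> \<xi>) * iexp (y \<bullet> \<xi>) \<partial>N \<partial>M)"
      by (subst integral_fst'[symmetric]) simp_all
    also have "\<dots> = (\<integral>x. iexp (x \<bullet> \<xi>) \<partial>M) * (\<integral>y. iexp (y \<bullet> \<xi>) \<partial>N)" by simp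
    also have "\<dots> = complex_of_real (exp (- ((C \<xi> + C' \<xi>) \<bullet> \<xi>) / 2))"
      using M N by (simp add: centered_gaussian_def exp_add[symmetric] inner_add_left field_simps flip: of_real_mult)
    finally show "(\<integral>z. iexp (z \<bullet> \<xi>) \<partial>distr (M \<Otimes>\<^sub>M N) borel (\<lambda>(x, y). x + y)) =
        complex_of_real (exp (- ((C \<xi> + C' \<xi>) \<bullet> \<xi>) / 2))" .
  qed simp
qed

end

section \<open>A Gaussian vector built from independent standard normals\<close>

abbreviation std_normal_sequence :: "(nat \<Rightarrow> real) measure" where
  "std_normal_sequence \<equiv> PiM UNIV (\<lambda>_. std_normal_distribution)"

lemma prob_space_std_normal: "prob_space std_normal_distribution"
  by (rule prob_space_normal_density) simp

interpretation std_seq: product_prob_space "\<lambda>_::nat. std_normal_distribution" UNIV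
  by (intro product_prob_spaceI prob_space_normal_density) simp

lemma sets_std_normal_sequence [measurable_cong]:
  "sets std_normal_sequence = sets (PiM UNIV (\<lambda>_. borel))"
  by (rule sets_PiM_cong) simp_all

lemma std_normal_sequence_char:
  "(\<integral>y. iexp (\<Sum>j<n. c j * y j) \<partial>std_normal_sequence) = complex_of_real (exp (- (\<Sum>j<n. (c j)\<^sup>2) / 2))"
proof -
  let ?J = "{..<n}" and ?N = "\<lambda>_::nat. std_normal_distribution"
  have r: "(\<lambda>y. restrict y ?J) \<in> measurable std_normal_sequence (PiM ?J ?N)"
    by (rule measurable_restrict_subset) simp
  have m: "(\<lambda>y. \<Prod>j<n. iexp (c j * y j)) \<in> borel_measurable (PiM ?J ?N)" by measurable
  have "(\<integral>y. iexp (\<Sum>j<n. c j * y j) \<partial>std_normal_sequence) =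
      (\<integral>y. (\<Prod>j<n. iexp (c j * restrict y ?J j)) \<partial>std_normal_sequence)"
    by (intro Bochner_Integration.integral_cong) (simp_all add: exp_sum[symmetric] sum_distrib_left)
  also have "\<dots> = (\<integral>y. (\<Prod>j<n. iexp (c j * y j)) \<partial>distr std_normal_sequence (PiM ?J ?N) (\<lambda>y. restrict y ?J))"
    by (rule integral_distr[OF r m, symmetric])
  also have "distr std_normal_sequence (PiM ?J ?N) (\<lambda>y. restrict y ?J) = PiM ?J ?N"
    by (rule std_seq.distr_PiM_restrict_finite) simp_all
  also have "(\<integral>y. (\<Prod>j<n. iexp (c j * y j)) \<partial>PiM ?J ?N) = (\<Prod>j<n. \<integral>y. iexp (c j * y) \<partial>std_normal_distribution)"
  proof (rule std_seq.product_integral_prod)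
    show "integrable std_normal_distribution (\<lambda>y. iexp (c j * y))" for j
      by (rule prob_space.integrable_iexp[OF prob_space_std_normal]) simp_all
  qed simp
  also have "\<dots> = (\<Prod>j<n. complex_of_real (exp (- (c j)\<^sup>2 / 2)))"
    using char_std_normal_distribution by (simp add: char_def fun_eq_iff)
  also have "\<dots> = complex_of_real (exp (- (\<Sum>j<n. (c j)\<^sup>2) / 2))"
    unfolding of_real_prod[symmetric] exp_sum[OF finite_lessThan, symmetric]
    by (simp add: sum_negf sum_divide_distrib)
  finally show ?thesis .
qed

text \<open>Any finite bound independent of \<open>j\<close> serves; |x| <= (1 + x^2) / 2 reduces it
  to the second moment and gives 1.\<close>

lemma std_normal_sequence_nn_abs:
  "(\<integral>\<^sup>+ y. ennreal \<bar>y j\<bar> \<partial>std_normal_sequence) \<le> 1"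
proof -
  have "(\<integral>\<^sup>+ y. ennreal \<bar>y j\<bar> \<partial>std_normal_sequence) =
      (\<integral>\<^sup>+ x. ennreal \<bar>x\<bar> \<partial>distr std_normal_sequence std_normal_distribution (\<lambda>y. y j))"
    by (subst nn_integral_distr) auto
  also have "distr std_normal_sequence std_normal_distribution (\<lambda>y. y j) = std_normal_distribution"
    by (rule std_seq.PiM_component) simp
  also have "(\<integral>\<^sup>+ x. ennreal \<bar>x\<bar> \<partial>std_normal_distribution) \<le>
      (\<integral>\<^sup>+ x. ennreal ((1 + x\<^sup>2) / 2) \<partial>std_normal_distribution)"
  proof (intro nn_integral_mono ennreal_leI)
    fix x :: real
    have "0 \<le> (\<bar>x\<bar> - 1)\<^sup>2" by simp
    then show "\<bar>x\<bar> \<le> (1 + x\<^sup>2) / 2" by (simp add: power2_diff)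
  qed
  also have "\<dots> = ennreal (\<integral>x. (1 + x\<^sup>2) / 2 \<partial>std_normal_distribution)"
  proof (rule nn_integral_eq_integral)
    show "integrable std_normal_distribution (\<lambda>x. (1 + x\<^sup>2) / 2)"
      using integrable_std_normal_distribution_moment[of 2] by simp
  qed simp
  also have "(\<integral>x. (1 + x\<^sup>2) / 2 \<partial>std_normal_distribution) = 1"
  proof -
    have "(\<integral>x. x\<^sup>2 \<partial>std_normal_distribution) = 1"
      using std_normal_distribution_even_moments[of 1] by simp
    moreover have "(\<integral>x. (1 + x\<^sup>2) \<partial>std_normal_distribution) =
        (\<integral>x. 1 \<partial>std_normal_distribution) + (\<integral>x. x\<^sup>2 \<partial>std_normal_distribution)"
      by (rule Bochner_Integration.integral_add)
        (rule prob_space.finite_measure[OF prob_space_std_normal, THEN finite_measure.integrable_const],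
         rule integrable_std_normal_distribution_moment)
    moreover have "(\<integral>x. 1 \<partial>std_normal_distribution) = (1::real)"
      using prob_space.prob_space[OF prob_space_std_normal] by (simp add: lebesgue_integral_const)
    ultimately show ?thesis unfolding integral_divide_zero by simp
  qed
  finally show ?thesis by simp
qed

text \<open>The numbers \<open>s j\<close> stand for the eigenvalues of the root of
  \<open>D\<close>; their summability is the form in which nuclearity of the root is used.\<close>

locale diag_gauss = onb e for e :: "nat \<Rightarrow> 'a::{real_inner,complete_space}" +
  fixes s :: "nat \<Rightarrow> real" and D :: "'a \<Rightarrow> 'a"
  assumes s_nonneg: "\<And>j. 0 \<le> s j" and s_summable: "summable s"
    and D_linear: "bounded_linear D" and D_e: "\<And>j. D (e j) = (s j)\<^sup>2 *\<^sub>R e j"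
begin

text \<open>The value 0 off the event of absolute convergence makes \<open>G_ell1\<close> hold for
  every \<open>y\<close>, not just almost every one. Testing with an extended nonnegative sum makes
  this event measurable.\<close>

definition G :: "(nat \<Rightarrow> real) \<Rightarrow> 'a" where
  "G y = (if (\<Sum>j. ennreal \<bar>s j * y j\<bar>) \<noteq> top then \<Sum>j. (s j * y j) *\<^sub>R e j else 0)"

lemma G_summable:
  assumes "(\<Sum>j. ennreal \<bar>s j * y j\<bar>) \<noteq> top"
  shows "summable (\<lambda>j. \<bar>s j * y j\<bar>)" and "summable (\<lambda>j. (s j * y j) *\<^sub>R e j)"
proof -
  show *: "summable (\<lambda>j. \<bar>s j * y j\<bar>)"
    using assms by (intro summable_suminf_not_top) auto
  \<comment> \<open>Absolutely summable terms are eventually below 1 in modulus, and there the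
    square is below the modulus.\<close>
  have sq: "summable (\<lambda>j. (s j * y j)\<^sup>2)"
  proof (rule summable_comparison_test_ev[OF _ *])
    have "(\<lambda>j. \<bar>s j * y j\<bar>) \<longlonglongrightarrow> 0" by (rule summable_LIMSEQ_zero[OF *])
    then have "\<forall>\<^sub>F j in sequentially. \<bar>s j * y j\<bar> < 1" by (rule order_tendstoD) simp
    then show "\<forall>\<^sub>F j in sequentially. norm ((s j * y j)\<^sup>2) \<le> \<bar>s j * y j\<bar>"
    proof (rule eventually_mono)
      fix j assume "\<bar>s j * y j\<bar> < 1"
      then have "\<bar>s j * y j\<bar> * \<bar>s j * y j\<bar> \<le> 1 * \<bar>s j * y j\<bar>" by (intro mult_right_mono) auto
      then show "norm ((s j * y j)\<^sup>2) \<le> \<bar>s j * y j\<bar>" by (simp add: power2_eq_square abs_mult)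
    qed
  qed
  show "summable (\<lambda>j. (s j * y j) *\<^sub>R e j)" by (rule ell2_vector[OF sq])
qed

lemma G_coord: "G y \<bullet> e j = (if (\<Sum>j. ennreal \<bar>s j * y j\<bar>) \<noteq> top then s j * y j else 0)"
  using suminf_inner_e[OF G_summable(2)[of y], of j]
  by (cases "(\<Sum>j. ennreal \<bar>s j * y j\<bar>) = top") (simp_all only: G_def if_False if_True inner_zero_left simp_thms not_False_eq_True)

lemma G_ell1: "summable (\<lambda>j. \<bar>G y \<bullet> e j\<bar>)"
  unfolding G_coord using G_summable(1)[of y]
  by (cases "(\<Sum>j. ennreal \<bar>s j * y j\<bar>) = top") (simp_all only: if_False if_True simp_thms not_False_eq_True abs_zero summable_zero)

lemma G_measurable [measurable]: "G \<in> borel_measurable std_normal_sequence"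
  by (rule borel_measurable_coordI) (simp add: G_coord)

text \<open>The expected value of the sum is at most the sum of the \<open>s j\<close>, and a
  variable with finite expectation is almost surely finite.\<close>

lemma AE_G_finite: "AE y in std_normal_sequence. (\<Sum>j. ennreal \<bar>s j * y j\<bar>) \<noteq> top"
proof -
  have "(\<integral>\<^sup>+ y. (\<Sum>j. ennreal \<bar>s j * y j\<bar>) \<partial>std_normal_sequence) =
      (\<Sum>j. \<integral>\<^sup>+ y. ennreal \<bar>s j * y j\<bar> \<partial>std_normal_sequence)"
    by (rule nn_integral_suminf) simp
  also have "\<dots> \<le> (\<Sum>j. ennreal (s j))"
  proof (rule suminf_le)
    fix j
    have "(\<integral>\<^sup>+ y. ennreal \<bar>s j * y j\<bar> \<partial>std_normal_sequence) = ennreal (s j) * (\<integral>\<^sup>+ y. ennreal \<bar>y j\<bar> \<partial>std_normal_sequence)"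
      using s_nonneg[of j] by (subst nn_integral_cmult[symmetric]) (auto simp: abs_mult ennreal_mult)
    also have "\<dots> \<le> ennreal (s j) * 1" by (intro mult_left_mono std_normal_sequence_nn_abs) simp
    finally show "(\<integral>\<^sup>+ y. ennreal \<bar>s j * y j\<bar> \<partial>std_normal_sequence) \<le> ennreal (s j)" by simp
  qed auto
  also have "\<dots> = ennreal (\<Sum>j. s j)" by (intro suminf_ennreal2 s_nonneg s_summable)
  also have "\<dots> < \<infinity>" by simp
  finally have "(\<integral>\<^sup>+ y. (\<Sum>j. ennreal \<bar>s j * y j\<bar>) \<partial>std_normal_sequence) \<noteq> \<infinity>"
    by (rule less_imp_neq)
  then have "AE y in std_normal_sequence. (\<Sum>j. ennreal \<bar>s j * y j\<bar>) \<noteq> \<infinity>"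
    by (rule nn_integral_noteq_infinite[rotated]) measurable
  then show ?thesis by (simp only: infinity_ennreal_def)
qed

lemma G_inner_sums:
  assumes "(\<Sum>j. ennreal \<bar>s j * y j\<bar>) \<noteq> top"
  shows "(\<lambda>j. (s j * (\<xi> \<bullet> e j)) * y j) sums (G y \<bullet> \<xi>)"
proof -
  have "(\<lambda>j. (s j * y j) *\<^sub>R e j) sums G y"
    using summable_sums[OF G_summable(2)[OF assms]] assms by (simp add: G_def)
  from bounded_linear.sums[OF bounded_linear_inner_left this, of \<xi>]
  show ?thesis by (simp add: inner_commute mult_ac)
qed

lemma D_quadratic_sums: "(\<lambda>j. (s j * (\<xi> \<bullet> e j))\<^sup>2) sums (D \<xi> \<bullet> \<xi>)"
proof -
  have "bounded_linear (\<lambda>x. D x \<bullet> \<xi>)"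
    by (rule bounded_linear_compose[OF bounded_linear_inner_left D_linear])
  from bounded_linear.sums[OF this expansion[of \<xi>]]
  show ?thesis
    by (simp add: linear_cmul[OF bounded_linear.linear[OF D_linear]] D_e inner_commute power_mult_distrib power2_eq_square mult_ac)
qed

text \<open>The explicit characteristic functions of the partial sums converge to the Gaussian
  expression with the quadratic form of \<open>D\<close>; dominated convergence identifies the
  limit, as the exponentials have modulus 1.\<close>

lemma centered_gaussian_G:
  assumes t: "t \<ge> 0"
  shows "centered_gaussian (\<lambda>x. t *\<^sub>R D x) (distr std_normal_sequence borel (\<lambda>y. sqrt t *\<^sub>R G y))"
proof -
  have m[measurable]: "(\<lambda>y. sqrt t *\<^sub>R G y) \<in> borel_measurable std_normal_sequence"
    by (rule borel_measurable_coordI) simp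
  show ?thesis
    unfolding centered_gaussian_def
  proof (intro conjI allI)
    show "prob_space (distr std_normal_sequence borel (\<lambda>y. sqrt t *\<^sub>R G y))"
      by (rule std_seq.P.prob_space_distr[OF m])
    fix \<xi>
    define c where "c j = sqrt t * (s j * (\<xi> \<bullet> e j))" for j
    have "(\<lambda>n. \<integral>y. iexp (\<Sum>j<n. c j * y j) \<partial>std_normal_sequence) \<longlonglongrightarrow>
        (\<integral>y. iexp ((sqrt t *\<^sub>R G y) \<bullet> \<xi>) \<partial>std_normal_sequence)"
    proof (rule integral_dominated_convergence[where w = "\<lambda>_. 1"])
      show "AE y in std_normal_sequence. (\<lambda>n. iexp (\<Sum>j<n. c j * y j)) \<longlonglongrightarrow> iexp ((sqrt t *\<^sub>R G y) \<bullet> \<xi>)"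
        using AE_G_finite
      proof eventually_elim
        case (elim y)
        from sums_mult[OF G_inner_sums[OF elim, of \<xi>], of "sqrt t"]
        have "(\<lambda>j. c j * y j) sums ((sqrt t *\<^sub>R G y) \<bullet> \<xi>)" by (simp add: c_def mult.assoc)
        then show ?case unfolding sums_def by (intro tendsto_intros)
      qed
      show "(\<lambda>y. iexp (\<Sum>j<n. c j * y j)) \<in> borel_measurable std_normal_sequence" for n by measurable
      show "(\<lambda>y. iexp ((sqrt t *\<^sub>R G y) \<bullet> \<xi>)) \<in> borel_measurable std_normal_sequence"
        using measurable_compose[OF m borel_measurable_inner] by measurable
    qed simp_all
    moreover have "(\<lambda>n. \<integral>y. iexp (\<Sum>j<n. c j * y j) \<partial>std_normal_sequence) \<longlonglongrightarrow>
        complex_of_real (exp (- (t *\<^sub>R D \<xi> \<bullet> \<xi>) / 2))"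
    proof -
      have "(\<lambda>j. (c j)\<^sup>2) sums (t *\<^sub>R D \<xi> \<bullet> \<xi>)"
        using sums_mult[OF D_quadratic_sums[of \<xi>], of t] t by (simp add: c_def power_mult_distrib)
      then show ?thesis
        unfolding std_normal_sequence_char sums_def by (intro tendsto_intros) simp_all
    qed
    ultimately have "(\<integral>y. iexp ((sqrt t *\<^sub>R G y) \<bullet> \<xi>) \<partial>std_normal_sequence) = complex_of_real (exp (- (t *\<^sub>R D \<xi> \<bullet> \<xi>) / 2))"
      by (rule LIMSEQ_unique)
    then show "(\<integral>x. iexp (x \<bullet> \<xi>) \<partial>distr std_normal_sequence borel (\<lambda>y. sqrt t *\<^sub>R G y)) =
        complex_of_real (exp (- (t *\<^sub>R D \<xi> \<bullet> \<xi>) / 2))"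
      by (subst integral_distr[OF m]) auto
  qed simp
qed

end

section \<open>Nuclearity and the square root of a diagonal operator\<close>

context onb
begin

lemma parseval: "(\<lambda>j. (x \<bullet> e j) * (y \<bullet> e j)) sums (x \<bullet> y)"
  using bounded_linear.sums[OF bounded_linear_inner_right expansion[of y], of x] by (simp add: mult.commute)

text \<open>The partial sums of \<open>s\<close> are partial traces of \<open>T\<close>.
  Cauchy-Schwarz and Bessel bound the contribution of each rank-one term by
  \<open>norm (x n) * norm (y n)\<close>, uniformly in \<open>N\<close>.\<close>

lemma nuclear_diagonal_summable:
  assumes "nuclear T" and T: "\<And>j. T (e j) = s j *\<^sub>R e j" and s: "\<And>j. 0 \<le> s j"
  shows "summable s"
proof -
  from assms(1) obtain x y where xy: "summable (\<lambda>n. norm (x n) * norm (y n))"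
    and sums: "\<And>v. (\<lambda>n. (v \<bullet> x n) *\<^sub>R y n) sums T v"
    unfolding nuclear_def by blast
  have "(\<Sum>j<N. s j) \<le> (\<Sum>n. norm (x n) * norm (y n))" for N
  proof -
    have "(\<lambda>n. (e j \<bullet> x n) * (y n \<bullet> e j)) sums s j" for j
      using bounded_linear.sums[OF bounded_linear_inner_left sums[of "e j"], of "e j"] by (simp add: T)
    then have sm: "(\<lambda>n. \<Sum>j<N. (e j \<bullet> x n) * (y n \<bullet> e j)) sums (\<Sum>j<N. s j)"
      by (intro sums_sum)
    have "(\<Sum>j<N. (e j \<bullet> x n) * (y n \<bullet> e j)) \<le> norm (x n) * norm (y n)" for n
    proof -
      have "(\<Sum>j<N. (x n \<bullet> e j) * (y n \<bullet> e j))\<^sup>2 \<le> (\<Sum>j<N. (x n \<bullet> e j)\<^sup>2) * (\<Sum>j<N. (y n \<bullet> e j)\<^sup>2)"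
        by (rule Cauchy_Schwarz_ineq_sum)
      also have "\<dots> \<le> (norm (x n))\<^sup>2 * (norm (y n))\<^sup>2"
        by (intro mult_mono bessel sum_nonneg) auto
      finally have "(\<Sum>j<N. (x n \<bullet> e j) * (y n \<bullet> e j))\<^sup>2 \<le> (norm (x n) * norm (y n))\<^sup>2"
        by (simp add: power_mult_distrib)
      then have "(\<Sum>j<N. (x n \<bullet> e j) * (y n \<bullet> e j)) \<le> norm (x n) * norm (y n)"
        by (rule power2_le_imp_le) simp
      then show ?thesis by (simp add: inner_commute)
    qed
    then show ?thesis by (intro sums_le[OF _ sm summable_sums[OF xy]])
  qed
  then show ?thesis by (rule summableI_nonneg_bounded[OF s])
qed

text \<open>The diagonal operator with entries \<open>sqrt (d j)\<close> is a root, bounded because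
  the eigenvalues are at most the bound of \<open>D\<close>. Any other positive root agrees with it
  on the basis vectors, hence everywhere.\<close>

lemma sqrt_op_diagonal:
  assumes D: "selfadjoint D" "positive_definite D" and De: "\<And>j. D (e j) = d j *\<^sub>R e j"
  shows "d j > 0" and "sqrt_op D (e j) = sqrt (d j) *\<^sub>R e j"
proof -
  have lin: "bounded_linear D" and sa: "\<And>x y. D x \<bullet> y = x \<bullet> D y" using D(1) by (auto simp: selfadjoint_def)
  have d_pos: "d j > 0" for j
  proof -
    have "e j \<noteq> 0" using norm_e[of j] by force
    then have "D (e j) \<bullet> e j > 0" using D(2) by (simp add: positive_definite_def)
    then show ?thesis by (simp add: De)
  qed
  obtain K where K: "\<And>x. norm (D x) \<le> norm x * K" using bounded_linear.bounded[OF lin] by blast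
  have dK: "d j \<le> K" for j using K[of "e j"] d_pos[of j] by (simp add: De)
  define R where "R x = (\<Sum>j. (sqrt (d j) * (x \<bullet> e j)) *\<^sub>R e j)" for x
  have le: "(sqrt (d j) * (x \<bullet> e j))\<^sup>2 \<le> K * (x \<bullet> e j)\<^sup>2" for x j
    using dK[of j] d_pos[of j] by (simp add: power_mult_distrib mult_right_mono)
  have Re: "R x \<bullet> e j = sqrt (d j) * (x \<bullet> e j)" for x j
    unfolding R_def
  proof (rule suminf_inner_e, rule ell2_vector)
    show "summable (\<lambda>j. (sqrt (d j) * (x \<bullet> e j))\<^sup>2)"
      by (rule summable_comparison_test'[OF summable_mult[OF summable_coord_sq[of x], of K], of 0]) (simp only: real_norm_def abs_power2 le)
  qed
  have K0: "K \<ge> 0" using dK[of 0] d_pos[of 0] by simp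
  have R_lin: "bounded_linear R"
  proof (rule bounded_linear_intro[where K = "sqrt K"])
    show "R (x + y) = R x + R y" for x y by (rule coord_ext) (simp add: Re inner_add_left algebra_simps)
    show "R (r *\<^sub>R x) = r *\<^sub>R R x" for r x by (rule coord_ext) (simp add: Re)
    show "norm (R x) \<le> norm x * sqrt K" for x
    proof -
      have "R x \<bullet> R x \<le> K * (x \<bullet> x)"
      proof (rule sums_le[OF _ parseval[of "R x" "R x"] sums_mult[OF parseval[of x x], of K]])
        show "(R x \<bullet> e j) * (R x \<bullet> e j) \<le> K * ((x \<bullet> e j) * (x \<bullet> e j))" for j
          using le[of j x] by (simp only: Re power2_eq_square)
      qed
      then show ?thesis unfolding norm_eq_sqrt_inner
        by (simp add: real_sqrt_mult[symmetric] mult.commute)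
    qed
  qed
  have "selfadjoint R \<and> (\<forall>x. R x \<bullet> x \<ge> 0) \<and> R \<circ> R = D"
  proof (intro conjI allI)
    show "selfadjoint R"
      unfolding selfadjoint_def
    proof (intro conjI allI R_lin)
      fix x y
      show "R x \<bullet> y = x \<bullet> R y"
        using parseval[of "R x" y] parseval[of x "R y"] by (simp add: Re mult_ac sums_unique2)
    qed
    show "R x \<bullet> x \<ge> 0" for x
      by (rule sums_le[OF _ sums_zero parseval[of "R x" x]]) (simp add: Re mult.assoc less_imp_le d_pos)
    show "R \<circ> R = D"
    proof
      fix x
      show "(R \<circ> R) x = D x"
        by (rule coord_ext) (use d_pos in \<open>simp add: Re sa De mult.assoc[symmetric] less_imp_le\<close>)
    qed
  qed
  moreover have root: "R' (e j) = sqrt (d j) *\<^sub>R e j"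
    if R': "selfadjoint R'" "\<forall>x. R' x \<bullet> x \<ge> 0" "R' \<circ> R' = D" for R' j
  proof -
    interpret R': bounded_linear R' using R'(1) by (simp add: selfadjoint_def)
    \<comment> \<open>\<open>(R' + sqrt (d j)) z = 0\<close>, and \<open>R' + sqrt (d j)\<close> is positive definite\<close>
    define z where "z = R' (e j) - sqrt (d j) *\<^sub>R e j"
    have "R' (R' (e j)) = d j *\<^sub>R e j" using R'(3) De by (auto simp: fun_eq_iff)
    then have "R' z + sqrt (d j) *\<^sub>R z = 0"
      using d_pos[of j] by (simp add: z_def R'.diff R'.scaleR algebra_simps)
    then have "R' z \<bullet> z + sqrt (d j) * (z \<bullet> z) = 0"
      by (metis inner_add_left inner_scaleR_left inner_zero_left)
    moreover have "0 \<le> R' z \<bullet> z" "0 \<le> sqrt (d j) * (z \<bullet> z)" using R'(2) d_pos[of j] by auto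
    ultimately have "sqrt (d j) * (z \<bullet> z) = 0" by linarith
    then have "z = 0" using d_pos[of j] by simp
    then show ?thesis by (simp add: z_def)
  qed
  ultimately have "sqrt_op D = R"
    unfolding sqrt_op_def
  proof (intro the_equality)
    fix R' assume R': "selfadjoint R' \<and> (\<forall>x. R' x \<bullet> x \<ge> 0) \<and> R' \<circ> R' = D"
    have "R (e j) = sqrt (d j) *\<^sub>R e j" for j by (rule coord_ext) (simp add: Re e_inner)
    then show "R' = R"
      using root R' by (intro bounded_linear_eqI R_lin) (auto simp: selfadjoint_def)
  qed simp
  then show "sqrt_op D (e j) = sqrt (d j) *\<^sub>R e j" by (simp add: coord_ext Re e_inner)
  show "d j > 0" by (rule d_pos)
qed

end

section \<open>The averaged shifts\<close>

lemma norm_integral_le: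
  fixes f :: "'w \<Rightarrow> 'b::{banach, second_countable_topology}"
  assumes "integrable M f" "integrable M g" "\<And>x. norm (f x) \<le> g x"
  shows "norm (\<integral>x. f x \<partial>M) \<le> (\<integral>x. g x \<partial>M)"
  using integral_norm_bound[of M f] integral_mono[OF integrable_norm[OF assms(1)] assms(2,3)]
  by (rule order_trans)

context shift_space
begin

lemma cmod_cinner_S_le: "cmod (cinner (S h f) g) \<le> norm f * norm g"
  using norm_cinner_le[of "S h f" g] by simp

lemma integrable_cinner_S:
  assumes "prob_space M" "sets M = sets borel"
  shows "integrable M (\<lambda>h. cinner (S h f) g)"
proof -
  interpret prob_space M by fact
  note [measurable_cong] = assms(2)
  have "(\<lambda>h. cinner (S h f) g) \<in> borel_measurable M"
    using borel_measurable_cinner_S measurable_cong_sets[OF assms(2) refl] by blast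
  then show ?thesis
    by (intro integrable_const_bound[where B = "norm f * norm g"]) (simp_all add: cmod_cinner_S_le)
qed

text \<open>The integral is obtained as the Riesz vector of the averaged scalar product; the
  isometry of the shifts bounds that functional by \<open>norm f\<close>.\<close>

lemma pettis_integral_exists:
  assumes M: "prob_space M" "sets M = sets borel"
  shows "\<exists>y. has_pettis_integral M (\<lambda>h. S h f) y"
proof -
  interpret prob_space M by fact
  note int = integrable_cinner_S[OF M]
  \<comment> \<open>Conjugation makes the functional complex linear, as \<open>cinner\<close> is
    conjugate linear in its second argument.\<close>
  define \<psi> where "\<psi> g = cnj (\<integral>h. cinner (S h f) g \<partial>M)" for g
  have "bounded_cfunctional \<psi>"
    unfolding bounded_cfunctional_def
  proof (intro conjI allI)
    show sc: "\<psi> (c *\<^sub>C g) = c * \<psi> g" for c g by (simp add: \<psi>_def cinner_scaleC_right)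
    show "bounded_linear \<psi>"
    proof (rule bounded_linear_intro[where K = "norm f"])
      show "\<psi> (g + g') = \<psi> g + \<psi> g'" for g g' by (simp add: \<psi>_def cinner_add_right int)
      show "\<psi> (r *\<^sub>R g) = r *\<^sub>R \<psi> g" for r g by (simp add: scaleR_scaleC sc scaleR_conv_of_real)
      fix g
      have "cmod (\<integral>h. cinner (S h f) g \<partial>M) \<le> (\<integral>h. norm f * norm g \<partial>M)"
        by (rule norm_integral_le) (simp_all add: int cmod_cinner_S_le)
      then show "norm (\<psi> g) \<le> norm g * norm f" by (simp add: \<psi>_def prob_space mult.commute)
    qed
  qed
  then obtain y where y: "\<And>g. \<psi> g = cinner g y" using riesz by blast
  have "has_pettis_integral M (\<lambda>h. S h f) y"
    unfolding has_pettis_integral_def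
  proof (intro allI impI)
    fix \<phi> :: "'h \<Rightarrow> complex" assume "bounded_cfunctional \<phi>"
    then obtain g where g: "\<And>x. \<phi> x = cinner x g" using riesz by blast
    have "cinner y g = cnj (\<psi> g)" unfolding y by (rule cinner_commute)
    then show "integrable M (\<lambda>h. \<phi> (S h f)) \<and> (\<integral>h. \<phi> (S h f) \<partial>M) = \<phi> y"
      unfolding g by (simp add: int \<psi>_def)
  qed
  then show ?thesis by blast
qed

lemma pettis_integral_cinner:
  assumes "has_pettis_integral M (\<lambda>h. S h f) y"
  shows "cinner y g = (\<integral>h. cinner (S h f) g \<partial>M)"
  using assms[unfolded has_pettis_integral_def, rule_format, OF bounded_cfunctional_cinner] by simp

text \<open>Resolves both definite descriptions at once. Since scalar products separate vectors,
  later identities for the averaged shifts are all derived from this formula.\<close>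

lemma cinner_averaged_shift:
  assumes M: "centered_gaussian C M"
  shows "cinner (averaged_shift e \<iota> C f) g = (\<integral>h. cinner (S h f) g \<partial>M)"
proof -
  have pM: "prob_space M" "sets M = sets borel" using M by (auto simp: centered_gaussian_def)
  have "\<exists>!y. has_pettis_integral (gaussian_measure C) (\<lambda>h. S h f) y"
    unfolding gaussian_measure_eq[OF M]
  proof (rule ex_ex1I[OF pettis_integral_exists[OF pM]])
    fix y y' assume "has_pettis_integral M (\<lambda>h. S h f) y" "has_pettis_integral M (\<lambda>h. S h f) y'"
    then show "y = y'" by (intro cinner_ext) (simp add: pettis_integral_cinner)
  qed
  from theI'[OF this]
  have "has_pettis_integral M (\<lambda>h. S h f) (averaged_shift e \<iota> C f)"
    unfolding averaged_shift_def gaussian_measure_eq[OF M] .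
  then show ?thesis by (rule pettis_integral_cinner)
qed

lemma bounded_clinear_averaged_shift:
  assumes M: "centered_gaussian C M"
  shows "bounded_clinear (averaged_shift e \<iota> C)"
proof -
  have pM: "prob_space M" "sets M = sets borel" using M by (auto simp: centered_gaussian_def)
  interpret prob_space M by fact
  note int = integrable_cinner_S[OF pM] and ci = cinner_averaged_shift[OF M]
  let ?U = "averaged_shift e \<iota> C"
  have sc: "?U (c *\<^sub>C f) = c *\<^sub>C ?U f" for c f
    by (rule cinner_ext) (simp add: ci cinner_scaleC_left S_scale)
  have "bounded_linear ?U"
  proof (rule bounded_linear_intro[where K = 1])
    show "?U (f + f') = ?U f + ?U f'" for f f'
      by (rule cinner_ext) (simp add: ci cinner_add_left S_add int)
    show "?U (r *\<^sub>R f) = r *\<^sub>R ?U f" for r f by (simp add: scaleR_scaleC sc)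
    fix f
    \<comment> \<open>Testing \<open>?U f\<close> against itself gives contractivity after
      cancelling one factor \<open>norm (?U f)\<close>.\<close>
    have "cmod (cinner (?U f) (?U f)) \<le> (\<integral>h. norm f * norm (?U f) \<partial>M)"
      unfolding ci by (rule norm_integral_le) (simp_all add: int cmod_cinner_S_le)
    then have "norm (?U f) * norm (?U f) \<le> norm f * norm (?U f)"
      by (simp add: cinner_self prob_space norm_mult power2_eq_square)
    then show "norm (?U f) \<le> norm f * 1"
      by (cases "?U f = 0") (simp_all add: mult_le_cancel_right)
  qed
  then show ?thesis using sc by (simp add: bounded_clinear_def)
qed

text \<open>The sum of the covariances belongs to the convolution, so Fubini yields a double
  integral over \<open>h + k\<close>.\<close>

lemma averaged_shift_add:
  assumes M: "centered_gaussian C M" and N: "centered_gaussian C' N"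
  shows "averaged_shift e \<iota> (\<lambda>x. C x + C' x) f = averaged_shift e \<iota> C (averaged_shift e \<iota> C' f)"
proof (rule cinner_ext)
  fix g
  have pM: "prob_space M" "sets M = sets borel" and pN: "prob_space N" "sets N = sets borel"
    using M N by (auto simp: centered_gaussian_def)
  interpret M: prob_space M by fact
  interpret N: prob_space N by fact
  interpret pair_prob_space M N ..
  have plus: "(\<lambda>(x, y). x + y) \<in> borel_measurable (M \<Otimes>\<^sub>M N)"
    using measurable_plus_pair measurable_cong_sets[OF sets_pair_measure_cong[OF pM(2) pN(2)] refl] by blast
  have m: "(\<lambda>(h, k). cinner (S (h + k) f) g) \<in> borel_measurable (M \<Otimes>\<^sub>M N)"
    using measurable_compose[OF plus borel_measurable_cinner_S[of f g]] by (simp add: split_beta)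
  have int: "integrable (M \<Otimes>\<^sub>M N) (\<lambda>(h, k). cinner (S (h + k) f) g)"
    by (rule integrable_const_bound[OF _ m, where B = "norm f * norm g"]) (auto simp: cmod_cinner_S_le)
  have "cinner (averaged_shift e \<iota> (\<lambda>x. C x + C' x) f) g =
      (\<integral>h. cinner (S h f) g \<partial>distr (M \<Otimes>\<^sub>M N) borel (\<lambda>(x, y). x + y))"
    by (rule cinner_averaged_shift[OF centered_gaussian_convolution[OF M N]])
  also have "\<dots> = (\<integral>(h, k). cinner (S (h + k) f) g \<partial>(M \<Otimes>\<^sub>M N))"
    by (subst integral_distr[OF plus borel_measurable_cinner_S]) (simp add: case_prod_unfold)
  also have "\<dots> = (\<integral>h. \<integral>k. cinner (S (h + k) f) g \<partial>N \<partial>M)"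
    using integral_fst'[OF int] by simp
  \<comment> \<open>Moving \<open>S h\<close> to the other side as its adjoint
    \<open>S (- h)\<close> leaves an inner integral that is the scalar formula for \<open>C'\<close>
    with a shifted test vector.\<close>
  also have "\<dots> = (\<integral>h. cinner (averaged_shift e \<iota> C' f) (S (- h) g) \<partial>M)"
    unfolding cinner_averaged_shift[OF N] by (simp only: S_S[symmetric] cinner_S[symmetric] minus_minus)
  also have "\<dots> = (\<integral>h. cinner (S h (averaged_shift e \<iota> C' f)) g \<partial>M)" by (simp add: cinner_S)
  also have "\<dots> = cinner (averaged_shift e \<iota> C (averaged_shift e \<iota> C' f)) g"
    by (rule cinner_averaged_shift[OF M, symmetric])
  finally show "cinner (averaged_shift e \<iota> (\<lambda>x. C x + C' x) f) g =
      cinner (averaged_shift e \<iota> C (averaged_shift e \<iota> C' f)) g" .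
qed

end

section \<open>The semigroup laws and strong continuity\<close>

locale shift_semigroup = shift_space e \<iota> + diag_gauss e s D
  for e :: "nat \<Rightarrow> 'a::{real_inner,complete_space}" and \<iota> :: "('a \<Rightarrow> complex) \<Rightarrow> 'h::complex_hilbert" and s D
begin

abbreviation U :: "real \<Rightarrow> 'h \<Rightarrow> 'h" where
  "U t \<equiv> averaged_shift e \<iota> (\<lambda>x. t *\<^sub>R D x)"

lemma measurable_scaled_G: "(\<lambda>y. r *\<^sub>R G y) \<in> borel_measurable std_normal_sequence"
  by (rule borel_measurable_coordI) simp

lemma cinner_U:
  assumes "t \<ge> 0"
  shows "cinner (U t f) g = (\<integral>y. cinner (S (sqrt t *\<^sub>R G y) f) g \<partial>std_normal_sequence)"
  unfolding cinner_averaged_shift[OF centered_gaussian_G[OF assms]]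
  by (rule integral_distr[OF measurable_scaled_G borel_measurable_cinner_S])

lemma U_0: "U 0 f = f"
  using cinner_U[of 0 f] by (intro cinner_ext) (simp add: S_0 std_seq.P.prob_space)

lemma U_add:
  assumes "u \<ge> 0" "t \<ge> 0"
  shows "U (u + t) f = U u (U t f)"
  using averaged_shift_add[OF centered_gaussian_G[OF assms(1)] centered_gaussian_G[OF assms(2)]]
  by (simp add: scaleR_left_distrib)

lemma norm_S_diff_le: "norm (S h f - f) \<le> 2 * norm f"
  using norm_triangle_ineq4[of "S h f" f] by simp

lemma measurable_norm_S_scaled_G:
  "(\<lambda>y. norm (S (r *\<^sub>R G y) f - f)) \<in> borel_measurable std_normal_sequence"
  by (rule measurable_compose[OF measurable_scaled_G borel_measurable_norm_S_diff])

text \<open>The difference is tested against itself. On the common sample space, factoring out the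
  isometry \<open>S (sqrt u *\<^sub>R G y)\<close> leaves one small shift along the ray of
  \<open>G y\<close>.\<close>

lemma norm_U_diff_le:
  assumes "t \<ge> 0" "u \<ge> 0"
  shows "norm (U t f - U u f) \<le> (\<integral>y. norm (S ((sqrt t - sqrt u) *\<^sub>R G y) f - f) \<partial>std_normal_sequence)"
    (is "_ \<le> ?I")
proof -
  define d where "d = U t f - U u f"
  have int: "integrable std_normal_sequence (\<lambda>y. cinner (S (r *\<^sub>R G y) f) d)" for r
    using measurable_compose[OF measurable_scaled_G borel_measurable_cinner_S]
    by (intro std_seq.P.integrable_const_bound[where B = "norm f * norm d"]) (simp_all add: cmod_cinner_S_le)
  have iq: "integrable std_normal_sequence (\<lambda>y. norm (S (r *\<^sub>R G y) f - f))" for r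
    by (intro std_seq.P.integrable_const_bound[where B = "2 * norm f"] measurable_norm_S_scaled_G)
      (simp add: norm_S_diff_le)
  have dd: "cinner d d = (\<integral>y. cinner (S (sqrt t *\<^sub>R G y) f) d - cinner (S (sqrt u *\<^sub>R G y) f) d \<partial>std_normal_sequence)"
    unfolding d_def[THEN arg_cong, of "\<lambda>x. cinner x d"] cinner_diff_left
    by (simp add: cinner_U assms int)
  have "cmod (cinner d d) \<le> (\<integral>y. norm (S ((sqrt t - sqrt u) *\<^sub>R G y) f - f) * norm d \<partial>std_normal_sequence)"
    unfolding dd
  proof (rule norm_integral_le)
    fix y
    have "S (sqrt t *\<^sub>R G y) f - S (sqrt u *\<^sub>R G y) f = S (sqrt u *\<^sub>R G y) (S ((sqrt t - sqrt u) *\<^sub>R G y) f - f)"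
      by (simp add: S_diff S_S scaleR_left_diff_distrib)
    then have "norm (S (sqrt t *\<^sub>R G y) f - S (sqrt u *\<^sub>R G y) f) = norm (S ((sqrt t - sqrt u) *\<^sub>R G y) f - f)"
      by simp
    then show "cmod (cinner (S (sqrt t *\<^sub>R G y) f) d - cinner (S (sqrt u *\<^sub>R G y) f) d) \<le>
        norm (S ((sqrt t - sqrt u) *\<^sub>R G y) f - f) * norm d"
      unfolding cinner_diff_left[symmetric] using norm_cinner_le[of "S (sqrt t *\<^sub>R G y) f - S (sqrt u *\<^sub>R G y) f" d]
      by simp
  qed (simp_all add: int iq)
  then have "norm d * norm d \<le> ?I * norm d"
    by (simp add: cinner_self norm_mult power2_eq_square)
  moreover have "0 \<le> ?I" by simp
  ultimately have "norm d \<le> ?I"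
    by (cases "d = 0") (simp_all add: mult_le_cancel_right)
  then show ?thesis by (simp add: d_def)
qed

text \<open>Sequential continuity makes dominated convergence applicable, with the constant bound
  \<open>2 * norm f\<close>; the integrand tends to 0 at every \<open>y\<close> because
  \<open>G y\<close> always has absolutely summable coordinates.\<close>

lemma continuous_on_U: "continuous_on {0..} (\<lambda>t. U t f)"
  unfolding continuous_on_sequentially
proof (intro allI ballI impI)
  fix x :: "nat \<Rightarrow> real" and a assume a: "a \<in> {0..}" and x: "(\<forall>n. x n \<in> {0..}) \<and> x \<longlonglongrightarrow> a"
  have r: "(\<lambda>n. sqrt (x n) - sqrt a) \<longlonglongrightarrow> 0"
    using tendsto_diff[OF tendsto_real_sqrt[OF conjunct2[OF x]] tendsto_const, of "sqrt a"] by simp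
  have "(\<lambda>n. \<integral>y. norm (S ((sqrt (x n) - sqrt a) *\<^sub>R G y) f - f) \<partial>std_normal_sequence) \<longlonglongrightarrow>
      (\<integral>y. 0 \<partial>std_normal_sequence)"
  proof (rule integral_dominated_convergence[where w = "\<lambda>_. 2 * norm f"])
    show "AE y in std_normal_sequence. (\<lambda>n. norm (S ((sqrt (x n) - sqrt a) *\<^sub>R G y) f - f)) \<longlonglongrightarrow> 0"
    proof (rule AE_I2)
      fix y
      show "(\<lambda>n. norm (S ((sqrt (x n) - sqrt a) *\<^sub>R G y) f - f)) \<longlonglongrightarrow> 0"
        using S_ray_LIMSEQ[OF G_ell1 r, of y f] by (intro tendsto_norm_zero LIM_zero)
    qed
  qed (simp_all add: norm_S_diff_le measurable_norm_S_scaled_G)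
  then have lim: "(\<lambda>n. \<integral>y. norm (S ((sqrt (x n) - sqrt a) *\<^sub>R G y) f - f) \<partial>std_normal_sequence) \<longlonglongrightarrow> 0"
    by simp
  have "norm (U (x n) f - U a f) \<le> (\<integral>y. norm (S ((sqrt (x n) - sqrt a) *\<^sub>R G y) f - f) \<partial>std_normal_sequence)" for n
    using a x by (intro norm_U_diff_le) simp_all
  then have "(\<lambda>n. U (x n) f - U a f) \<longlonglongrightarrow> 0"
    by (rule Lim_null_comparison[OF always_eventually[OF allI] lim])
  then show "((\<lambda>t. U t f) \<circ> x) \<longlonglongrightarrow> U a f" unfolding o_def by (rule LIM_zero_cancel)
qed

lemma strongly_continuous_semigroup_U: "strongly_continuous_semigroup U"
  unfolding strongly_continuous_semigroup_def
proof (intro conjI allI impI)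
  show "bounded_clinear (U t)" if "t \<ge> 0" for t
    by (rule bounded_clinear_averaged_shift[OF centered_gaussian_G[OF that]])
qed (simp_all only: U_0 U_add continuous_on_U)

end

theorem corollary5p1:
  fixes e :: "nat \<Rightarrow> 'a::{real_inner,complete_space}"
    and \<iota> :: "('a \<Rightarrow> complex) \<Rightarrow> 'h::complex_hilbert"
    and D :: "'a \<Rightarrow> 'a"
  assumes "orthonormal_basis e"
    and "is_HE e \<iota>"
    and "selfadjoint D" and "positive_definite D" and "nuclear D"
    and "\<forall>k. \<exists>d. D (e k) = d *\<^sub>R e k"
    and "nuclear (sqrt_op D)"
  shows "strongly_continuous_semigroup (\<lambda>t. averaged_shift e \<iota> (\<lambda>x. t *\<^sub>R D x))"
proof -
  interpret onb e by unfold_locales fact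
  obtain d where d: "\<And>k. D (e k) = d k *\<^sub>R e k" using assms(6) by metis
  note sq = sqrt_op_diagonal[OF assms(3,4) d]
  interpret D: bounded_linear D using assms(3) by (simp add: selfadjoint_def)
  \<comment> \<open>The entries \<open>sqrt (d j)\<close> are the eigenvalues of
    \<open>sqrt_op D\<close>, so its assumed nuclearity is their summability.\<close>
  have "shift_semigroup e \<iota> (\<lambda>j. sqrt (d j)) D"
  proof unfold_locales
    show "is_HE e \<iota>" by fact
    show "0 \<le> sqrt (d j)" for j using sq(1)[of j] by simp
    then show "summable (\<lambda>j. sqrt (d j))" by (rule nuclear_diagonal_summable[OF assms(7) sq(2)])
    show "D (e j) = (sqrt (d j))\<^sup>2 *\<^sub>R e j" for j using sq(1)[of j] by (simp add: d)
  qed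
  then show ?thesis by (rule shift_semigroup.strongly_continuous_semigroup_U)
qed

end
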